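(* Let $S_{\mathbf c,r}\subset\mathbb R^3$ be a canal surface with non-linear (i.e. not contained in a straight line) spine curve $\mathbf c$ and radius function $r$, and suppose that $S_{\mathbf c,r}$ is not a Dupin cyclide. Let $\mathbf f(\mathbf x)=\mathbf Q\mathbf x+\mathbf b$ be an isometry of $\mathbb R^3$ ($\mathbf Q$ orthogonal, $\mathbf b\in\mathbb R^3$). Then $\mathbf f$ is a symmetry of $S_{\mathbf c,r}$ (i.e. $\mathbf f(S_{\mathbf c,r})=S_{\mathbf c,r}$) if and only if there exists a Möbius transformation $\varphi$ such that both of the following hold (as identities of rational functions): (C1) $\mathbf f\circ\mathbf c=\mathbf c\circ\varphi$; (C2) $r^2=(r\circ\varphi)^2$.
   Context: A Möbius transformation is a real rational function $\varphi(t)=\frac{\alpha t+\beta}{\gamma t+\delta}$ with $\alpha,\beta,\gamma,\delta\in\mathbb R$, $\alpha\delta-\beta\gamma\ne0$ (the identity is allowed). Canal surfaces. Let $\mathbf c$ be a real rational parametrized curve in $\mathbb R^3$ (the spine curve) and $r$ a real rational function (the radius function). Standing assumptions: $\mathbf c$ is proper (birational onto its image, equivalently injective except for finitely many parameter values), and $\|\dot{\mathbf c}(t)\|^2>\dot r(t)^2$ for all real $t$ at which $\mathbf c$ and $r$ are defined. The canal surface $S_{\mathbf c,r}$ is the envelope of the family of spheres with center $\mathbf c(t)$ and radius $r(t)$: it is the irreducible real surface (understood as the Zariski closure in $\mathbb R^3$) swept out by the characteristic circles $$k(t)=\{\mathbf x\in\mathbb R^3:\ \|\mathbf x-\mathbf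 c(t)\|^2-r(t)^2=0,\ \langle \mathbf x-\mathbf c(t),\dot{\mathbf c}(t)\rangle+r(t)\dot r(t)=0\}.$$ Replacing $r$ by $-r$ gives the same surface. Dupin cyclides are exactly the canal surfaces that are envelopes of two different one-parameter families of spheres, with distinct spine curves; a canal surface that is not a Dupin cyclide has a unique spine curve. *)

theory Defs
  imports
    "HOL-Analysis.Analysis"
    "HOL-Computational_Algebra.Normalized_Fraction"
    "HOL-Computational_Algebra.Polynomial_Factorial"
    "HOL-Computational_Algebra.Field_as_Ring"
begin

section \<open>Real rational functions\<close>

text \<open>
  Real rational functions are the elements of the field of fractions of the polynomial ring, so
  equality on this type is identity of rational functions. Poles are read off from the
  representation in lowest terms; the value assigned at a pole is irrelevant.
\<close>

type_synonym ratfun = "real poly fract"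

definition ratfun_defined_at :: "ratfun \<Rightarrow> real \<Rightarrow> bool" where
  "ratfun_defined_at h t \<longleftrightarrow> poly (snd (quot_of_fract h)) t \<noteq> 0"

definition ratfun_at :: "ratfun \<Rightarrow> real \<Rightarrow> real" where
  "ratfun_at h t = poly (fst (quot_of_fract h)) t / poly (snd (quot_of_fract h)) t"

definition ratfun_const :: "real \<Rightarrow> ratfun" where
  "ratfun_const a = to_fract [:a:]"

text \<open>
  Substitution of \<open>\<phi>\<close> for the variable, computed in the field of rational functions. It is
  meaningful whenever \<open>\<phi>\<close> is not constant, since then the substituted denominator is nonzero.
\<close>

definition ratfun_compose :: "ratfun \<Rightarrow> ratfun \<Rightarrow> ratfun" where
  "ratfun_compose h \<phi> =
     poly (map_poly ratfun_const (fst (quot_of_fract h))) \<phi> /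
     poly (map_poly ratfun_const (snd (quot_of_fract h))) \<phi>"

definition moebius_transformation :: "ratfun \<Rightarrow> bool" where
  "moebius_transformation \<phi> \<longleftrightarrow>
     (\<exists>\<alpha> \<beta> \<gamma> \<delta>. \<alpha> * \<delta> - \<beta> * \<gamma> \<noteq> 0 \<and> \<phi> = Fract [:\<beta>, \<alpha>:] [:\<delta>, \<gamma>:])"


section \<open>Rational curves in space\<close>

type_synonym ratcurve = "ratfun ^ 3"

definition curve_defined_at :: "ratcurve \<Rightarrow> real \<Rightarrow> bool" where
  "curve_defined_at c t \<longleftrightarrow> (\<forall>i. ratfun_defined_at (c $ i) t)"

definition curve_at :: "ratcurve \<Rightarrow> real \<Rightarrow> real ^ 3" where
  "curve_at c t = (\<chi> i. ratfun_at (c $ i) t)"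

definition curve_image :: "ratcurve \<Rightarrow> (real ^ 3) set" where
  "curve_image c = curve_at c ` {t. curve_defined_at c t}"

definition curve_compose :: "ratcurve \<Rightarrow> ratfun \<Rightarrow> ratcurve" where
  "curve_compose c \<phi> = (\<chi> i. ratfun_compose (c $ i) \<phi>)"

text \<open>The rational curve \<open>f \<circ> c\<close> for the affine map \<open>f x = Q x + b\<close>.\<close>

definition affine_image_curve :: "real ^ 3 ^ 3 \<Rightarrow> real ^ 3 \<Rightarrow> ratcurve \<Rightarrow> ratcurve" where
  "affine_image_curve Q b c =
     (\<chi> i j. ratfun_const (Q $ i $ j)) *v c + (\<chi> i. ratfun_const (b $ i))"

text \<open>
  Birationality onto the image: the parameter is recovered from the point by a rational function
  \<open>P / D\<close> on space. Injectivity up to finitely many real parameters would be weaker: composing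
  \<open>(s, s\<^sup>2, 0)\<close> with \<open>s = t\<^sup>3 + t\<close> gives a regular curve that is injective on the real line but has
  degree three onto its image. (Injectivity has to be read over the complex parameters.)
\<close>

definition proper_curve :: "ratcurve \<Rightarrow> bool" where
  "proper_curve c \<longleftrightarrow>
     (\<exists>P D. real_polynomial_function P \<and> real_polynomial_function D \<and>
        (\<forall>\<^sub>F t in cofinite. curve_defined_at c t \<and> D (curve_at c t) \<noteq> 0 \<and>
            P (curve_at c t) / D (curve_at c t) = t))"


section \<open>Canal surfaces\<close>

definition zariski_closure :: "(real ^ 3) set \<Rightarrow> (real ^ 3) set" where
  "zariski_closure X =
     {x. \<forall>p. real_polynomial_function p \<longrightarrow> (\<forall>y\<in>X. p y = 0) \<longrightarrow> p x = 0}"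

definition spine_curve :: "ratcurve \<Rightarrow> (real ^ 3) set" where
  "spine_curve c = zariski_closure (curve_image c)"

definition sphere_family :: "ratcurve \<Rightarrow> ratfun \<Rightarrow> bool" where
  "sphere_family c r \<longleftrightarrow>
     (\<forall>t. curve_defined_at c t \<longrightarrow> ratfun_defined_at r t \<longrightarrow>
        (norm (vector_derivative (curve_at c) (at t)))\<^sup>2 > (deriv (ratfun_at r) t)\<^sup>2)"

definition char_circle :: "ratcurve \<Rightarrow> ratfun \<Rightarrow> real \<Rightarrow> (real ^ 3) set" where
  "char_circle c r t =
     {x. (norm (x - curve_at c t))\<^sup>2 - (ratfun_at r t)\<^sup>2 = 0 \<and>
         (x - curve_at c t) \<bullet> vector_derivative (curve_at c) (at t)
           + ratfun_at r t * deriv (ratfun_at r) t = 0}"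

definition canal_surface :: "ratcurve \<Rightarrow> ratfun \<Rightarrow> (real ^ 3) set" where
  "canal_surface c r =
     zariski_closure (\<Union>t\<in>{t. curve_defined_at c t \<and> ratfun_defined_at r t}. char_circle c r t)"

text \<open>
  A Dupin cyclide is the envelope of two rational one-parameter families of spheres with distinct
  spine curves. The spine parametrizations of the two families are not required to be proper: in
  the second family of a torus, the spheres centred on the axis come in pairs with the same centre,
  so that a rational parametrization of the family covers the axis twice.
  Spine curves are compared as Zariski closures, so that reparametrizing a family does not change
  its spine curve.
\<close>

definition dupin_cyclide :: "(real ^ 3) set \<Rightarrow> bool" where
  "dupin_cyclide S \<longleftrightarrow>
     (\<exists>c\<^sub>1 r\<^sub>1 c\<^sub>2 r\<^sub>2. sphere_family c\<^sub>1 r\<^sub>1 \<and> sphere_family c\<^sub>2 r\<^sub>2 \<and>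
        S = canal_surface c\<^sub>1 r\<^sub>1 \<and> S = canal_surface c\<^sub>2 r\<^sub>2 \<and>
        spine_curve c\<^sub>1 \<noteq> spine_curve c\<^sub>2)"

end

theory Submission
  imports Defs
begin

text \<open>
  The easy direction is differentiation. If \<open>f \<circ> c = c \<circ> \<phi>\<close> and \<open>r\<^sup>2 = (r \<circ> \<phi>)\<^sup>2\<close>, then \<open>f\<close> maps the
  characteristic circle at \<open>t\<close> onto the one at \<open>\<phi> t\<close> for all but finitely many \<open>t\<close>, because the
  circle is determined by \<open>c\<close>, \<open>c'\<close>, \<open>r\<^sup>2\<close> and \<open>(r\<^sup>2)'\<close>. A polynomial that vanishes on infinitely many
  circles vanishes on all of them, so that finitely many exceptional parameters do not change the
  Zariski closure (\<open>symmetry_of_canal_surface\<close>).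

  Conversely, let \<open>f\<close> be a symmetry of \<open>S\<close>. Then \<open>f\<^sup>-\<^sup>1 \<circ> c\<close> with the same radius is a second family of
  spheres with envelope \<open>S\<close>. Since \<open>S\<close> is not a Dupin cyclide, both families have the same spine
  curve, hence \<open>f\<close> preserves it. Let \<open>P / D\<close> recover the parameter from the point of the spine. With
  denominators cleared, the identity \<open>c (P y / D y) = y\<close> holds on the whole spine curve, in particular
  for \<open>y = f (c t)\<close>, so that \<open>\<phi> t = P (f (c t)) / D (f (c t))\<close> satisfies \<open>f \<circ> c = c \<circ> \<phi>\<close> (\<open>spine_parameter_change\<close>).
  The same construction for \<open>f\<^sup>-\<^sup>1\<close> gives a rational left inverse of \<open>\<phi>\<close>, and a rational function with a
  rational left inverse is a Moebius transformation (\<open>moebius_if_left_invertible\<close>).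

  It remains to compare the radii, and this is the hard part: two families of spheres
  with the same spine curve and the same envelope have the same squared radius at corresponding
  points (\<open>radius_condition\<close>). Two facts from differential geometry are used. The normal of the
  envelope at a point \<open>x\<close> of the circle at \<open>t\<close> is the line through \<open>x\<close> and \<open>c t\<close>
  (\<open>normal_parallel_radius\<close>), and the circle is a line of curvature, so that \<open>c t\<close> is one of the two
  focal points on this normal (\<open>focal_value\<close>). In terms of the gradient \<open>G\<close> and the Hessian of a
  polynomial \<open>p\<close> of least degree that vanishes on \<open>S\<close>, the centre is \<open>x - G x / \<nu>\<close>, where \<open>\<nu>\<close> is a
  root of a quadratic equation with coefficients polynomial in \<open>x\<close>.

  The envelope is given as a Zariski closure only; a priori the real circles of the two families
  need not have a single point in common. Any argument therefore has to pass through polynomial identities on \<open>S\<close>.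
  The quadratic equation makes this possible without algebraic closures. Suppose that the radii
  disagree. Then there is a polynomial relation between \<open>x\<close> and the centre which holds for the second
  family and fails for the first one. Modulo the quadratic equation it becomes \<open>a x * \<nu> + b x = 0\<close>
  with \<open>a\<close> not vanishing identically on \<open>S\<close>. Hence \<open>\<nu> = - b / a\<close> on the second family, and the parameter \<open>s\<close> of
  the second family is a rational function \<open>\<sigma>\<close> of the point \<open>x\<close> of \<open>S\<close> (\<open>rational_parameter\<close>).
  All relations between \<open>x\<close> and \<open>s\<close> now transfer to the points \<open>x\<close> of the first family with
  \<open>\<sigma> x\<close> in place of \<open>s\<close>. In particular, the centre \<open>c2 (\<sigma> x)\<close> lies on the normal at \<open>x\<close>, for
  all but finitely many \<open>x\<close> of a general circle of the first family. If \<open>\<sigma>\<close> takes infinitely many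
  values there, then the whole spine curve lies on the cone of normals along the circle. The axis of
  this cone is the tangent of the spine at its apex \<open>c t\<close>, and its opening angle is positive because of
  \<open>\<bar>r'\<bar> < \<parallel>c'\<parallel>\<close>, so that chords of the spine could not approach the tangent direction
  (\<open>spine_not_in_cone\<close>). Otherwise \<open>\<sigma>\<close> is constant on infinitely many points of the circle, the common
  centre must be \<open>c t\<close>, and the radii agree after all (\<open>corresponding_parameter\<close>).
\<close>

section \<open>Polynomial functions on space\<close>

lemma real_polynomial_function_component [intro]:
  "real_polynomial_function (\<lambda>x :: real^'n. x $ i)"
  by (rule real_polynomial_function.intros(1)) (rule bounded_linear_vec_nth)

lemmas polyfun_intros =
  real_polynomial_function.intros(2-4)
  real_polynomial_function_diff real_polynomial_function_minus real_polynomial_function_power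
  real_polynomial_function_component

lemma real_polynomial_function_inner:
  fixes f g :: "real^3 \<Rightarrow> real^3"
  assumes "\<And>i. real_polynomial_function (\<lambda>x. f x $ i)"
    and "\<And>i. real_polynomial_function (\<lambda>x. g x $ i)"
  shows "real_polynomial_function (\<lambda>x. f x \<bullet> g x)"
  unfolding inner_vec_def sum_3 inner_real_def
  by (intro polyfun_intros assms)

lemma real_polynomial_function_substitute:
  fixes F :: "real^3 \<Rightarrow> real" and g :: "'a::real_normed_vector \<Rightarrow> real^3"
  assumes "real_polynomial_function F"
    and "\<And>i. real_polynomial_function (\<lambda>x. g x $ i)"
  shows "real_polynomial_function (\<lambda>x. F (g x))"
  using assms(1)
proof induction
  case (linear f)
  have "f y = (\<Sum>i\<in>UNIV. y $ i * f (axis i 1))" for y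
  proof -
    have "f y = f (\<Sum>i\<in>UNIV. y $ i *\<^sub>R axis i 1)"
      by (simp add: basis_expansion scalar_mult_eq_scaleR[symmetric])
    also have "\<dots> = (\<Sum>i\<in>UNIV. y $ i * f (axis i 1))"
      using linear by (simp add: linear_sum bounded_linear.linear linear_cmul)
    finally show ?thesis .
  qed
  then have f_eq: "(\<lambda>x. f (g x)) = (\<lambda>x. \<Sum>i\<in>UNIV. g x $ i * f (axis i 1))"
    by (intro ext)
  have "real_polynomial_function (\<lambda>x. \<Sum>i\<in>UNIV. g x $ i * f (axis i 1))"
    by (rule real_polynomial_function_sum)
      (simp_all add: real_polynomial_function.intros(2,4) assms(2))
  then show ?case unfolding f_eq .
qed (intro polyfun_intros; assumption)+

text \<open>
  An upper bound for the total degree. The rule \<open>weaken\<close> makes it monotone, so that sums of functions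
  with different bounds are covered.
\<close>

inductive polyfun_degree :: "nat \<Rightarrow> (real^3 \<Rightarrow> real) \<Rightarrow> bool" where
  const: "polyfun_degree 0 (\<lambda>x. a)"
| coord: "polyfun_degree 1 (\<lambda>x. x $ i)"
| add: "polyfun_degree d f \<Longrightarrow> polyfun_degree d g \<Longrightarrow> polyfun_degree d (\<lambda>x. f x + g x)"
| mult: "polyfun_degree d f \<Longrightarrow> polyfun_degree e g \<Longrightarrow> polyfun_degree (d + e) (\<lambda>x. f x * g x)"
| weaken: "polyfun_degree d f \<Longrightarrow> polyfun_degree (Suc d) f"

lemma polyfun_degree_mono:
  assumes "polyfun_degree d f" "d \<le> e"
  shows "polyfun_degree e f"
  using assms(2,1) by (induction rule: dec_induct) (simp_all add: polyfun_degree.weaken)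

lemma polyfun_degree_imp_polynomial:
  "polyfun_degree d f \<Longrightarrow> real_polynomial_function f"
  by (induction rule: polyfun_degree.induct) (auto intro: polyfun_intros)

lemma polyfun_degree_cmult:
  "polyfun_degree d f \<Longrightarrow> polyfun_degree d (\<lambda>x. a * f x)"
  using polyfun_degree.mult[OF polyfun_degree.const[of a], of d f] by simp

lemma polyfun_degree_sum:
  "finite I \<Longrightarrow> (\<And>i. i \<in> I \<Longrightarrow> polyfun_degree d (f i)) \<Longrightarrow> polyfun_degree d (\<lambda>x. \<Sum>i\<in>I. f i x)"
  by (induction rule: finite_induct)
    (simp_all add: polyfun_degree.add polyfun_degree_mono[OF polyfun_degree.const])

lemma polyfun_degree_power:
  "polyfun_degree n (\<lambda>x. (x $ i) ^ n)"
proof (induction n)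
  case 0
  show ?case using polyfun_degree.const[of 1] by simp
next
  case (Suc n)
  show ?case using polyfun_degree.mult[OF polyfun_degree.coord Suc] by simp
qed

lemma polynomial_imp_polyfun_degree:
  assumes "real_polynomial_function (f :: real^3 \<Rightarrow> real)"
  shows "\<exists>d. polyfun_degree d f"
  using assms
proof induction
  case (linear f)
  have f_eq: "f = (\<lambda>y. \<Sum>i\<in>UNIV. f (axis i 1) * y $ i)"
  proof
    fix y
    have "f y = f (\<Sum>i\<in>UNIV. y $ i *\<^sub>R axis i 1)"
      by (simp add: basis_expansion scalar_mult_eq_scaleR[symmetric])
    also have "\<dots> = (\<Sum>i\<in>UNIV. f (axis i 1) * y $ i)"
      using linear by (simp add: linear_sum bounded_linear.linear linear_cmul mult.commute)
    finally show "f y = (\<Sum>i\<in>UNIV. f (axis i 1) * y $ i)" .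
  qed
  have "polyfun_degree 1 (\<lambda>y. \<Sum>i\<in>UNIV. f (axis i 1) * y $ i)"
    by (intro polyfun_degree_sum polyfun_degree_cmult polyfun_degree.coord) auto
  then show ?case by (subst f_eq) blast
next
  case (const c)
  then show ?case using polyfun_degree.const by blast
next
  case (add f g)
  then obtain d e where "polyfun_degree d f" "polyfun_degree e g" by blast
  then have "polyfun_degree (max d e) f" "polyfun_degree (max d e) g"
    by (meson polyfun_degree_mono max.cobounded1 max.cobounded2)+
  then show ?case using polyfun_degree.add by blast
next
  case (mult f g)
  then show ?case using polyfun_degree.mult by blast
qed

text \<open>
  The bound for the partial derivatives is what the argument with a polynomial of least degree rests
  on. Degree \<open>0\<close> is singled out because there the truncated bound \<open>d - 1\<close> says nothing.
\<close>

lemma polyfun_degree_gradient: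
  assumes "polyfun_degree d F"
  shows "\<exists>G :: real^3 \<Rightarrow> real^3. (\<forall>x. (F has_derivative (\<lambda>h. G x \<bullet> h)) (at x)) \<and>
     (\<forall>i. (d = 0 \<longrightarrow> (\<forall>x. G x $ i = 0)) \<and> polyfun_degree (d - 1) (\<lambda>x. G x $ i))"
  using assms
proof induction
  case (const a)
  show ?case by (rule exI[of _ "\<lambda>x. 0"]) (auto intro: polyfun_degree.const)
next
  case (coord i)
  have "((\<lambda>x::real^3. x $ i) has_derivative (\<lambda>h. axis i 1 \<bullet> h)) (at x)" for x
    by (simp add: inner_axis' bounded_linear_imp_has_derivative bounded_linear_vec_nth)
  then show ?case by (intro exI[of _ "\<lambda>x. axis i 1"]) (auto intro: polyfun_degree.const)
next
  case (add d f g)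
  then obtain G H where G: "\<forall>x. (f has_derivative (\<lambda>h. G x \<bullet> h)) (at x)"
     "\<And>i. (d = 0 \<longrightarrow> (\<forall>x. G x $ i = 0)) \<and> polyfun_degree (d - 1) (\<lambda>x. G x $ i)"
    and H: "\<forall>x. (g has_derivative (\<lambda>h. H x \<bullet> h)) (at x)"
     "\<And>i. (d = 0 \<longrightarrow> (\<forall>x. H x $ i = 0)) \<and> polyfun_degree (d - 1) (\<lambda>x. H x $ i)" by blast
  show ?case
  proof (intro exI[of _ "\<lambda>x. G x + H x"] conjI allI impI)
    show "((\<lambda>x. f x + g x) has_derivative (\<lambda>h. (G x + H x) \<bullet> h)) (at x)" for x
      using G(1) H(1) by (auto simp: inner_add_left intro!: derivative_eq_intros)
  qed (use G(2) H(2) in \<open>auto intro: polyfun_degree.add\<close>)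
next
  case (mult d f e g)
  then obtain G H where G: "\<forall>x. (f has_derivative (\<lambda>h. G x \<bullet> h)) (at x)"
     "\<And>i. (d = 0 \<longrightarrow> (\<forall>x. G x $ i = 0)) \<and> polyfun_degree (d - 1) (\<lambda>x. G x $ i)"
    and H: "\<forall>x. (g has_derivative (\<lambda>h. H x \<bullet> h)) (at x)"
     "\<And>i. (e = 0 \<longrightarrow> (\<forall>x. H x $ i = 0)) \<and> polyfun_degree (e - 1) (\<lambda>x. H x $ i)" by blast
  show ?case
  proof (intro exI[of _ "\<lambda>x. f x *\<^sub>R H x + g x *\<^sub>R G x"] conjI allI impI)
    show "((\<lambda>x. f x * g x) has_derivative (\<lambda>h. (f x *\<^sub>R H x + g x *\<^sub>R G x) \<bullet> h)) (at x)" for x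
      using G(1)[rule_format, of x] H(1)[rule_format, of x]
      by (auto simp: inner_add_left intro!: derivative_eq_intros)
    fix i
    have 1: "polyfun_degree (d + e - 1) (\<lambda>x. f x * H x $ i)"
    proof (cases "e = 0")
      case True
      then have "(\<lambda>x. f x * H x $ i) = (\<lambda>x. 0)" using H(2) by auto
      then show ?thesis by (simp add: polyfun_degree_mono[OF polyfun_degree.const])
    next
      case False
      then have "d + e - 1 = d + (e - 1)" by simp
      then show ?thesis using polyfun_degree.mult[OF mult.hyps(1), of "e - 1" "\<lambda>x. H x $ i"] H(2) by simp
    qed
    have 2: "polyfun_degree (d + e - 1) (\<lambda>x. g x * G x $ i)"
    proof (cases "d = 0")
      case True
      then have "(\<lambda>x. g x * G x $ i) = (\<lambda>x. 0)" using G(2) by auto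
      then show ?thesis by (simp add: polyfun_degree_mono[OF polyfun_degree.const])
    next
      case False
      then have "d + e - 1 = e + (d - 1)" by simp
      then show ?thesis using polyfun_degree.mult[OF mult.hyps(2), of "d - 1" "\<lambda>x. G x $ i"] G(2) by simp
    qed
    show "polyfun_degree (d + e - 1) (\<lambda>x. (f x *\<^sub>R H x + g x *\<^sub>R G x) $ i)"
      using polyfun_degree.add[OF 1 2] by simp
    show "d + e = 0 \<Longrightarrow> (f x *\<^sub>R H x + g x *\<^sub>R G x) $ i = 0" for x
      using G(2) H(2) by simp
  qed
next
  case (weaken d f)
  then obtain G where G: "\<forall>x. (f has_derivative (\<lambda>h. G x \<bullet> h)) (at x)"
     "\<And>i. (d = 0 \<longrightarrow> (\<forall>x. G x $ i = 0)) \<and> polyfun_degree (d - 1) (\<lambda>x. G x $ i)" by blast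
  have "polyfun_degree d (\<lambda>x. G x $ i)" for i
    using G(2)[of i] polyfun_degree_mono[of "d - 1" _ d] by simp
  with G(1) show ?case by (intro exI[of _ G]) auto
qed

lemma polynomial_gradient:
  fixes F :: "real^3 \<Rightarrow> real"
  assumes "real_polynomial_function F"
  obtains G :: "real^3 \<Rightarrow> real^3"
  where "\<And>x. (F has_derivative (\<lambda>h. G x \<bullet> h)) (at x)"
    and "\<And>i. real_polynomial_function (\<lambda>x. G x $ i)"
proof -
  obtain d where "polyfun_degree d F" using polynomial_imp_polyfun_degree assms by blast
  from polyfun_degree_gradient[OF this] show ?thesis
    using that polyfun_degree_imp_polynomial by blast
qed

text \<open>
  Clears the denominator of \<open>q (P / D)\<close>. The value \<open>s\<close> is characterized by \<open>P x = s * D x\<close> instead of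
  being written as a quotient, since this is the form in which parameters are known.
\<close>

lemma homogenized_substitution:
  fixes P D :: "'a::real_normed_vector \<Rightarrow> real"
  assumes "real_polynomial_function P" "real_polynomial_function D" "degree q \<le> m"
  obtains Q where "real_polynomial_function Q"
    and "\<And>x s. P x = s * D x \<Longrightarrow> Q x = D x ^ m * poly q s"
proof
  define Q where "Q = (\<lambda>x. \<Sum>i\<le>m. coeff q i * (P x ^ i * D x ^ (m - i)))"
  show "real_polynomial_function Q" unfolding Q_def
    by (intro real_polynomial_function_sum polyfun_intros assms) auto
  fix x s assume "P x = s * D x"
  then have "Q x = (\<Sum>i\<le>m. D x ^ m * (coeff q i * s ^ i))"
    unfolding Q_def
    by (intro sum.cong) (auto simp: power_mult_distrib power_add[symmetric] mult_ac)
  also have "\<dots> = D x ^ m * poly q s"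
    using arg_cong[OF poly_as_sum_of_monoms'[OF assms(3)], of "\<lambda>p. poly p s"]
    by (simp add: sum_distrib_left[symmetric] poly_sum poly_monom)
  finally show "Q x = D x ^ m * poly q s" .
qed

section \<open>Linear relations between monomials\<close>

lemma nontrivial_linear_relation:
  fixes M :: "'i \<Rightarrow> 'j \<Rightarrow> real"
  assumes "finite J" "finite I" "card J < card I"
  shows "\<exists>a. (\<exists>i\<in>I. a i \<noteq> 0) \<and> (\<forall>j\<in>J. (\<Sum>i\<in>I. a i * M i j) = 0)"
  using assms
proof (induction arbitrary: I M rule: finite_induct)
  case empty
  then obtain i where "i \<in> I" by fastforce
  then show ?case by (intro exI[of _ "\<lambda>_. 1"]) auto
next
  case (insert j J)
  show ?case
  proof (cases "\<forall>i\<in>I. M i j = 0")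
    case True
    then show ?thesis using insert.IH[OF insert.prems(1), of M] insert.prems insert.hyps
      by (force simp: card_insert_if)
  next
    case False
    then obtain k where k: "k \<in> I" "M k j \<noteq> 0" by blast
    \<comment> \<open>Gaussian elimination of the unknown \<open>k\<close> by means of equation \<open>j\<close>.\<close>
    define N where "N = (\<lambda>i l. M i l - M i j * M k l / M k j)"
    have "card J < card (I - {k})"
      using insert k by (simp add: card_insert_if)
    from insert.IH[OF _ this, of N] obtain a where a: "\<exists>i\<in>I-{k}. a i \<noteq> 0"
      "\<forall>l\<in>J. (\<Sum>i\<in>I-{k}. a i * N i l) = 0" using insert.prems(1) by blast
    define b where "b = a(k := - (\<Sum>i\<in>I-{k}. a i * M i j) / M k j)"
    have *: "(\<Sum>i\<in>I. b i * M i l) = (\<Sum>i\<in>I-{k}. a i * N i l)" for l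
    proof -
      have "(\<Sum>i\<in>I. b i * M i l) = b k * M k l + (\<Sum>i\<in>I-{k}. b i * M i l)"
        using insert.prems(1) k(1) by (rule sum.remove)
      also have "(\<Sum>i\<in>I-{k}. b i * M i l) = (\<Sum>i\<in>I-{k}. a i * M i l)"
        by (intro sum.cong) (auto simp: b_def)
      also have "b k * M k l = - (\<Sum>i\<in>I-{k}. a i * (M i j * M k l / M k j))"
        by (simp add: b_def sum_distrib_left sum_distrib_right sum_divide_distrib mult_ac)
      finally show ?thesis
        by (simp add: N_def algebra_simps sum_subtractf)
    qed
    have "N i j = 0" for i using k by (simp add: N_def)
    then have "\<forall>l\<in>insert j J. (\<Sum>i\<in>I. b i * M i l) = 0" using a(2) * by simp
    moreover have "\<exists>i\<in>I. b i \<noteq> 0" using a(1) by (auto simp: b_def)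
    ultimately show ?thesis by blast
  qed
qed

text \<open>
  Apply the one-variable statement to one coordinate after the other.
\<close>

lemma monomials_independent:
  fixes a :: "nat \<Rightarrow> nat \<Rightarrow> nat \<Rightarrow> real"
  assumes "\<And>x :: real^3. (\<Sum>i\<le>n. \<Sum>j\<le>n. \<Sum>k\<le>n. a i j k * (x$1 ^ i * x$2 ^ j * x$3 ^ k)) = 0"
    and "i \<le> n" "j \<le> n" "k \<le> n"
  shows "a i j k = 0"
proof -
  have "(\<Sum>i\<le>n. \<Sum>j\<le>n. \<Sum>k\<le>n. a i j k * (x ^ i * y ^ j * z ^ k)) = 0" for x y z
    using assms(1)[of "vector [x, y, z]"] by simp
  then have "(\<Sum>i\<le>n. (\<Sum>j\<le>n. \<Sum>k\<le>n. a i j k * (y ^ j * z ^ k)) * x ^ i) = 0" for x y z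
    by (simp add: sum_distrib_left sum_distrib_right mult_ac)
  then have "(\<Sum>j\<le>n. \<Sum>k\<le>n. a i j k * (y ^ j * z ^ k)) = 0" if "i \<le> n" for i y z
    using polyfun_eq_0[of "\<lambda>i. (\<Sum>j\<le>n. \<Sum>k\<le>n. a i j k * (y ^ j * z ^ k))" n] that by blast
  then have "(\<Sum>j\<le>n. (\<Sum>k\<le>n. a i j k * z ^ k) * y ^ j) = 0" if "i \<le> n" for i y z
    using that by (simp add: sum_distrib_left sum_distrib_right mult_ac)
  then have "(\<Sum>k\<le>n. a i j k * z ^ k) = 0" if "i \<le> n" "j \<le> n" for i j z
    using polyfun_eq_0[of "\<lambda>j. \<Sum>k\<le>n. a i j k * z ^ k" n] that by blast
  then show ?thesis using polyfun_eq_0[of "a i j" n] assms by blast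
qed

section \<open>Circles in an orthogonal frame\<close>

unbundle cross3_syntax

lemma real_polynomial_function_poly: "real_polynomial_function (poly (q :: real poly))"
  unfolding poly_altdef by (auto intro!: polyfun_intros real_polynomial_function_iff_sum[THEN iffD2])

lemma real_polynomial_function_real_imp_poly:
  assumes "real_polynomial_function (f :: real \<Rightarrow> real)"
  obtains q where "\<And>t. f t = poly q t"
proof -
  obtain a n where f: "f = (\<lambda>x. \<Sum>i\<le>n. a i * x ^ i)"
    using assms real_polynomial_function_iff_sum by blast
  have "f t = poly (\<Sum>i\<le>n. monom (a i) i) t" for t
    by (simp add: f poly_sum poly_monom)
  then show ?thesis using that by blast
qed

lemma real_polynomial_function_cross3:
  fixes f g :: "'a::real_normed_vector \<Rightarrow> real^3"
  assumes "\<And>i. real_polynomial_function (\<lambda>x. f x $ i)"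
    and "\<And>i. real_polynomial_function (\<lambda>x. g x $ i)"
  shows "real_polynomial_function (\<lambda>x. (f x \<times> g x) $ i)"
  using exhaust_3[of i] 
  by (elim disjE; simp only: cross_components; intro polyfun_intros assms)

text \<open>
  The expansion in the orthogonal basis \<open>u\<close>, \<open>v\<close>, \<open>u \<times> v\<close>, multiplied by the squared lengths, so that
  it is an identity of polynomials.
\<close>

lemma orthogonal_expansion3:
  fixes u v z :: "real^3"
  assumes "u \<bullet> v = 0"
  shows "((u \<bullet> u) * (v \<bullet> v)) *\<^sub>R z =
    ((v \<bullet> v) * (z \<bullet> u)) *\<^sub>R u + ((u \<bullet> u) * (z \<bullet> v)) *\<^sub>R v + (z \<bullet> (u \<times> v)) *\<^sub>R (u \<times> v)"
proof -
  have "u$1 * v$1 + u$2 * v$2 + u$3 * v$3 = 0"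
    using assms by (simp add: inner_vec_def sum_3)
  then show ?thesis
    unfolding vec_eq_iff forall_3 inner_vec_def sum_3 inner_real_def vector_add_component
      vector_scaleR_component cross_components real_scaleR_def
    by (intro conjI; algebra)
qed

text \<open>
  A sphere and a plane with normal \<open>T\<close> meet in a circle. In the frame \<open>T\<close>, \<open>a \<times> T\<close>,
  \<open>T \<times> (a \<times> T)\<close>, which is orthogonal but not normalized, the circle becomes the conic
  \<open>\<eta>\<^sup>2 = \<Omega>0 - \<xi>\<^sup>2 * \<Omega>1\<close>. Normalizing the frame would introduce square roots and destroy the
  polynomial dependence on the parameter of the family.
\<close>

lemma circle_in_orthogonal_frame:
  fixes T a Y :: "real^3"
  defines "e2 \<equiv> a \<times> T" and "e3 \<equiv> T \<times> (a \<times> T)"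
  defines "N \<equiv> T \<bullet> T" and "E \<equiv> (a \<times> T) \<bullet> (a \<times> T)"
  assumes "E \<noteq> 0" "N \<noteq> 0"
  shows "Y \<bullet> Y = \<rho>\<^sup>2 \<and> Y \<bullet> T + k = 0 \<longleftrightarrow>
    (\<exists>\<xi> \<eta>. \<eta>\<^sup>2 = E * (\<rho>\<^sup>2 * N - k\<^sup>2) - \<xi>\<^sup>2 * (E\<^sup>2 * N) \<and>
      (N * E) *\<^sub>R Y = (- E * k) *\<^sub>R T + \<xi> *\<^sub>R ((N * E) *\<^sub>R e2) + \<eta> *\<^sub>R e3)"
proof -
  have orth: "T \<bullet> e2 = 0" "T \<bullet> e3 = 0" "e2 \<bullet> e3 = 0" "e2 \<bullet> T = 0" "e3 \<bullet> T = 0" "e3 \<bullet> e2 = 0"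
    by (simp_all add: e2_def e3_def dot_cross_self inner_commute)
  have e3e3: "e3 \<bullet> e3 = N * E"
    using norm_cross_dot[of T e2] orth
    by (simp add: e3_def e2_def N_def E_def power_mult_distrib power2_norm_eq_inner)
  have e2e2: "e2 \<bullet> e2 = E" by (simp add: e2_def E_def)
  have exp: "(N * E) *\<^sub>R Y = (E * (Y \<bullet> T)) *\<^sub>R T + (N * (Y \<bullet> e2)) *\<^sub>R e2 + (Y \<bullet> e3) *\<^sub>R e3"
    using orthogonal_expansion3[OF orth(1), of Y] by (simp add: N_def E_def e2_def e3_def)
  have norm: "(N * E)\<^sup>2 * (Y \<bullet> Y) = (p\<^sup>2 * N + q\<^sup>2 * E + s\<^sup>2 * (N * E))"
    if "(N * E) *\<^sub>R Y = p *\<^sub>R T + q *\<^sub>R e2 + s *\<^sub>R e3" for p q s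
  proof -
    have "(N * E)\<^sup>2 * (Y \<bullet> Y) = ((N * E) *\<^sub>R Y) \<bullet> ((N * E) *\<^sub>R Y)"
      by (simp add: power2_eq_square)
    also have "\<dots> = p\<^sup>2 * N + q\<^sup>2 * E + s\<^sup>2 * (N * E)"
      unfolding that by (simp add: inner_add_left inner_add_right orth e2e2 e3e3 N_def[symmetric] power2_eq_square)
    finally show ?thesis .
  qed
  show ?thesis
  proof
    assume *: "Y \<bullet> Y = \<rho>\<^sup>2 \<and> Y \<bullet> T + k = 0"
    then have k: "Y \<bullet> T = - k" by simp
    have "(N * E)\<^sup>2 * \<rho>\<^sup>2 = (E * (Y \<bullet> T))\<^sup>2 * N + (N * (Y \<bullet> e2))\<^sup>2 * E + (Y \<bullet> e3)\<^sup>2 * (N * E)"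
      using norm[OF exp] * by simp
    then have "(N * E) * (Y \<bullet> e3)\<^sup>2 = (N * E) * (E * (\<rho>\<^sup>2 * N - k\<^sup>2) - ((Y \<bullet> e2) / E)\<^sup>2 * (E\<^sup>2 * N))"
      unfolding k using assms by (simp add: field_simps power2_eq_square)
    then have "(Y \<bullet> e3)\<^sup>2 = E * (\<rho>\<^sup>2 * N - k\<^sup>2) - ((Y \<bullet> e2) / E)\<^sup>2 * (E\<^sup>2 * N)"
      using assms by (metis mult_cancel_left no_zero_divisors)
    moreover have "(N * E) *\<^sub>R Y = (- E * k) *\<^sub>R T + ((Y \<bullet> e2) / E) *\<^sub>R ((N * E) *\<^sub>R e2) + (Y \<bullet> e3) *\<^sub>R e3"
      unfolding exp k using assms by (simp add: mult.commute)
    ultimately show "\<exists>\<xi> \<eta>. \<eta>\<^sup>2 = E * (\<rho>\<^sup>2 * N - k\<^sup>2) - \<xi>\<^sup>2 * (E\<^sup>2 * N) \<and>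
      (N * E) *\<^sub>R Y = (- E * k) *\<^sub>R T + \<xi> *\<^sub>R ((N * E) *\<^sub>R e2) + \<eta> *\<^sub>R e3" by blast
  next
    assume "\<exists>\<xi> \<eta>. \<eta>\<^sup>2 = E * (\<rho>\<^sup>2 * N - k\<^sup>2) - \<xi>\<^sup>2 * (E\<^sup>2 * N) \<and>
      (N * E) *\<^sub>R Y = (- E * k) *\<^sub>R T + \<xi> *\<^sub>R ((N * E) *\<^sub>R e2) + \<eta> *\<^sub>R e3"
    then obtain \<xi> \<eta> where h: "\<eta>\<^sup>2 = E * (\<rho>\<^sup>2 * N - k\<^sup>2) - \<xi>\<^sup>2 * (E\<^sup>2 * N)"
      and Y: "(N * E) *\<^sub>R Y = (- E * k) *\<^sub>R T + (\<xi> * (N * E)) *\<^sub>R e2 + \<eta> *\<^sub>R e3"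
      by (auto simp: mult_ac)
    have "(N * E)\<^sup>2 * (Y \<bullet> Y) = (N * E)\<^sup>2 * \<rho>\<^sup>2"
      unfolding norm[OF Y] h by (simp add: power2_eq_square algebra_simps)
    moreover have "(N * E) * (Y \<bullet> T) = (N * E) * (- k)"
      using arg_cong[OF Y, of "\<lambda>v. v \<bullet> T"] 
      by (simp add: inner_add_left inner_diff_left orth N_def[symmetric])
    moreover have "N * E \<noteq> 0" using assms(5,6) by simp
    ultimately have "Y \<bullet> Y = \<rho>\<^sup>2" "Y \<bullet> T = - k"
      by (simp_all only: mult_cancel_left power_eq_0_iff) auto
    then show "Y \<bullet> Y = \<rho>\<^sup>2 \<and> Y \<bullet> T + k = 0" by simp
  qed
qed

section \<open>Reduction of polynomials along a family of circles\<close>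

text \<open>
  A polynomial in \<open>\<xi>\<close> whose coefficients are polynomials in \<open>t\<close> is an element of \<open>real poly poly\<close>;
  \<open>a\<close> bounds the degree in \<open>\<xi>\<close> and \<open>b\<close> the degree in \<open>t\<close>.
\<close>

definition bidegree_le :: "nat \<Rightarrow> nat \<Rightarrow> real poly poly \<Rightarrow> bool" where
  "bidegree_le a b \<alpha> \<longleftrightarrow> (\<forall>i. coeff \<alpha> i \<noteq> 0 \<longrightarrow> i \<le> a \<and> degree (coeff \<alpha> i) \<le> b)"

definition eval2 :: "real poly poly \<Rightarrow> real \<Rightarrow> real \<Rightarrow> real" where
  "eval2 \<alpha> t \<xi> = poly (poly \<alpha> [:\<xi>:]) t"

definition slice :: "real poly poly \<Rightarrow> real \<Rightarrow> real poly" where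
  "slice \<alpha> t = map_poly (\<lambda>p. poly p t) \<alpha>"

lemma eval2_simps [simp]:
  "eval2 0 t \<xi> = 0"
  "eval2 (\<alpha> + \<beta>) t \<xi> = eval2 \<alpha> t \<xi> + eval2 \<beta> t \<xi>"
  "eval2 (\<alpha> * \<beta>) t \<xi> = eval2 \<alpha> t \<xi> * eval2 \<beta> t \<xi>"
  "eval2 (smult p \<alpha>) t \<xi> = poly p t * eval2 \<alpha> t \<xi>"
  "eval2 (pCons p \<alpha>) t \<xi> = poly p t + \<xi> * eval2 \<alpha> t \<xi>"
  by (simp_all add: eval2_def)

lemma poly_slice: "poly (slice \<alpha> t) \<xi> = eval2 \<alpha> t \<xi>"
  unfolding slice_def by (induction \<alpha>) (auto simp: map_poly_pCons)

lemma coeff_slice: "coeff (slice \<alpha> t) i = poly (coeff \<alpha> i) t"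
  by (simp add: slice_def coeff_map_poly)

lemma bidegree_le_add:
  "bidegree_le a b \<alpha> \<Longrightarrow> bidegree_le a b \<beta> \<Longrightarrow> bidegree_le a b (\<alpha> + \<beta>)"
  unfolding bidegree_le_def
proof (intro allI impI conjI)
  assume \<alpha>: "\<forall>i. coeff \<alpha> i \<noteq> 0 \<longrightarrow> i \<le> a \<and> degree (coeff \<alpha> i) \<le> b"
    and \<beta>: "\<forall>i. coeff \<beta> i \<noteq> 0 \<longrightarrow> i \<le> a \<and> degree (coeff \<beta> i) \<le> b"
  fix i assume "coeff (\<alpha> + \<beta>) i \<noteq> 0"
  then have "coeff \<alpha> i \<noteq> 0 \<or> coeff \<beta> i \<noteq> 0" by auto
  then show "i \<le> a" using \<alpha> \<beta> by blast
  have "degree (coeff \<alpha> i) \<le> b" "degree (coeff \<beta> i) \<le> b"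
    using \<alpha> \<beta> by (cases "coeff \<alpha> i = 0"; simp) (cases "coeff \<beta> i = 0"; simp add: \<beta>)
  then show "degree (coeff (\<alpha> + \<beta>) i) \<le> b" by (simp add: degree_add_le)
qed

lemma bidegree_le_mono:
  "bidegree_le a b \<alpha> \<Longrightarrow> a \<le> a' \<Longrightarrow> b \<le> b' \<Longrightarrow> bidegree_le a' b' \<alpha>"
  unfolding bidegree_le_def by (meson order_trans)

lemma bidegree_le_mult:
  assumes "bidegree_le a b \<alpha>" "bidegree_le a' b' \<beta>"
  shows "bidegree_le (a + a') (b + b') (\<alpha> * \<beta>)"
  unfolding bidegree_le_def
proof (intro allI impI conjI)
  fix i
  assume "coeff (\<alpha> * \<beta>) i \<noteq> 0"
  then have "(\<Sum>k\<le>i. coeff \<alpha> k * coeff \<beta> (i - k)) \<noteq> 0" by (simp add: coeff_mult)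
  then obtain k where k: "k \<le> i" "coeff \<alpha> k * coeff \<beta> (i - k) \<noteq> 0"
    by (meson atMost_iff sum.neutral)
  then have "k \<le> a" "i - k \<le> a'" using assms unfolding bidegree_le_def by auto
  with k(1) show "i \<le> a + a'" by linarith
  have "degree (coeff \<alpha> k * coeff \<beta> (i - k)) \<le> b + b'" for k
  proof (cases "coeff \<alpha> k = 0 \<or> coeff \<beta> (i - k) = 0")
    case False
    then have "degree (coeff \<alpha> k) \<le> b" "degree (coeff \<beta> (i - k)) \<le> b'"
      using assms unfolding bidegree_le_def by auto
    then show ?thesis using degree_mult_le[of "coeff \<alpha> k" "coeff \<beta> (i - k)"] by linarith
  qed auto
  then show "degree (coeff (\<alpha> * \<beta>) i) \<le> b + b'"
    unfolding coeff_mult by (intro degree_sum_le) auto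
qed

lemma bidegree_le_const: "degree p \<le> b \<Longrightarrow> bidegree_le a b [:p:]"
  unfolding bidegree_le_def by (auto simp: coeff_pCons split: nat.splits)

lemma bidegree_le_pCons:
  "degree p \<le> b \<Longrightarrow> bidegree_le a b \<alpha> \<Longrightarrow> bidegree_le (Suc a) b (pCons p \<alpha>)"
  unfolding bidegree_le_def by (auto simp: coeff_pCons split: nat.splits)

text \<open>
  The point \<open>x\<close> has coordinates \<open>(\<xi>, \<eta>)\<close> on the conic which is the circle at \<open>t\<close> in a moving frame.
\<close>

definition on_conic where
  "on_conic W X0 X1 X2 \<Omega>0 \<Omega>1 t \<xi> \<eta> (x :: real^3) \<longleftrightarrow>
    \<eta>\<^sup>2 = poly \<Omega>0 t - \<xi>\<^sup>2 * poly \<Omega>1 (t :: real) \<and>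
    (\<forall>i. poly W t * x $ i = poly (X0 i) t + \<xi> * poly (X1 i) t + \<eta> * poly (X2 i) t)"

text \<open>
  Along the family of circles a polynomial in \<open>x\<close> becomes a polynomial in \<open>t\<close>, \<open>\<xi>\<close> and \<open>\<eta>\<close>, and \<open>\<eta>\<^sup>2\<close>
  can be eliminated by the equation of the conic. The point is that the degrees grow only linearly
  with \<open>d\<close>: there are \<open>O(d\<^sup>2)\<close> coefficients, whereas polynomials of degree \<open>d\<close> in three variables form
  a space of dimension of order \<open>d\<^sup>3\<close>.
\<close>

lemma reduction_to_linear_in_eta:
  fixes W \<Omega>0 \<Omega>1 :: "real poly" and X0 X1 X2 :: "3 \<Rightarrow> real poly"
  obtains K where "\<And>d F. polyfun_degree d F \<Longrightarrow>
    \<exists>\<alpha> \<beta>. bidegree_le d (K * d) \<alpha> \<and> bidegree_le d (K * d) \<beta> \<and>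
      (\<forall>t \<xi> \<eta> x. on_conic W X0 X1 X2 \<Omega>0 \<Omega>1 t \<xi> \<eta> x \<longrightarrow>
        poly W t ^ d * F x = eval2 \<alpha> t \<xi> + \<eta> * eval2 \<beta> t \<xi>)"
proof -
  define L where "L = degree \<Omega>0 + degree \<Omega>1"
  define \<Omega> where "\<Omega> = [:\<Omega>0, 0, - \<Omega>1:]"
  define K where "K = degree W + (\<Sum>i\<in>UNIV. degree (X0 i)) + (\<Sum>i\<in>UNIV. degree (X1 i))
     + (\<Sum>i\<in>UNIV. degree (X2 i)) + L"
  have X_le: "degree (X0 i) \<le> (\<Sum>i\<in>UNIV. degree (X0 i))" "degree (X1 i) \<le> (\<Sum>i\<in>UNIV. degree (X1 i))"
    "degree (X2 i) \<le> (\<Sum>i\<in>UNIV. degree (X2 i))" for i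
    by (rule member_le_sum; simp)+
  have K: "degree W \<le> K" "degree (X0 i) \<le> K" "degree (X1 i) \<le> K" "degree (X2 i) \<le> K - L" "L \<le> K" for i
    using X_le[of i] by (auto simp: K_def)
  have \<Omega>: "bidegree_le 2 (2 * L) \<Omega>"
    unfolding \<Omega>_def numeral_2_eq_2
    by (intro bidegree_le_pCons bidegree_le_const) (auto simp: L_def)
  have eval\<Omega>: "eval2 \<Omega> t \<xi> = poly \<Omega>0 t - \<xi>\<^sup>2 * poly \<Omega>1 t" for t \<xi>
    by (simp add: \<Omega>_def power2_eq_square algebra_simps)
  let ?rel = "on_conic W X0 X1 X2 \<Omega>0 \<Omega>1"
  \<comment> \<open>The bound on \<open>\<beta>\<close> is smaller than that on \<open>\<alpha>\<close> by the weight \<open>(1, L)\<close> of \<open>\<eta>\<close>; with this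
    bookkeeping the bounds stay proportional to \<open>d\<close> when \<open>\<eta>\<^sup>2\<close> is eliminated from a product.\<close>
  have main: "\<exists>\<alpha> \<beta>. bidegree_le d (K * d) \<alpha> \<and> (d = 0 \<longrightarrow> \<beta> = 0) \<and> bidegree_le (d - 1) (K * d - L) \<beta> \<and>
      (\<forall>t \<xi> \<eta> x. ?rel t \<xi> \<eta> x \<longrightarrow> poly W t ^ d * F x = eval2 \<alpha> t \<xi> + \<eta> * eval2 \<beta> t \<xi>)"
    if "polyfun_degree d F" for d F
    using that
  proof induction
    case (const a)
    show ?case
      by (rule exI[of _ "[:[:a:]:]"], rule exI[of _ 0])
        (simp add: bidegree_le_const, simp add: bidegree_le_def)
  next
    case (coord i)
    show ?case
      by (rule exI[of _ "[:X0 i, X1 i:]"], rule exI[of _ "[:X2 i:]"])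
        (use K in \<open>auto simp: on_conic_def algebra_simps intro!: bidegree_le_const bidegree_le_pCons[where a = 0, simplified]\<close>)
  next
    case (add d f g)
    then obtain \<alpha> \<beta> \<alpha>' \<beta>' where
      1: "bidegree_le d (K * d) \<alpha>" "d = 0 \<longrightarrow> \<beta> = 0" "bidegree_le (d - 1) (K * d - L) \<beta>"
       "\<And>t \<xi> \<eta> x. ?rel t \<xi> \<eta> x \<Longrightarrow> poly W t ^ d * f x = eval2 \<alpha> t \<xi> + \<eta> * eval2 \<beta> t \<xi>" and
      2: "bidegree_le d (K * d) \<alpha>'" "d = 0 \<longrightarrow> \<beta>' = 0" "bidegree_le (d - 1) (K * d - L) \<beta>'"
       "\<And>t \<xi> \<eta> x. ?rel t \<xi> \<eta> x \<Longrightarrow> poly W t ^ d * g x = eval2 \<alpha>' t \<xi> + \<eta> * eval2 \<beta>' t \<xi>"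
      by blast
    show ?case
    proof (intro exI conjI allI impI)
      show "bidegree_le d (K * d) (\<alpha> + \<alpha>')" "bidegree_le (d - 1) (K * d - L) (\<beta> + \<beta>')"
        using 1 2 by (simp_all add: bidegree_le_add)
      show "d = 0 \<Longrightarrow> \<beta> + \<beta>' = 0" using 1 2 by simp
      show "poly W t ^ d * (f x + g x) = eval2 (\<alpha> + \<alpha>') t \<xi> + \<eta> * eval2 (\<beta> + \<beta>') t \<xi>"
        if "?rel t \<xi> \<eta> x" for t \<xi> \<eta> x
        using 1(4)[OF that] 2(4)[OF that] by (simp add: algebra_simps)
    qed
  next
    case (mult d f e g)
    then obtain \<alpha> \<beta> \<alpha>' \<beta>' where
      1: "bidegree_le d (K * d) \<alpha>" "d = 0 \<longrightarrow> \<beta> = 0" "bidegree_le (d - 1) (K * d - L) \<beta>"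
       "\<And>t \<xi> \<eta> x. ?rel t \<xi> \<eta> x \<Longrightarrow> poly W t ^ d * f x = eval2 \<alpha> t \<xi> + \<eta> * eval2 \<beta> t \<xi>" and
      2: "bidegree_le e (K * e) \<alpha>'" "e = 0 \<longrightarrow> \<beta>' = 0" "bidegree_le (e - 1) (K * e - L) \<beta>'"
       "\<And>t \<xi> \<eta> x. ?rel t \<xi> \<eta> x \<Longrightarrow> poly W t ^ e * g x = eval2 \<alpha>' t \<xi> + \<eta> * eval2 \<beta>' t \<xi>"
      by blast
    have KL: "L \<le> K * d" if "d \<noteq> 0" for d
      using that K(5) by (metis One_nat_def Suc_leI bot_nat_0.not_eq_extremum dual_order.trans mult.right_neutral mult_le_mono2)
    show ?case
    proof (intro exI conjI allI impI)
      show "bidegree_le (d + e) (K * (d + e)) (\<alpha> * \<alpha>' + \<beta> * \<beta>' * \<Omega>)"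
      proof (rule bidegree_le_add)
        show "bidegree_le (d + e) (K * (d + e)) (\<alpha> * \<alpha>')"
          using bidegree_le_mult[OF 1(1) 2(1)] by (simp add: distrib_left)
        show "bidegree_le (d + e) (K * (d + e)) (\<beta> * \<beta>' * \<Omega>)"
        proof (cases "d = 0 \<or> e = 0")
          case True
          then show ?thesis using 1 2 by (auto simp: bidegree_le_def)
        next
          case False
          then show ?thesis using KL[of d] KL[of e]
            by (intro bidegree_le_mono[OF bidegree_le_mult[OF bidegree_le_mult[OF 1(3) 2(3)] \<Omega>]])
              (auto simp: distrib_left)
        qed
      qed
      show "bidegree_le (d + e - 1) (K * (d + e) - L) (\<alpha> * \<beta>' + \<alpha>' * \<beta>)"
      proof (rule bidegree_le_add)
        show "bidegree_le (d + e - 1) (K * (d + e) - L) (\<alpha> * \<beta>')"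
        proof (cases "e = 0")
          case False
          then show ?thesis using KL[of e]
            by (intro bidegree_le_mono[OF bidegree_le_mult[OF 1(1) 2(3)]]) (auto simp: distrib_left)
        qed (use 2 in \<open>simp add: bidegree_le_def\<close>)
        show "bidegree_le (d + e - 1) (K * (d + e) - L) (\<alpha>' * \<beta>)"
        proof (cases "d = 0")
          case False
          then show ?thesis using KL[of d]
            by (intro bidegree_le_mono[OF bidegree_le_mult[OF 2(1) 1(3)]]) (auto simp: distrib_left)
        qed (use 1 in \<open>simp add: bidegree_le_def\<close>)
      qed
      show "d + e = 0 \<Longrightarrow> \<alpha> * \<beta>' + \<alpha>' * \<beta> = 0" using 1 2 by simp
      show "poly W t ^ (d + e) * (f x * g x) =
          eval2 (\<alpha> * \<alpha>' + \<beta> * \<beta>' * \<Omega>) t \<xi> + \<eta> * eval2 (\<alpha> * \<beta>' + \<alpha>' * \<beta>) t \<xi>"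
        if "?rel t \<xi> \<eta> x" for t \<xi> \<eta> x
      proof -
        have "eval2 \<Omega> t \<xi> = \<eta>\<^sup>2" using that eval\<Omega> by (simp add: on_conic_def)
        moreover have "poly W t ^ (d + e) * (f x * g x) = (poly W t ^ d * f x) * (poly W t ^ e * g x)"
          by (simp add: power_add)
        ultimately show ?thesis
          unfolding 1(4)[OF that] 2(4)[OF that] by (simp add: algebra_simps power2_eq_square)
      qed
    qed
  next
    case (weaken d f)
    then obtain \<alpha> \<beta> where
      1: "bidegree_le d (K * d) \<alpha>" "d = 0 \<longrightarrow> \<beta> = 0" "bidegree_le (d - 1) (K * d - L) \<beta>"
       "\<And>t \<xi> \<eta> x. ?rel t \<xi> \<eta> x \<Longrightarrow> poly W t ^ d * f x = eval2 \<alpha> t \<xi> + \<eta> * eval2 \<beta> t \<xi>"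
      by blast
    have W: "bidegree_le 0 K [:W:]" using K by (simp add: bidegree_le_const)
    show ?case
    proof (intro exI conjI allI impI)
      show "bidegree_le (Suc d) (K * Suc d) ([:W:] * \<alpha>)"
        by (intro bidegree_le_mono[OF bidegree_le_mult[OF W 1(1)]]) auto
      show "bidegree_le (Suc d - 1) (K * Suc d - L) ([:W:] * \<beta>)"
      proof (cases "d = 0")
        case False
        then have "L \<le> K * d" using K(5) by (cases d) auto
        then show ?thesis
          by (intro bidegree_le_mono[OF bidegree_le_mult[OF W 1(3)]]) (use K(5) in auto)
      qed (use 1 in \<open>simp add: bidegree_le_def\<close>)
      show "Suc d = 0 \<Longrightarrow> [:W:] * \<beta> = 0" by simp
      show "poly W t ^ Suc d * f x = eval2 ([:W:] * \<alpha>) t \<xi> + \<eta> * eval2 ([:W:] * \<beta>) t \<xi>"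
        if "?rel t \<xi> \<eta> x" for t \<xi> \<eta> x
      proof -
        have "poly W t ^ Suc d * f x = poly W t * (poly W t ^ d * f x)" by simp
        then show ?thesis unfolding 1(4)[OF that] by (simp add: algebra_simps)
      qed
    qed
  qed
  show ?thesis
  proof (rule that)
    fix d F assume "polyfun_degree d F"
    from main[OF this] obtain \<alpha> \<beta> where *: "bidegree_le d (K * d) \<alpha>" "bidegree_le (d - 1) (K * d - L) \<beta>"
      "\<And>t \<xi> \<eta> x. ?rel t \<xi> \<eta> x \<Longrightarrow> poly W t ^ d * F x = eval2 \<alpha> t \<xi> + \<eta> * eval2 \<beta> t \<xi>" by blast
    have "bidegree_le d (K * d) \<beta>" using *(2) by (rule bidegree_le_mono) auto
    with *(1,3) show "\<exists>\<alpha> \<beta>. bidegree_le d (K * d) \<alpha> \<and> bidegree_le d (K * d) \<beta> \<and>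
      (\<forall>t \<xi> \<eta> x. on_conic W X0 X1 X2 \<Omega>0 \<Omega>1 t \<xi> \<eta> x \<longrightarrow>
        poly W t ^ d * F x = eval2 \<alpha> t \<xi> + \<eta> * eval2 \<beta> t \<xi>)"
      by (intro exI[of _ \<alpha>] exI[of _ \<beta>]) blast
  qed
qed

section \<open>Sphere families with cleared denominators\<close>

definition poly_vec :: "real poly ^ 3 \<Rightarrow> real \<Rightarrow> real ^ 3" where
  "poly_vec C t = (\<chi> i. poly (C $ i) t)"

text \<open>
  The numerator of the derivative of \<open>f / w\<close> over the denominator \<open>w\<^sup>2\<close>; up to sign the Wronskian of
  \<open>f\<close> and \<open>w\<close>.
\<close>

definition cleared_deriv :: "real poly \<Rightarrow> real poly \<Rightarrow> real poly" where
  "cleared_deriv w f = pderiv f * w - f * pderiv w"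

lemma poly_vec_nth [simp]: "poly_vec C t $ i = poly (C $ i) t"
  by (simp add: poly_vec_def)

lemma real_polynomial_functions_real_imp_polys:
  assumes "\<And>i. real_polynomial_function (\<lambda>t. f t i :: real)"
  obtains q where "\<And>t i. f (t :: real) i = poly (q i) t"
proof -
  have "\<exists>q. \<forall>t. f t i = poly q t" for i
    by (rule real_polynomial_function_real_imp_poly[OF assms[of i]]) blast
  then have "\<exists>q. \<forall>i t. f t i = poly (q i) t" by (intro choice allI)
  then show thesis using that by blast
qed

lemma nonparallel_vector_exists:
  fixes T :: "real^3"
  assumes "T \<noteq> 0"
  obtains a where "a \<times> T \<noteq> 0"
proof -
  have "T = 0" if "\<And>a. a \<times> T = 0"
    using that[of "vector [1,0,0]"] that[of "vector [0,1,0]"]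
    by (auto simp: vec_eq_iff forall_3 cross_components)
  then show ?thesis using assms that by blast
qed

lemma eval2_sum: "eval2 (sum \<alpha> I) t \<xi> = (\<Sum>i\<in>I. eval2 (\<alpha> i) t \<xi>)"
  by (simp add: eval2_def poly_sum)

lemma eval2_eq_0:
  assumes "\<And>i. poly (coeff \<alpha> i) t = 0"
  shows "eval2 \<alpha> t \<xi> = 0"
proof -
  have "slice \<alpha> t = 0" by (rule poly_eqI) (simp add: coeff_slice assms)
  then show ?thesis by (metis poly_0 poly_slice)
qed

text \<open>
  The spheres with centre \<open>C / w\<close> and radius \<open>R / w\<close>, all over one common denominator \<open>w\<close>, which is
  allowed to be larger than necessary. The second assumption is \<open>(r')\<^sup>2 < \<parallel>c'\<parallel>\<^sup>2\<close>, multiplied by \<open>w\<^sup>4\<close>.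
\<close>

locale canal_family =
  fixes w :: "real poly" and C :: "real poly ^ 3" and R :: "real poly"
  assumes w_nonzero: "w \<noteq> 0"
    and immersed: "poly w t \<noteq> 0 \<Longrightarrow> (poly (cleared_deriv w R) t)\<^sup>2 <
      poly_vec (\<chi> i. cleared_deriv w (C $ i)) t \<bullet> poly_vec (\<chi> i. cleared_deriv w (C $ i)) t"
begin

text \<open>
  The derivative of the centre is \<open>T / w\<^sup>2\<close>, that of the radius is \<open>U / w\<^sup>2\<close>.
\<close>

definition T :: "real \<Rightarrow> real^3" where "T = poly_vec (\<chi> i. cleared_deriv w (C $ i))"

definition U :: "real poly" where "U = cleared_deriv w R"

text \<open>
  The vector from the centre to \<open>x\<close>, multiplied by \<open>w\<close>.
\<close>

definition Y :: "real \<Rightarrow> real^3 \<Rightarrow> real^3" where "Y t x = poly w t *\<^sub>R x - poly_vec C t"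

definition circle :: "real \<Rightarrow> (real^3) set" where
  "circle t = {x. Y t x \<bullet> Y t x = (poly R t)\<^sup>2 \<and> Y t x \<bullet> T t + poly R t * poly U t = 0}"

definition sweep :: "(real^3) set" where
  "sweep = (\<Union>t\<in>{t. poly w t \<noteq> 0}. circle t)"

lemma U_less: "poly w t \<noteq> 0 \<Longrightarrow> (poly U t)\<^sup>2 < T t \<bullet> T t"
  using immersed by (simp add: T_def U_def)

lemma T_nonzero: "poly w t \<noteq> 0 \<Longrightarrow> T t \<noteq> 0"
  using U_less[of t] by (auto simp: not_less)

lemma polynomial_T: "real_polynomial_function (\<lambda>t. T t $ i)"
  by (simp add: T_def real_polynomial_function_poly)

text \<open>
  A constant vector \<open>a\<close> that is not parallel to the tangent \<open>T t\<close> gives a frame that depends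
  polynomially on \<open>t\<close> and is nondegenerate near \<open>t\<close> (where \<open>E\<close> does not vanish). No single \<open>a\<close> serves
  all parameters.
\<close>

lemma frame:
  obtains W \<Omega>0 \<Omega>1 E :: "real poly" and X0 X1 X2 :: "3 \<Rightarrow> real poly" where
    "\<And>t. poly E t = (a \<times> T t) \<bullet> (a \<times> T t)"
    "\<And>t. poly W t = poly w t * (T t \<bullet> T t) * poly E t"
    "\<And>t. poly \<Omega>0 t = poly E t * ((poly R t)\<^sup>2 * (T t \<bullet> T t - (poly U t)\<^sup>2))"
    "\<And>t. poly \<Omega>1 t = (poly E t)\<^sup>2 * (T t \<bullet> T t)"
    "\<And>t x. poly w t \<noteq> 0 \<Longrightarrow> poly E t \<noteq> 0 \<Longrightarrow> x \<in> circle t \<longleftrightarrow>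
      (\<exists>\<xi> \<eta>. on_conic W X0 X1 X2 \<Omega>0 \<Omega>1 t \<xi> \<eta> x)"
    "\<And>t. (\<Sum>i\<in>UNIV. poly (X1 i) t * poly (X2 i) t) = 0"
    "\<And>t. (\<Sum>i\<in>UNIV. poly (X1 i) t * poly (X1 i) t) = (T t \<bullet> T t * poly E t)\<^sup>2 * poly E t"
proof -
  have pT: "real_polynomial_function (\<lambda>t. T t \<bullet> T t)"
    by (simp add: inner_vec_def sum_3) (intro polyfun_intros polynomial_T)
  have pe2: "real_polynomial_function (\<lambda>t. (a \<times> T t) $ i)" for i
    by (intro real_polynomial_function_cross3 polynomial_T) (rule real_polynomial_function.intros)
  have pe3: "real_polynomial_function (\<lambda>t. (T t \<times> (a \<times> T t)) $ i)" for i
    by (intro real_polynomial_function_cross3 polynomial_T pe2)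
  have pE: "real_polynomial_function (\<lambda>t. (a \<times> T t) \<bullet> (a \<times> T t))"
    using pe2 by (simp add: inner_vec_def sum_3) (intro polyfun_intros)
  obtain N where N: "\<And>t. T t \<bullet> T t = poly N t"
    using real_polynomial_function_real_imp_poly[OF pT] by blast
  obtain E where E: "\<And>t. (a \<times> T t) \<bullet> (a \<times> T t) = poly E t"
    using real_polynomial_function_real_imp_poly[OF pE] by blast
  obtain e2 where e2: "\<And>t i. (a \<times> T t) $ i = poly (e2 i) t"
    using real_polynomial_functions_real_imp_polys[where f = "\<lambda>t i. (a \<times> T t) $ i", OF pe2] by blast
  obtain e3 where e3: "\<And>t i. (T t \<times> (a \<times> T t)) $ i = poly (e3 i) t"
    using real_polynomial_functions_real_imp_polys[where f = "\<lambda>t i. (T t \<times> (a \<times> T t)) $ i", OF pe3] by blast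
  obtain T' where T': "\<And>t i. T t $ i = poly (T' i) t"
    using real_polynomial_functions_real_imp_polys[where f = "\<lambda>t i. T t $ i", OF polynomial_T] by blast
  define X0 where "X0 = (\<lambda>i. N * E * C $ i - E * (R * U) * T' i)"
  define X1 where "X1 = (\<lambda>i. N * E * e2 i)"
  show thesis
  proof (rule that[of E "w * N * E" "E * (R\<^sup>2 * (N - U\<^sup>2))" "E\<^sup>2 * N" X0 X1 e3])
    fix t
    show "poly E t = (a \<times> T t) \<bullet> (a \<times> T t)"
      and "poly (w * N * E) t = poly w t * (T t \<bullet> T t) * poly E t"
      and "poly (E * (R\<^sup>2 * (N - U\<^sup>2))) t = poly E t * ((poly R t)\<^sup>2 * (T t \<bullet> T t - (poly U t)\<^sup>2))"
      and "poly (E\<^sup>2 * N) t = (poly E t)\<^sup>2 * (T t \<bullet> T t)"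
      by (simp_all add: N E)
    have "(a \<times> T t) \<bullet> (T t \<times> (a \<times> T t)) = 0" by (simp add: dot_cross_self)
    then have "(\<Sum>i\<in>UNIV. poly (e2 i) t * poly (e3 i) t) = 0"
      by (simp add: inner_vec_def e2 e3)
    then show "(\<Sum>i\<in>UNIV. poly (X1 i) t * poly (e3 i) t) = 0"
      by (simp add: X1_def mult.assoc flip: sum_distrib_left)
    have "(\<Sum>i\<in>UNIV. poly (e2 i) t * poly (e2 i) t) = poly E t"
      using E[of t] by (simp add: inner_vec_def e2)
    moreover have "(\<Sum>i\<in>UNIV. poly (X1 i) t * poly (X1 i) t)
        = (poly N t * poly E t)\<^sup>2 * (\<Sum>i\<in>UNIV. poly (e2 i) t * poly (e2 i) t)"
      by (simp add: X1_def sum_distrib_left power2_eq_square mult_ac)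
    ultimately show "(\<Sum>i\<in>UNIV. poly (X1 i) t * poly (X1 i) t) = (T t \<bullet> T t * poly E t)\<^sup>2 * poly E t"
      by (simp add: N)
    fix x assume nz: "poly w t \<noteq> 0" "poly E t \<noteq> 0"
    have "x \<in> circle t \<longleftrightarrow> (\<exists>\<xi> \<eta>. \<eta>\<^sup>2 = poly E t * ((poly R t)\<^sup>2 * poly N t - (poly R t * poly U t)\<^sup>2) - \<xi>\<^sup>2 * ((poly E t)\<^sup>2 * poly N t) \<and>
      (poly N t * poly E t) *\<^sub>R Y t x = (- poly E t * (poly R t * poly U t)) *\<^sub>R T t + \<xi> *\<^sub>R ((poly N t * poly E t) *\<^sub>R (a \<times> T t)) + \<eta> *\<^sub>R (T t \<times> (a \<times> T t)))"
      unfolding circle_def mem_Collect_eq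
      using circle_in_orthogonal_frame[of a "T t" "Y t x" "poly R t" "poly R t * poly U t"] nz T_nonzero[OF nz(1)]
      by (simp only: N[symmetric] E[symmetric]) auto
    also have "\<dots> \<longleftrightarrow> (\<exists>\<xi> \<eta>. on_conic (w * N * E) X0 X1 e3 (E * (R\<^sup>2 * (N - U\<^sup>2))) (E\<^sup>2 * N) t \<xi> \<eta> x)"
      by (intro arg_cong[of _ _ Ex] ext)
        (auto simp: on_conic_def vec_eq_iff Y_def X0_def X1_def e2 e3 T' power_mult_distrib algebra_simps)
    finally show "x \<in> circle t \<longleftrightarrow>
      (\<exists>\<xi> \<eta>. on_conic (w * N * E) X0 X1 e3 (E * (R\<^sup>2 * (N - U\<^sup>2))) (E\<^sup>2 * N) t \<xi> \<eta> x)" .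
  qed
qed

text \<open>
  For a nonzero radius \<open>\<Omega>0\<close> is positive, because \<open>U\<^sup>2 < T \<bullet> T\<close>, and so every small \<open>\<xi>\<close> belongs to a real
  point of the conic.
\<close>

lemma infinite_circle:
  assumes "poly w t \<noteq> 0" "poly R t \<noteq> 0"
  shows "infinite (circle t)"
proof -
  obtain a where a: "a \<times> T t \<noteq> 0"
    using nonparallel_vector_exists[OF T_nonzero[OF assms(1)]] .
  obtain W \<Omega>0 \<Omega>1 E :: "real poly" and X0 X1 X2 :: "3 \<Rightarrow> real poly" where
    E: "\<And>t. poly E t = (a \<times> T t) \<bullet> (a \<times> T t)" and
    W: "\<And>t. poly W t = poly w t * (T t \<bullet> T t) * poly E t" and
    \<Omega>0: "\<And>t. poly \<Omega>0 t = poly E t * ((poly R t)\<^sup>2 * (T t \<bullet> T t - (poly U t)\<^sup>2))" and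
    \<Omega>1: "\<And>t. poly \<Omega>1 t = (poly E t)\<^sup>2 * (T t \<bullet> T t)" and
    circ: "\<And>t x. poly w t \<noteq> 0 \<Longrightarrow> poly E t \<noteq> 0 \<Longrightarrow> x \<in> circle t \<longleftrightarrow>
      (\<exists>\<xi> \<eta>. on_conic W X0 X1 X2 \<Omega>0 \<Omega>1 t \<xi> \<eta> x)" and
    X12: "\<And>t. (\<Sum>i\<in>UNIV. poly (X1 i) t * poly (X2 i) t) = 0" and
    X11: "\<And>t. (\<Sum>i\<in>UNIV. poly (X1 i) t * poly (X1 i) t) = (T t \<bullet> T t * poly E t)\<^sup>2 * poly E t"
    by (rule frame[of a]; rule that; assumption)
  have Ep: "poly E t > 0" using a by (simp add: E)
  have Tp: "T t \<bullet> T t > 0" using T_nonzero[OF assms(1)] by simp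
  have W0: "poly W t \<noteq> 0" using Ep Tp assms by (simp add: W)
  have p0: "poly \<Omega>0 t > 0" using Ep U_less[OF assms(1)] assms by (simp add: \<Omega>0)
  have p1: "poly \<Omega>1 t > 0" using Ep Tp by (simp add: \<Omega>1)
  define m where "m = min 1 (poly \<Omega>0 t / poly \<Omega>1 t)"
  have m: "m > 0" using p0 p1 by (simp add: m_def)
  define pt where "pt = (\<lambda>\<xi>. (\<chi> i. (poly (X0 i) t + \<xi> * poly (X1 i) t +
     sqrt (poly \<Omega>0 t - \<xi>\<^sup>2 * poly \<Omega>1 t) * poly (X2 i) t) / poly W t) :: real^3)"
  have "pt ` {0<..<m} \<subseteq> circle t"
  proof safe
    fix \<xi> assume \<xi>: "\<xi> \<in> {0<..<m}"
    have "\<xi>\<^sup>2 \<le> \<xi>" using \<xi> by (simp add: m_def power2_eq_square mult_left_le)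
    then have "\<xi>\<^sup>2 \<le> poly \<Omega>0 t / poly \<Omega>1 t" using \<xi> by (simp add: m_def)
    then have "0 \<le> poly \<Omega>0 t - \<xi>\<^sup>2 * poly \<Omega>1 t" using p1 by (simp add: field_simps)
    then have "(sqrt (poly \<Omega>0 t - \<xi>\<^sup>2 * poly \<Omega>1 t))\<^sup>2 = poly \<Omega>0 t - \<xi>\<^sup>2 * poly \<Omega>1 t" by simp
    moreover have "\<forall>i. poly W t * pt \<xi> $ i = poly (X0 i) t + \<xi> * poly (X1 i) t
        + sqrt (poly \<Omega>0 t - \<xi>\<^sup>2 * poly \<Omega>1 t) * poly (X2 i) t"
      using W0 by (simp add: pt_def)
    moreover have "poly E t \<noteq> 0" using Ep by simp
    ultimately show "pt \<xi> \<in> circle t"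
      using circ[OF assms(1), of "pt \<xi>"] unfolding on_conic_def by blast
  qed
  moreover have "inj_on pt {0<..<m}"
  proof
    fix \<xi> \<xi>' assume "pt \<xi> = pt \<xi>'"
    then have "(poly (X0 i) t + \<xi> * poly (X1 i) t + sqrt (poly \<Omega>0 t - \<xi>\<^sup>2 * poly \<Omega>1 t) * poly (X2 i) t) =
      (poly (X0 i) t + \<xi>' * poly (X1 i) t + sqrt (poly \<Omega>0 t - \<xi>'\<^sup>2 * poly \<Omega>1 t) * poly (X2 i) t)" for i
      using W0 by (simp add: pt_def vec_eq_iff)
    then have "(\<xi> - \<xi>') * poly (X1 i) t =
      (sqrt (poly \<Omega>0 t - \<xi>'\<^sup>2 * poly \<Omega>1 t) - sqrt (poly \<Omega>0 t - \<xi>\<^sup>2 * poly \<Omega>1 t)) * poly (X2 i) t" for i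
      by (simp add: algebra_simps)
    then have "(\<xi> - \<xi>') * (\<Sum>i\<in>UNIV. poly (X1 i) t * poly (X1 i) t) =
      (sqrt (poly \<Omega>0 t - \<xi>'\<^sup>2 * poly \<Omega>1 t) - sqrt (poly \<Omega>0 t - \<xi>\<^sup>2 * poly \<Omega>1 t)) * (\<Sum>i\<in>UNIV. poly (X1 i) t * poly (X2 i) t)"
      unfolding sum_distrib_left by (intro sum.cong refl) (metis mult.left_commute)
    then show "\<xi> = \<xi>'" using Ep Tp by (simp add: X12 X11)
  qed
  ultimately show ?thesis
    using m by (metis finite_imageD finite_subset infinite_Ioo)
qed

text \<open>
  A polynomial with infinitely many zeros on one circle vanishes on it. The equation \<open>\<alpha> + \<eta> \<beta> = 0\<close>
  gives \<open>\<alpha>\<^sup>2 = \<Omega> \<beta>\<^sup>2\<close> for infinitely many \<open>\<xi>\<close>, hence for all \<open>\<xi>\<close>; but \<open>\<Omega>\<close> is negative for large \<open>\<xi>\<close>.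
\<close>

lemma circle_zero_criterion:
  assumes E: "poly w t \<noteq> 0" "poly E t \<noteq> 0"
    and W: "poly W t \<noteq> 0" and pos: "0 < poly \<Omega>1 t"
    and circ: "\<And>x. x \<in> circle t \<longleftrightarrow>
      (\<exists>\<xi> \<eta>. on_conic W X0 X1 X2 \<Omega>0 \<Omega>1 t \<xi> \<eta> x)"
    and F: "\<And>\<xi> \<eta> x. on_conic W X0 X1 X2 \<Omega>0 \<Omega>1 t \<xi> \<eta> x \<Longrightarrow>
        poly W t ^ d * F x = eval2 \<alpha> t \<xi> + \<eta> * eval2 \<beta> t \<xi>"
  shows "(\<forall>i. poly (coeff \<alpha> i) t = 0 \<and> poly (coeff \<beta> i) t = 0) \<Longrightarrow> x \<in> circle t \<Longrightarrow> F x = 0"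
    and "infinite {x \<in> circle t. F x = 0} \<Longrightarrow> poly (coeff \<alpha> i) t = 0 \<and> poly (coeff \<beta> i) t = 0"
proof -
  assume z: "\<forall>i. poly (coeff \<alpha> i) t = 0 \<and> poly (coeff \<beta> i) t = 0" and x: "x \<in> circle t"
  from x obtain \<xi> \<eta> where "on_conic W X0 X1 X2 \<Omega>0 \<Omega>1 t \<xi> \<eta> x" using circ by blast
  from F[OF this] z W show "F x = 0" by (simp add: eval2_eq_0)
next
  assume inf: "infinite {x \<in> circle t. F x = 0}"
  define \<Omega> where "\<Omega> = [:poly \<Omega>0 t, 0, - poly \<Omega>1 t:]"
  have \<Omega>: "poly \<Omega> \<xi> = poly \<Omega>0 t - \<xi>\<^sup>2 * poly \<Omega>1 t" for \<xi>
    by (simp add: \<Omega>_def power2_eq_square algebra_simps)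
  \<comment> \<open>The norm of \<open>F\<close> from the function field of the circle down to the rational functions of \<open>\<xi>\<close>.\<close>
  define N where "N = (slice \<alpha> t)\<^sup>2 - \<Omega> * (slice \<beta> t)\<^sup>2"
  have "N = 0"
  proof (rule ccontr)
    assume "N \<noteq> 0"
    then have fin: "finite {\<xi>. poly N \<xi> = 0}" by (rule poly_roots_finite)
    define pt where "pt = (\<lambda>(\<xi>, s). (\<chi> i. (poly (X0 i) t + \<xi> * poly (X1 i) t +
       s * sqrt (poly \<Omega> \<xi>) * poly (X2 i) t) / poly W t) :: real^3)"
    have "{x \<in> circle t. F x = 0} \<subseteq> pt ` (Sigma {\<xi>. poly N \<xi> = 0} (\<lambda>_. {-1, 1}))"
    proof safe
      fix x assume "x \<in> circle t" "F x = 0"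
      then obtain \<xi> \<eta> where on: "on_conic W X0 X1 X2 \<Omega>0 \<Omega>1 t \<xi> \<eta> x" using circ by blast
      then have h: "\<eta>\<^sup>2 = poly \<Omega>0 t - \<xi>\<^sup>2 * poly \<Omega>1 t"
        "\<forall>i. poly W t * x $ i = poly (X0 i) t + \<xi> * poly (X1 i) t + \<eta> * poly (X2 i) t"
        by (simp_all add: on_conic_def)
      from F[OF on] \<open>F x = 0\<close> have "poly (slice \<alpha> t) \<xi> = - (\<eta> * poly (slice \<beta> t) \<xi>)"
        by (simp add: poly_slice)
      then have "poly N \<xi> = 0"
        using h(1) by (simp add: N_def \<Omega> power_mult_distrib)
      moreover have "\<exists>s\<in>{-1,1}. \<eta> = s * sqrt (poly \<Omega> \<xi>)"
      proof -
        have "sqrt (poly \<Omega> \<xi>) = \<bar>\<eta>\<bar>" using h(1) by (metis \<Omega> real_sqrt_abs)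
        then show ?thesis by (cases "\<eta> \<ge> 0") auto
      qed
      then obtain s where s: "s \<in> {-1,1}" "\<eta> = s * sqrt (poly \<Omega> \<xi>)" by blast
      have "x = pt (\<xi>, s)"
        using h(2) W unfolding s(2) by (simp add: pt_def vec_eq_iff field_simps)
      ultimately show "x \<in> pt ` (Sigma {\<xi>. poly N \<xi> = 0} (\<lambda>_. {-1, 1}))" using s(1) by blast
    qed
    then show False using inf fin by (meson finite.emptyI finite.insertI finite_SigmaI finite_imageI finite_subset)
  qed
  \<comment> \<open>For large \<open>\<xi>\<close> the value of \<open>\<Omega>\<close> is negative, so that both squares in the norm vanish.\<close>
  have z: "poly (slice \<alpha> t) \<xi> = 0 \<and> poly (slice \<beta> t) \<xi> = 0"
    if \<xi>: "\<xi> > max 1 (poly \<Omega>0 t / poly \<Omega>1 t)" for \<xi>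
  proof -
    have "\<xi> \<le> \<xi>\<^sup>2" using \<xi> by (simp add: power2_eq_square)
    then have "poly \<Omega>0 t / poly \<Omega>1 t < \<xi>\<^sup>2" using \<xi> by simp
    then have neg: "poly \<Omega> \<xi> < 0" using pos by (simp add: \<Omega> field_simps)
    have "(poly (slice \<alpha> t) \<xi>)\<^sup>2 = poly \<Omega> \<xi> * (poly (slice \<beta> t) \<xi>)\<^sup>2"
      using arg_cong[OF \<open>N = 0\<close>, of "\<lambda>p. poly p \<xi>"] by (simp add: N_def)
    moreover have "poly \<Omega> \<xi> * (poly (slice \<beta> t) \<xi>)\<^sup>2 \<le> 0"
      using neg by (simp add: mult_nonpos_nonneg)
    ultimately have "(poly (slice \<alpha> t) \<xi>)\<^sup>2 = 0" "poly \<Omega> \<xi> * (poly (slice \<beta> t) \<xi>)\<^sup>2 = 0"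
      using zero_le_power2[of "poly (slice \<alpha> t) \<xi>"] by linarith+
    with neg show ?thesis by simp
  qed
  have "infinite {\<xi>. \<xi> > max 1 (poly \<Omega>0 t / poly \<Omega>1 t)}"
    using infinite_Ioi unfolding greaterThan_def by blast
  then have "infinite {\<xi>. poly (slice \<alpha> t) \<xi> = 0}" "infinite {\<xi>. poly (slice \<beta> t) \<xi> = 0}"
    using z by (auto elim!: infinite_super[rotated])
  then have "slice \<alpha> t = 0" "slice \<beta> t = 0" using poly_roots_finite by blast+
  then show "poly (coeff \<alpha> i) t = 0 \<and> poly (coeff \<beta> i) t = 0"
    by (metis coeff_0 coeff_slice)
qed

text \<open>
  What is needed of the reduction: vanishing on a circle is expressed by finitely many polynomial
  conditions on \<open>t\<close>, and sufficiently many polynomials of degree \<open>d\<close> have a nontrivial linear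
  combination that vanishes on all circles.
\<close>

lemma reduced_frame:
  obtains E :: "real poly" and K where
    "\<And>t. poly E t = (a \<times> T t) \<bullet> (a \<times> T t)"
    "\<And>d F. polyfun_degree d F \<Longrightarrow> \<exists>\<alpha> \<beta>.
      (\<forall>t x. poly w t \<noteq> 0 \<longrightarrow> poly E t \<noteq> 0 \<longrightarrow> x \<in> circle t \<longrightarrow>
         (\<forall>i. poly (coeff \<alpha> i) t = 0 \<and> poly (coeff \<beta> i) t = 0) \<longrightarrow> F x = 0) \<and>
      (\<forall>t i. poly w t \<noteq> 0 \<longrightarrow> poly E t \<noteq> 0 \<longrightarrow> infinite {x \<in> circle t. F x = 0} \<longrightarrow>
         poly (coeff \<alpha> i) t = 0 \<and> poly (coeff \<beta> i) t = 0)"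
    "\<And>d (I :: (nat \<times> nat \<times> nat) set) f. finite I \<Longrightarrow> (\<And>m. m \<in> I \<Longrightarrow> polyfun_degree d (f m)) \<Longrightarrow>
      2 * (d + 1) * (K * d + 1) < card I \<Longrightarrow>
      \<exists>c. (\<exists>m\<in>I. c m \<noteq> 0) \<and> (\<forall>t x. poly w t \<noteq> 0 \<longrightarrow> poly E t \<noteq> 0 \<longrightarrow> x \<in> circle t \<longrightarrow>
         (\<Sum>m\<in>I. c m * f m x) = 0)"
proof -
  obtain W \<Omega>0 \<Omega>1 E :: "real poly" and X0 X1 X2 :: "3 \<Rightarrow> real poly" where
    E: "\<And>t. poly E t = (a \<times> T t) \<bullet> (a \<times> T t)" and
    W: "\<And>t. poly W t = poly w t * (T t \<bullet> T t) * poly E t" and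
    \<Omega>1: "\<And>t. poly \<Omega>1 t = (poly E t)\<^sup>2 * (T t \<bullet> T t)" and
    circ: "\<And>t x. poly w t \<noteq> 0 \<Longrightarrow> poly E t \<noteq> 0 \<Longrightarrow> x \<in> circle t \<longleftrightarrow>
      (\<exists>\<xi> \<eta>. on_conic W X0 X1 X2 \<Omega>0 \<Omega>1 t \<xi> \<eta> x)"
    by (rule frame[of a]; rule that; assumption)
  obtain K where K: "\<And>d F. polyfun_degree d F \<Longrightarrow>
    \<exists>\<alpha> \<beta>. bidegree_le d (K * d) \<alpha> \<and> bidegree_le d (K * d) \<beta> \<and>
      (\<forall>t \<xi> \<eta> x. on_conic W X0 X1 X2 \<Omega>0 \<Omega>1 t \<xi> \<eta> x \<longrightarrow>
        poly W t ^ d * F x = eval2 \<alpha> t \<xi> + \<eta> * eval2 \<beta> t \<xi>)"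
    by (rule reduction_to_linear_in_eta[of W X0 X1 X2 \<Omega>0 \<Omega>1]; rule that; assumption)
  have pos: "0 < poly \<Omega>1 t" "poly W t \<noteq> 0" if "poly w t \<noteq> 0" "poly E t \<noteq> 0" for t
  proof -
    have "0 < T t \<bullet> T t" using T_nonzero[OF that(1)] by simp
    then show "0 < poly \<Omega>1 t" "poly W t \<noteq> 0" using that by (simp_all add: \<Omega>1 W)
  qed
  show thesis
  proof (rule that[OF E])
    fix d F assume "polyfun_degree d F"
    then obtain \<alpha> \<beta> where ab:
      "\<And>t \<xi> \<eta> x. on_conic W X0 X1 X2 \<Omega>0 \<Omega>1 t \<xi> \<eta> x \<Longrightarrow>
        poly W t ^ d * F x = eval2 \<alpha> t \<xi> + \<eta> * eval2 \<beta> t \<xi>"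
      using K by meson
    show "\<exists>\<alpha> \<beta>.
      (\<forall>t x. poly w t \<noteq> 0 \<longrightarrow> poly E t \<noteq> 0 \<longrightarrow> x \<in> circle t \<longrightarrow>
         (\<forall>i. poly (coeff \<alpha> i) t = 0 \<and> poly (coeff \<beta> i) t = 0) \<longrightarrow> F x = 0) \<and>
      (\<forall>t i. poly w t \<noteq> 0 \<longrightarrow> poly E t \<noteq> 0 \<longrightarrow> infinite {x \<in> circle t. F x = 0} \<longrightarrow>
         poly (coeff \<alpha> i) t = 0 \<and> poly (coeff \<beta> i) t = 0)"
    proof (rule exI[of _ \<alpha>], rule exI[of _ \<beta>], intro conjI allI impI)
      fix t x assume h: "poly w t \<noteq> 0" "poly E t \<noteq> 0" "x \<in> circle t"
        "\<forall>i. poly (coeff \<alpha> i) t = 0 \<and> poly (coeff \<beta> i) t = 0"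
      show "F x = 0"
        by (rule circle_zero_criterion(1)[OF h(1,2) pos(2,1)[OF h(1,2)] circ[OF h(1,2)] ab h(4,3)])
    next
      fix t i assume h: "poly w t \<noteq> 0" "poly E t \<noteq> 0" "infinite {x \<in> circle t. F x = 0}"
      from circle_zero_criterion(2)[OF h(1,2) pos(2,1)[OF h(1,2)] circ[OF h(1,2)] ab h(3)]
      show "poly (coeff \<alpha> i) t = 0" "poly (coeff \<beta> i) t = 0" by blast+
    qed
  next
    fix d and I :: "(nat \<times> nat \<times> nat) set" and f
    assume I: "finite I" and f: "\<And>m. m \<in> I \<Longrightarrow> polyfun_degree d (f m)"
      and card: "2 * (d + 1) * (K * d + 1) < card I"
    have "\<forall>m\<in>I. \<exists>ab. bidegree_le d (K * d) (fst ab) \<and> bidegree_le d (K * d) (snd ab) \<and>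
      (\<forall>t \<xi> \<eta> x. on_conic W X0 X1 X2 \<Omega>0 \<Omega>1 t \<xi> \<eta> x \<longrightarrow>
        poly W t ^ d * f m x = eval2 (fst ab) t \<xi> + \<eta> * eval2 (snd ab) t \<xi>)"
      using K[OF f] by (simp only: split_paired_Ex fst_conv snd_conv) blast
    from bchoice[OF this] obtain ab where ab: "\<And>m. m \<in> I \<Longrightarrow> bidegree_le d (K * d) (fst (ab m))"
      "\<And>m. m \<in> I \<Longrightarrow> bidegree_le d (K * d) (snd (ab m))"
      "\<And>m t \<xi> \<eta> x. m \<in> I \<Longrightarrow>
        on_conic W X0 X1 X2 \<Omega>0 \<Omega>1 t \<xi> \<eta> x \<Longrightarrow>
        poly W t ^ d * f m x = eval2 (fst (ab m)) t \<xi> + \<eta> * eval2 (snd (ab m)) t \<xi>"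
      by blast
    \<comment> \<open>One linear equation for each coefficient of \<open>\<alpha>\<close> and of \<open>\<beta>\<close>.\<close>
    define J where "J = Sigma (UNIV :: bool set) (\<lambda>_. Sigma {..d} (\<lambda>_. {..K * d}))"
    define M where "M = (\<lambda>m (b, i, k). coeff (coeff (if b then fst (ab m) else snd (ab m)) i) k)"
    have "finite J" "card J < card I"
      using card by (simp_all add: J_def mult.commute algebra_simps)
    then obtain c where c: "\<exists>m\<in>I. c m \<noteq> 0" "\<forall>j\<in>J. (\<Sum>m\<in>I. c m * M m j) = 0"
      using nontrivial_linear_relation[OF _ I, of J M] by blast
    have zero: "(\<Sum>m\<in>I. smult [:c m:] (g m)) = 0"
      if g: "\<And>m. m \<in> I \<Longrightarrow> bidegree_le d (K * d) (g m)"
        and M: "\<And>m i k. M m (b, i, k) = coeff (coeff (g m) i) k" for g b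
    proof (intro poly_eqI)
      fix i k
      have "coeff (coeff (\<Sum>m\<in>I. smult [:c m:] (g m)) i) k = (\<Sum>m\<in>I. c m * coeff (coeff (g m) i) k)"
        by (simp add: coeff_sum)
      also have "\<dots> = 0"
      proof (cases "i \<le> d \<and> k \<le> K * d")
        case True
        then have "(b, i, k) \<in> J" by (simp add: J_def)
        from c(2)[rule_format, OF this] show ?thesis by (simp add: M)
      next
        case False
        have "coeff (coeff (g m) i) k = 0" if "m \<in> I" for m
        proof (cases "coeff (g m) i = 0")
          case nz: False
          then have "i \<le> d" "degree (coeff (g m) i) \<le> K * d"
            using g[OF that] unfolding bidegree_le_def by blast+
          then show ?thesis using False by (intro coeff_eq_0) auto
        qed simp
        then show ?thesis by simp
      qed
      finally show "coeff (coeff (\<Sum>m\<in>I. smult [:c m:] (g m)) i) k = coeff (coeff 0 i) k" by simp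
    qed
    have \<alpha>0: "(\<Sum>m\<in>I. smult [:c m:] (fst (ab m))) = 0"
      using zero[of "\<lambda>m. fst (ab m)" True] ab(1) by (simp add: M_def)
    have \<beta>0: "(\<Sum>m\<in>I. smult [:c m:] (snd (ab m))) = 0"
      using zero[of "\<lambda>m. snd (ab m)" False] ab(2) by (simp add: M_def)
    have "(\<Sum>m\<in>I. c m * f m x) = 0" if h: "poly w t \<noteq> 0" "poly E t \<noteq> 0" "x \<in> circle t" for t x
    proof -
      obtain \<xi> \<eta> where xe: "on_conic W X0 X1 X2 \<Omega>0 \<Omega>1 t \<xi> \<eta> x" using circ[OF h(1,2)] h(3) by blast
      have "poly W t ^ d * (\<Sum>m\<in>I. c m * f m x) = (\<Sum>m\<in>I. c m * (poly W t ^ d * f m x))"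
        by (simp add: sum_distrib_left mult.left_commute)
      also have "\<dots> = (\<Sum>m\<in>I. c m * (eval2 (fst (ab m)) t \<xi> + \<eta> * eval2 (snd (ab m)) t \<xi>))"
        using ab(3)[OF _ xe] by (intro sum.cong) auto
      also have "\<dots> = eval2 (\<Sum>m\<in>I. smult [:c m:] (fst (ab m))) t \<xi> + \<eta> * eval2 (\<Sum>m\<in>I. smult [:c m:] (snd (ab m))) t \<xi>"
        by (simp add: eval2_sum sum_distrib_left sum.distrib[symmetric] algebra_simps)
      finally show ?thesis using pos(2)[OF h(1,2)] by (simp add: \<alpha>0 \<beta>0)
    qed
    with c(1) show "\<exists>c. (\<exists>m\<in>I. c m \<noteq> 0) \<and> (\<forall>t x. poly w t \<noteq> 0 \<longrightarrow> poly E t \<noteq> 0 \<longrightarrow> x \<in> circle t \<longrightarrow>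
         (\<Sum>m\<in>I. c m * f m x) = 0)" by blast
  qed
qed

text \<open>
  Irreducibility of the single circle.
\<close>

lemma finite_zeros_on_circle:
  assumes F: "real_polynomial_function F" and t: "poly w t \<noteq> 0"
    and "infinite {x \<in> circle t. F x = 0}" "x \<in> circle t"
  shows "F x = 0"
proof -
  obtain a where a: "a \<times> T t \<noteq> 0"
    using nonparallel_vector_exists[OF T_nonzero[OF t]] .
  obtain d where d: "polyfun_degree d F" using polynomial_imp_polyfun_degree[OF F] by blast
  show ?thesis
  proof (rule reduced_frame[of a])
    fix E K
    assume E: "\<And>t. poly E t = a \<times> T t \<bullet> a \<times> T t"
      and K: "\<And>d F. polyfun_degree d F \<Longrightarrow> \<exists>\<alpha> \<beta>.
      (\<forall>t x. poly w t \<noteq> 0 \<longrightarrow> poly E t \<noteq> 0 \<longrightarrow> x \<in> circle t \<longrightarrow>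
         (\<forall>i. poly (coeff \<alpha> i) t = 0 \<and> poly (coeff \<beta> i) t = 0) \<longrightarrow> F x = 0) \<and>
      (\<forall>t i. poly w t \<noteq> 0 \<longrightarrow> poly E t \<noteq> 0 \<longrightarrow> infinite {x \<in> circle t. F x = 0} \<longrightarrow>
         poly (coeff \<alpha> i) t = 0 \<and> poly (coeff \<beta> i) t = 0)"
    have "poly E t \<noteq> 0" using a by (simp add: E)
    with K[OF d] t assms(3,4) show "F x = 0" by blast
  qed
qed

text \<open>
  The coefficients of the reduced polynomial are polynomials in \<open>t\<close> with infinitely many zeros. The
  frame is chosen for the circle on which the conclusion is wanted, and may degenerate at finitely
  many other parameters.
\<close>

lemma vanishing_on_infinitely_many_circles:
  assumes F: "real_polynomial_function F"
    and inf: "infinite {t. poly w t \<noteq> 0 \<and> infinite {x \<in> circle t. F x = 0}}"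
    and x: "x \<in> sweep"
  shows "F x = 0"
proof -
  obtain s where s: "poly w s \<noteq> 0" "x \<in> circle s" using x unfolding sweep_def by blast
  obtain a where a: "a \<times> T s \<noteq> 0"
    using nonparallel_vector_exists[OF T_nonzero[OF s(1)]] .
  obtain d where d: "polyfun_degree d F" using polynomial_imp_polyfun_degree[OF F] by blast
  show ?thesis
  proof (rule reduced_frame[of a])
    fix E K
    assume E: "\<And>t. poly E t = a \<times> T t \<bullet> a \<times> T t"
      and K: "\<And>d F. polyfun_degree d F \<Longrightarrow> \<exists>\<alpha> \<beta>.
      (\<forall>t x. poly w t \<noteq> 0 \<longrightarrow> poly E t \<noteq> 0 \<longrightarrow> x \<in> circle t \<longrightarrow>
         (\<forall>i. poly (coeff \<alpha> i) t = 0 \<and> poly (coeff \<beta> i) t = 0) \<longrightarrow> F x = 0) \<and>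
      (\<forall>t i. poly w t \<noteq> 0 \<longrightarrow> poly E t \<noteq> 0 \<longrightarrow> infinite {x \<in> circle t. F x = 0} \<longrightarrow>
         poly (coeff \<alpha> i) t = 0 \<and> poly (coeff \<beta> i) t = 0)"
    have E0: "poly E s \<noteq> 0" using a by (simp add: E)
    then have "finite {t. poly E t = 0}" by (intro poly_roots_finite) auto
    with inf have "infinite ({t. poly w t \<noteq> 0 \<and> infinite {x \<in> circle t. F x = 0}} - {t. poly E t = 0})"
      by (rule Diff_infinite_finite[rotated])
    obtain \<alpha> \<beta> where
      1: "\<And>t x. poly w t \<noteq> 0 \<Longrightarrow> poly E t \<noteq> 0 \<Longrightarrow> x \<in> circle t \<Longrightarrow>
         (\<forall>i. poly (coeff \<alpha> i) t = 0 \<and> poly (coeff \<beta> i) t = 0) \<Longrightarrow> F x = 0" and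
      2: "\<And>t i. poly w t \<noteq> 0 \<Longrightarrow> poly E t \<noteq> 0 \<Longrightarrow> infinite {x \<in> circle t. F x = 0} \<Longrightarrow>
         poly (coeff \<alpha> i) t = 0 \<and> poly (coeff \<beta> i) t = 0"
      using K[OF d] by (elim exE conjE) blast
    let ?Z = "{t. poly w t \<noteq> 0 \<and> infinite {x \<in> circle t. F x = 0}} - {t. poly E t = 0}"
    have "infinite {t. poly (coeff \<alpha> i) t = 0}" "infinite {t. poly (coeff \<beta> i) t = 0}" for i
      using 2 \<open>infinite ?Z\<close> by (auto elim!: infinite_super[rotated])
    then have "coeff \<alpha> i = 0" "coeff \<beta> i = 0" for i
      using poly_roots_finite by metis+
    then show "F x = 0" using 1[OF s(1) E0 s(2)] by simp
  qed
qed

end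

section \<open>Normals along the characteristic circles\<close>

lemma has_vector_derivative_vec_componentI:
  fixes f :: "real \<Rightarrow> real^3"
  assumes "\<And>i. ((\<lambda>s. f s $ i) has_real_derivative f' $ i) (at t)"
  shows "(f has_vector_derivative f') (at t)"
  unfolding has_vector_derivative_def
proof (subst has_derivative_componentwise_within, intro ballI)
  fix b :: "real^3" assume "b \<in> Basis"
  then obtain i where b: "b = axis i 1" by (auto simp: Basis_vec_def)
  show "((\<lambda>x. f x \<bullet> b) has_derivative (\<lambda>x. (x *\<^sub>R f') \<bullet> b)) (at t)"
    using assms[of i] unfolding b
    by (simp add: inner_axis has_field_derivative_def mult_commute_abs)
qed

lemma has_real_derivative_inner:
  fixes f g :: "real \<Rightarrow> real^3"
  assumes "(f has_vector_derivative f') (at t)" "(g has_vector_derivative g') (at t)"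
  shows "((\<lambda>s. f s \<bullet> g s) has_real_derivative f t \<bullet> g' + f' \<bullet> g t) (at t)"
  using bounded_bilinear.has_vector_derivative[OF bounded_bilinear_inner assms]
  by (simp add: has_real_derivative_iff_has_vector_derivative)

lemma has_real_derivative_gradient:
  fixes f :: "real \<Rightarrow> real^3"
  assumes "(F has_derivative (\<lambda>h. G \<bullet> h)) (at (f t))" "(f has_vector_derivative f') (at t)"
  shows "((\<lambda>s. F (f s)) has_real_derivative G \<bullet> f') (at t)"
  using has_derivative_compose[OF assms(2)[unfolded has_vector_derivative_def] assms(1)]
  by (simp add: has_field_derivative_def mult.commute[of _ "G \<bullet> f'"] mult_commute_abs)

text \<open>
  Used to differentiate the equations of sphere and plane along curves on the envelope.
\<close>

lemma derivative_of_vanishing: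
  assumes "(g has_real_derivative D) (at t)" "eventually (\<lambda>s. g s = 0) (nhds t)"
  shows "D = 0"
proof -
  have "((\<lambda>s. 0) has_real_derivative D) (at t)"
    using DERIV_cong_ev[OF refl assms(2) refl, of D] assms(1) by simp
  then show ?thesis using DERIV_const DERIV_unique by blast
qed

lemma poly_vec_has_vector_derivative:
  "(poly_vec C has_vector_derivative poly_vec (\<chi> i. pderiv (C $ i)) t) (at t)"
  by (rule has_vector_derivative_vec_componentI) (simp add: poly_DERIV)

context canal_family
begin

lemma poly_U: "poly U t = poly (pderiv R) t * poly w t - poly R t * poly (pderiv w) t"
  by (simp add: U_def cleared_deriv_def)

lemma T_eq: "T t = poly w t *\<^sub>R poly_vec (\<chi> i. pderiv (C $ i)) t - poly (pderiv w) t *\<^sub>R poly_vec C t"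
  by (simp add: vec_eq_iff T_def cleared_deriv_def mult.commute)

definition T' :: "real \<Rightarrow> real^3" where
  "T' = poly_vec (\<chi> i. pderiv (cleared_deriv w (C $ i)))"

lemma T_has_vector_derivative: "(T has_vector_derivative T' t) (at t)"
  using poly_vec_has_vector_derivative[of "\<chi> i. cleared_deriv w (C $ i)" t]
  by (simp add: T_def T'_def)

lemma polynomial_Y: "real_polynomial_function (\<lambda>x. Y t x $ i)"
  by (simp add: Y_def) (intro polyfun_intros)

text \<open>
  The tangent direction of the circle does not vanish, as \<open>Y\<close> and \<open>T\<close> cannot be parallel: equality in
  the Cauchy-Schwarz inequality would mean \<open>U\<^sup>2 = T \<bullet> T\<close>.
\<close>

lemma T_cross_Y:
  assumes "poly w t \<noteq> 0" "poly R t \<noteq> 0" "x \<in> circle t"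
  shows "T t \<times> Y t x \<noteq> 0"
proof
  assume "T t \<times> Y t x = 0"
  then have "(T t \<bullet> Y t x)\<^sup>2 = (T t \<bullet> T t) * (Y t x \<bullet> Y t x)"
    using norm_cross_dot[of "T t" "Y t x"] by (simp add: power_mult_distrib power2_norm_eq_inner)
  moreover have "T t \<bullet> Y t x = - (poly R t * poly U t)"
    using assms(3) by (simp add: circle_def inner_commute)
  ultimately have "(poly R t)\<^sup>2 * (poly U t)\<^sup>2 = (poly R t)\<^sup>2 * (T t \<bullet> T t)"
    using assms(3) by (simp add: circle_def power_mult_distrib)
  then show False using U_less[OF assms(1)] assms(2) by simp
qed

text \<open>
  Differentiate \<open>F\<close> along the rotation about the axis of the circle.
\<close>

lemma gradient_along_circle:
  assumes F: "\<And>x. x \<in> circle t \<Longrightarrow> F x = 0"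
    and G: "(F has_derivative (\<lambda>h. G \<bullet> h)) (at x)"
    and t: "poly w t \<noteq> 0" and x: "x \<in> circle t"
  shows "G \<bullet> (T t \<times> Y t x) = 0"
proof -
  define N where "N = T t \<bullet> T t"
  have N: "N > 0" using T_nonzero[OF t] by (simp add: N_def)
  define y where "y = Y t x"
  define p where "p = (y \<bullet> T t / N) *\<^sub>R T t"
  define b where "b = (1 / sqrt N) *\<^sub>R (T t \<times> y)"
  define rot where "rot = (\<lambda>\<theta>. p + cos \<theta> *\<^sub>R (y - p) + sin \<theta> *\<^sub>R b)"
  define pt where "pt = (\<lambda>\<theta>. (1 / poly w t) *\<^sub>R (poly_vec C t + rot \<theta>))"
  have orth: "p \<bullet> T t = y \<bullet> T t" "b \<bullet> T t = 0" "b \<bullet> y = 0" "b \<bullet> p = 0" "p \<bullet> (y - p) = 0"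
    using N by (simp_all add: p_def b_def dot_cross_self N_def inner_diff_right inner_commute)
  have bb: "b \<bullet> b = (y - p) \<bullet> (y - p)"
  proof -
    have "(T t \<times> y) \<bullet> (T t \<times> y) = N * (y \<bullet> y) - (y \<bullet> T t)\<^sup>2"
      using norm_cross_dot[of "T t" y] by (simp add: power_mult_distrib power2_norm_eq_inner N_def inner_commute)
    then have "b \<bullet> b = (N * (y \<bullet> y) - (y \<bullet> T t)\<^sup>2) / N"
      using N by (simp add: b_def field_simps)
    also have "\<dots> = y \<bullet> y - 2 * (y \<bullet> p) + p \<bullet> p"
    proof -
      have "y \<bullet> p = (y \<bullet> T t)\<^sup>2 / N" by (simp add: p_def power2_eq_square)
      moreover have "p \<bullet> p = (y \<bullet> T t)\<^sup>2 / N"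
        using N by (simp add: p_def N_def[symmetric] power2_eq_square)
      ultimately show ?thesis using N by (simp add: diff_divide_distrib)
    qed
    also have "\<dots> = (y - p) \<bullet> (y - p)"
      by (simp add: inner_diff_left inner_diff_right inner_commute)
    finally show ?thesis .
  qed
  have rotT: "rot \<theta> \<bullet> T t = y \<bullet> T t" for \<theta>
    by (simp add: rot_def inner_add_left inner_diff_left orth)
  have rotrot: "rot \<theta> \<bullet> rot \<theta> = y \<bullet> y" for \<theta>
  proof -
    define q where "q = y - p"
    have o: "p \<bullet> q = 0" "q \<bullet> p = 0" "b \<bullet> q = 0" "q \<bullet> b = 0" "p \<bullet> b = 0" "b \<bullet> p = 0" "b \<bullet> b = q \<bullet> q"
      using orth bb by (simp_all add: q_def inner_diff_right inner_diff_left inner_commute)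
    have "rot \<theta> \<bullet> rot \<theta> = p \<bullet> p + (cos \<theta> * cos \<theta> * (q \<bullet> q) + sin \<theta> * sin \<theta> * (q \<bullet> q))"
      by (simp add: rot_def q_def[symmetric] inner_add_left inner_add_right o algebra_simps)
    also have "\<dots> = p \<bullet> p + q \<bullet> q"
      by (simp flip: distrib_right power2_eq_square)
    also have "\<dots> = (p + q) \<bullet> (p + q)" by (simp add: inner_add_left inner_add_right o)
    also have "p + q = y" by (simp add: q_def)
    finally show ?thesis .
  qed
  have Ypt: "Y t (pt \<theta>) = rot \<theta>" for \<theta>
    using t by (simp add: Y_def pt_def)
  have "pt \<theta> \<in> circle t" for \<theta>
    using x rotT rotrot unfolding circle_def mem_Collect_eq Ypt y_def by simp
  then have zero: "F (pt \<theta>) = 0" for \<theta> using F by blast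
  have "pt 0 = x" using t by (simp add: pt_def rot_def y_def Y_def)
  have "(rot has_vector_derivative b) (at 0)"
    unfolding rot_def by (auto intro!: derivative_eq_intros)
  then have "(pt has_vector_derivative (1 / poly w t) *\<^sub>R b) (at 0)"
    unfolding pt_def by (auto intro!: derivative_eq_intros)
  then have "((\<lambda>\<theta>. F (pt \<theta>)) has_real_derivative G \<bullet> ((1 / poly w t) *\<^sub>R b)) (at 0)"
    using G \<open>pt 0 = x\<close> by (intro has_real_derivative_gradient) simp_all
  then have "G \<bullet> ((1 / poly w t) *\<^sub>R b) = 0"
    by (rule derivative_of_vanishing) (simp add: zero)
  then show ?thesis using t N by (simp add: b_def y_def)
qed

text \<open>
  For a curve \<open>x(t)\<close> with \<open>x(t)\<close> on the circle at \<open>t\<close>, differentiating the plane equation shows that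
  \<open>w\<^sup>2 * (x' \<bullet> T)\<close> is the negative of this expression. Where it does not vanish, the curve is
  transversal to the circles, that is, \<open>x\<close> is a regular point of the envelope.
\<close>

definition transversality :: "real \<Rightarrow> real^3 \<Rightarrow> real" where
  "transversality t x = Y t x \<bullet> (poly w t *\<^sub>R T' t + poly (pderiv w) t *\<^sub>R T t) + poly w t * poly (pderiv (R * U)) t - T t \<bullet> T t"

text \<open>
  The expression is affine in \<open>x\<close>. If it vanished on the whole circle, then its gradient would be
  orthogonal to all tangents of the circle, hence parallel to \<open>T\<close>, and \<open>c''\<close> would be parallel to \<open>c'\<close>.
\<close>

lemma finite_zeros_transversality:
  assumes t: "poly w t \<noteq> 0" "poly R t \<noteq> 0" and curved: "T t \<times> T' t \<noteq> 0"
  shows "finite {x \<in> circle t. transversality t x = 0}"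
proof (rule ccontr)
  assume inf: "infinite {x \<in> circle t. transversality t x = 0}"
  have grad: "((\<lambda>x. Y t x \<bullet> a + k) has_derivative (\<lambda>h. (poly w t *\<^sub>R a) \<bullet> h)) (at x)" for a x k
    unfolding Y_def
    by (auto intro!: derivative_eq_intros simp: inner_diff_left inner_commute)
  have "real_polynomial_function (transversality t)"
    unfolding transversality_def
    by (intro polyfun_intros real_polynomial_function_inner polynomial_Y)
  then have J0: "transversality t x = 0" if "x \<in> circle t" for x
    using finite_zeros_on_circle t inf that by blast
  define m where "m = T t \<times> T' t"
  have mY: "m \<bullet> Y t x = 0" if "x \<in> circle t" for x
  proof -
    have "(poly w t *\<^sub>R (poly w t *\<^sub>R T' t + poly (pderiv w) t *\<^sub>R T t)) \<bullet> (T t \<times> Y t x) = 0"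
    proof (rule gradient_along_circle[OF J0 _ t(1) that])
      show "(transversality t has_derivative (\<bullet>) (poly w t *\<^sub>R (poly w t *\<^sub>R T' t + poly (pderiv w) t *\<^sub>R T t))) (at x)"
        using grad[of "poly w t *\<^sub>R T' t + poly (pderiv w) t *\<^sub>R T t"
            "poly w t * poly (pderiv (R * U)) t - T t \<bullet> T t" x]
        by (simp only: transversality_def[abs_def] add_diff_eq)
    qed
    then have "T' t \<bullet> (T t \<times> Y t x) = 0"
      using t by (simp add: inner_add_left dot_cross_self)
    moreover have "m \<bullet> Y t x = - (T' t \<bullet> (T t \<times> Y t x))"
      by (simp add: m_def inner_vec_def sum_3 cross_components algebra_simps)
    ultimately show ?thesis by simp
  qed
  obtain x where x: "x \<in> circle t" using infinite_circle[OF t] by (metis ex_in_conv finite.emptyI)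
  have "(poly w t *\<^sub>R m) \<bullet> (T t \<times> Y t x) = 0"
    by (rule gradient_along_circle[OF _ _ t(1) x, of "\<lambda>x. Y t x \<bullet> m"])
      (use mY grad[of m 0] in \<open>simp_all add: inner_commute\<close>)
  then have 1: "m \<bullet> (T t \<times> Y t x) = 0" using t by simp
  have 2: "m \<bullet> T t = 0" by (simp add: m_def dot_cross_self)
  have "((T t \<times> Y t x) \<bullet> (T t \<times> Y t x)) *\<^sub>R m =
    (m \<bullet> (T t \<times> Y t x)) *\<^sub>R (T t \<times> Y t x) + (m \<bullet> T t) *\<^sub>R ((Y t x \<bullet> Y t x) *\<^sub>R T t - (T t \<bullet> Y t x) *\<^sub>R Y t x)
     + (m \<bullet> Y t x) *\<^sub>R ((T t \<bullet> T t) *\<^sub>R Y t x - (T t \<bullet> Y t x) *\<^sub>R T t)"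
    unfolding vec_eq_iff forall_3 inner_vec_def sum_3 inner_real_def vector_add_component
      vector_minus_component vector_scaleR_component cross_components real_scaleR_def
    by (intro conjI; algebra)
  then have "m = 0" using 1 2 mY[OF x] T_cross_Y[OF t x] by simp
  then show False using curved by (simp add: m_def)
qed

text \<open>
  The derivatives of the sphere and plane equations along the curve \<open>c\<close> show that its velocity \<open>v\<close> is
  orthogonal to the radius vector and independent of the tangent of the circle. Thus the tangent plane
  of the envelope is the tangent plane of the sphere.
\<close>

lemma normal_at_regular_point:
  assumes p: "\<And>x. x \<in> sweep \<Longrightarrow> p x = 0"
    and G: "(p has_derivative (\<lambda>h. G \<bullet> h)) (at x)"
    and t: "poly w t \<noteq> 0" and x: "x \<in> circle t" and transversality: "transversality t x \<noteq> 0"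
    and curve: "(c has_vector_derivative v) (at t)" "c t = x" "eventually (\<lambda>s. c s \<in> circle s) (nhds t)"
  shows "G \<times> Y t x = 0"
proof -
  have wne: "eventually (\<lambda>s. poly w s \<noteq> 0) (nhds t)"
    using eventually_nhds_in_open[of "{s. poly w s \<noteq> 0}" t] t
    by (simp add: open_Collect_neq continuous_intros)
  have circ: "Y s (c s) \<bullet> Y s (c s) - poly (R * R) s = 0 \<and> Y s (c s) \<bullet> T s + poly (R * U) s = 0"
    if "c s \<in> circle s" for s
    using that by (simp add: circle_def power2_eq_square)
  define y where "y = Y t x"
  define y' where "y' = poly w t *\<^sub>R v + poly (pderiv w) t *\<^sub>R x - poly_vec (\<chi> i. pderiv (C $ i)) t"
  have dY: "((\<lambda>s. Y s (c s)) has_vector_derivative y') (at t)"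
    unfolding Y_def y'_def using curve(2)
    by (auto intro!: derivative_eq_intros curve(1) poly_vec_has_vector_derivative)
  have "((\<lambda>s. Y s (c s) \<bullet> Y s (c s) - poly (R * R) s) has_real_derivative
      (y \<bullet> y' + y' \<bullet> y) - poly (pderiv (R * R)) t) (at t)"
    unfolding y_def by (rule DERIV_diff[OF _ poly_DERIV])
      (use has_real_derivative_inner[OF dY dY] curve(2) in simp)
  then have "(y \<bullet> y' + y' \<bullet> y) - poly (pderiv (R * R)) t = 0"
    by (rule derivative_of_vanishing) (use curve(3) in \<open>eventually_elim, use circ in blast\<close>)
  then have yy': "y \<bullet> y' = poly R t * poly (pderiv R) t"
    by (simp add: pderiv_mult inner_commute)
  have "((\<lambda>s. Y s (c s) \<bullet> T s + poly (R * U) s) has_real_derivative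
      (y \<bullet> T' t + y' \<bullet> T t) + poly (pderiv (R * U)) t) (at t)"
    unfolding y_def by (rule DERIV_add[OF _ poly_DERIV])
      (use has_real_derivative_inner[OF dY T_has_vector_derivative] curve(2) in simp)
  then have yT: "(y \<bullet> T' t + y' \<bullet> T t) + poly (pderiv (R * U)) t = 0"
    by (rule derivative_of_vanishing) (use curve(3) in \<open>eventually_elim, use circ in blast\<close>)
  have wy': "poly w t *\<^sub>R y' = poly (pderiv w) t *\<^sub>R y + (poly w t)\<^sup>2 *\<^sub>R v - T t"
    by (simp add: y'_def y_def Y_def T_eq algebra_simps power2_eq_square)
  have y: "y \<bullet> y = (poly R t)\<^sup>2" "y \<bullet> T t = - (poly R t * poly U t)"
    using x by (auto simp: circle_def y_def)
  have "(poly w t)\<^sup>2 * (y \<bullet> v) = poly w t * (y \<bullet> y') - poly (pderiv w) t * (y \<bullet> y) + y \<bullet> T t"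
    using arg_cong[OF wy', of "\<lambda>u. y \<bullet> u"] by (simp add: inner_add_right inner_diff_right)
  also have "\<dots> = 0" unfolding yy' y poly_U by (simp add: power2_eq_square algebra_simps)
  finally have yv: "y \<bullet> v = 0" using t by simp
  have "(poly w t)\<^sup>2 * (v \<bullet> T t) = poly w t * (y' \<bullet> T t) - poly (pderiv w) t * (y \<bullet> T t) + T t \<bullet> T t"
    using arg_cong[OF wy', of "\<lambda>u. u \<bullet> T t"] by (simp add: inner_add_left inner_diff_left)
  also have "y' \<bullet> T t = - (y \<bullet> T' t) - poly (pderiv (R * U)) t" using yT by simp
  finally have "(poly w t)\<^sup>2 * (v \<bullet> T t) = - transversality t x"
    unfolding transversality_def y_def[symmetric] by (simp add: inner_add_right algebra_simps)
  then have vT: "v \<bullet> T t \<noteq> 0" using transversality by auto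
  have "((\<lambda>s. p (c s)) has_real_derivative G \<bullet> v) (at t)"
    using has_real_derivative_gradient[OF _ curve(1)] G curve(2) by simp
  then have Gv: "G \<bullet> v = 0"
    by (rule derivative_of_vanishing)
      (use curve(3) wne in \<open>eventually_elim, use p in \<open>auto simp: sweep_def\<close>\<close>)
  have "p x = 0" if "x \<in> circle t" for x using p that t by (auto simp: sweep_def)
  from gradient_along_circle[OF this G t x] have GTy: "G \<bullet> (T t \<times> y) = 0" by (simp add: y_def)
  have "(v \<bullet> T t) *\<^sub>R (G \<times> y) = (G \<bullet> v) *\<^sub>R (T t \<times> y) - (G \<bullet> (T t \<times> y)) *\<^sub>R v + (y \<bullet> v) *\<^sub>R (G \<times> T t)"
    unfolding vec_eq_iff forall_3 inner_vec_def sum_3 inner_real_def vector_add_component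
      vector_minus_component vector_scaleR_component cross_components real_scaleR_def
    by (intro conjI; algebra)
  then show ?thesis using vT yv Gv GTy by (simp add: y_def)
qed

text \<open>
  Keep \<open>\<xi>\<close> fixed and move \<open>t\<close>; then \<open>\<eta>\<close> is the square root of a polynomial in \<open>t\<close>, which is
  differentiable unless \<open>\<eta> = 0\<close>. The two values of \<open>\<xi>\<close> with \<open>\<eta> = 0\<close> are the exceptions.
\<close>

lemma finite_without_transversal_curve:
  assumes t: "poly w t \<noteq> 0" "poly R t \<noteq> 0"
  shows "finite {x \<in> circle t. \<not> (\<exists>c v. (c has_vector_derivative v) (at t) \<and> c t = x \<and>
    eventually (\<lambda>s. c s \<in> circle s) (nhds t))}" (is "finite ?B")
proof -
  obtain a where a: "a \<times> T t \<noteq> 0"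
    using nonparallel_vector_exists[OF T_nonzero[OF t(1)]] .
  obtain W \<Omega>0 \<Omega>1 E :: "real poly" and X0 X1 X2 :: "3 \<Rightarrow> real poly" where
    E: "\<And>t. poly E t = (a \<times> T t) \<bullet> (a \<times> T t)" and
    W: "\<And>t. poly W t = poly w t * (T t \<bullet> T t) * poly E t" and
    \<Omega>1: "\<And>t. poly \<Omega>1 t = (poly E t)\<^sup>2 * (T t \<bullet> T t)" and
    circ: "\<And>t x. poly w t \<noteq> 0 \<Longrightarrow> poly E t \<noteq> 0 \<Longrightarrow> x \<in> circle t \<longleftrightarrow>
      (\<exists>\<xi> \<eta>. on_conic W X0 X1 X2 \<Omega>0 \<Omega>1 t \<xi> \<eta> x)"
    by (rule frame[of a]; rule that; assumption)
  have nz: "poly E t \<noteq> 0" using a by (simp add: E)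
  have W0: "poly W t \<noteq> 0" and O1: "poly \<Omega>1 t \<noteq> 0"
    using nz T_nonzero[OF t(1)] t by (simp_all add: W \<Omega>1)
  define pt where "pt = (\<lambda>\<xi>. (\<chi> i. (poly (X0 i) t + \<xi> * poly (X1 i) t) / poly W t) :: real^3)"
  define Z where "Z = {\<xi>. poly [:poly \<Omega>0 t, 0, - poly \<Omega>1 t:] \<xi> = 0}"
  have "?B \<subseteq> pt ` Z"
  proof
    fix x assume x: "x \<in> ?B"
    then obtain \<xi> \<eta> where h: "\<eta>\<^sup>2 = poly \<Omega>0 t - \<xi>\<^sup>2 * poly \<Omega>1 t"
        "\<forall>i. poly W t * x $ i = poly (X0 i) t + \<xi> * poly (X1 i) t + \<eta> * poly (X2 i) t"
      using circ[OF t(1) nz] unfolding on_conic_def by blast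
    have "\<eta> = 0"
    proof (rule ccontr)
      assume \<eta>: "\<eta> \<noteq> 0"
      define q where "q = \<Omega>0 - [:\<xi>\<^sup>2:] * \<Omega>1"
      have q: "poly q s = poly \<Omega>0 s - \<xi>\<^sup>2 * poly \<Omega>1 s" for s by (simp add: q_def)
      have qpos: "0 < poly q t" using h(1) \<eta> by (simp add: q flip: h(1))
      define A where "A = (\<lambda>i. X0 i + smult \<xi> (X1 i))"
      define B where "B = (\<lambda>i. smult (sgn \<eta>) (X2 i))"
      define c where "c = (\<lambda>s. (\<chi> i. (poly (A i) s + sqrt (poly q s) * poly (B i) s) / poly W s) :: real^3)"
      have "\<exists>D. ((\<lambda>s. c s $ i) has_real_derivative D) (at t)" for i
        using DERIV_divide[OF DERIV_add[OF poly_DERIV[of "A i"]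
              DERIV_mult[OF DERIV_chain2[OF DERIV_real_sqrt[OF qpos] poly_DERIV] poly_DERIV[of "B i"]]] poly_DERIV W0]
        unfolding c_def vec_lambda_beta by blast
      then obtain D where "\<And>i. ((\<lambda>s. c s $ i) has_real_derivative D i) (at t)" by metis
      then have "(c has_vector_derivative (\<chi> i. D i)) (at t)"
        by (intro has_vector_derivative_vec_componentI) simp
      moreover have "c t = x"
      proof -
        have "sqrt (poly q t) = \<bar>\<eta>\<bar>" using h(1) by (metis q real_sqrt_abs)
        then have "sgn \<eta> * sqrt (poly q t) = \<eta>" by (simp add: sgn_mult_abs)
        then have "sqrt (poly q t) * poly (B i) t = \<eta> * poly (X2 i) t" for i
          by (simp add: B_def) (metis mult.commute mult.left_commute)
        then show ?thesis
          using h(2) W0 by (simp add: c_def A_def vec_eq_iff field_simps)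
      qed
      moreover have "eventually (\<lambda>s. c s \<in> circle s) (nhds t)"
      proof -
        define V where "V = {s. poly w s \<noteq> 0} \<inter> {s. poly E s \<noteq> 0} \<inter> {s. 0 < poly q s}"
        have "open V" unfolding V_def
          by (intro open_Int open_Collect_neq open_Collect_less continuous_intros)
        moreover have "t \<in> V" using t nz qpos by (simp add: V_def)
        ultimately have "eventually (\<lambda>s. s \<in> V) (nhds t)" by (rule eventually_nhds_in_open)
        then show ?thesis
        proof eventually_elim
          case (elim s)
          then have s: "poly w s \<noteq> 0" "poly E s \<noteq> 0" "0 < poly q s" by (simp_all add: V_def)
          then have "poly W s \<noteq> 0" using T_nonzero[OF s(1)] by (simp add: W)
          then have "\<forall>i. poly W s * c s $ i = poly (X0 i) s + \<xi> * poly (X1 i) s + (sgn \<eta> * sqrt (poly q s)) * poly (X2 i) s"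
            by (simp add: c_def A_def B_def)
          moreover have "(sgn \<eta> * sqrt (poly q s))\<^sup>2 = poly \<Omega>0 s - \<xi>\<^sup>2 * poly \<Omega>1 s"
            using s(3) \<eta> by (simp add: power_mult_distrib q sgn_if)
          ultimately show ?case using circ[OF s(1,2)] unfolding on_conic_def by blast
        qed
      qed
      ultimately show False using x by blast
    qed
    then have "\<xi> \<in> Z" using h(1) by (simp add: Z_def power2_eq_square algebra_simps)
    moreover have "x = pt \<xi>"
      using h(2) \<open>\<eta> = 0\<close> W0 by (simp add: pt_def vec_eq_iff field_simps)
    ultimately show "x \<in> pt ` Z" by blast
  qed
  moreover have "finite Z" unfolding Z_def using O1 by (intro poly_roots_finite) simp
  ultimately show ?thesis by (meson finite_imageI finite_subset)
qed

text \<open>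
  The relation holds at all but finitely many points of the circle, and both sides are polynomials in
  \<open>x\<close>.
\<close>

lemma normal_parallel_radius:
  assumes p: "\<And>x. x \<in> sweep \<Longrightarrow> p x = 0"
    and G: "\<And>x. (p has_derivative (\<lambda>h. G x \<bullet> h)) (at x)"
    and polyG: "\<And>i. real_polynomial_function (\<lambda>x. G x $ i)"
    and t: "poly w t \<noteq> 0" "poly R t \<noteq> 0" and curved: "T t \<times> T' t \<noteq> 0"
    and x: "x \<in> circle t"
  shows "G x \<times> Y t x = 0"
proof -
  have "(G x \<times> Y t x) $ i = 0" for i
  proof (rule finite_zeros_on_circle[OF _ t(1) _ x])
    show "real_polynomial_function (\<lambda>x. (G x \<times> Y t x) $ i)"
      by (intro real_polynomial_function_cross3 polyG polynomial_Y)
    let ?B = "{x \<in> circle t. \<not> (\<exists>c v. (c has_vector_derivative v) (at t) \<and> c t = x \<and>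
      eventually (\<lambda>s. c s \<in> circle s) (nhds t))} \<union> {x \<in> circle t. transversality t x = 0}"
    have "infinite (circle t - ?B)"
      using finite_without_transversal_curve[OF t] finite_zeros_transversality[OF t curved] infinite_circle[OF t]
      by (intro Diff_infinite_finite) auto
    moreover have "circle t - ?B \<subseteq> {x \<in> circle t. (G x \<times> Y t x) $ i = 0}"
      using normal_at_regular_point[OF p G t(1)] by auto
    ultimately show "infinite {x \<in> circle t. (G x \<times> Y t x) $ i = 0}"
      using infinite_super by blast
  qed
  then show ?thesis by (simp add: vec_eq_iff)
qed

end

section \<open>The characteristic circles as lines of curvature\<close>

text \<open>
  For \<open>M = H - \<nu> I\<close> this is \<open>n\<^sup>T adj(M) n\<close>, the negative of the determinant of \<open>M\<close> bordered by \<open>n\<close>. As a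
  polynomial in \<open>\<nu>\<close> it is quadratic. For the gradient \<open>n\<close> and the Hessian \<open>H\<close> of an equation of a
  surface, its roots are the principal curvatures, up to the factor \<open>\<parallel>n\<parallel>\<close>.
\<close>

definition focal_form :: "real^3^3 \<Rightarrow> real^3 \<Rightarrow> real \<Rightarrow> real" where
  "focal_form H n \<nu> = (let M = (\<lambda>i. H $ i - \<nu> *\<^sub>R axis i 1) in
     n \<bullet> (n $ 1 *\<^sub>R (M 2 \<times> M 3) + n $ 2 *\<^sub>R (M 3 \<times> M 1) + n $ 3 *\<^sub>R (M 1 \<times> M 2)))"

definition focal_linear :: "real^3^3 \<Rightarrow> real^3 \<Rightarrow> real" where
  "focal_linear H n = focal_form H n 1 - n \<bullet> n - focal_form H n 0"

lemma axis_components_3 [simp]: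
  "axis (1::3) 1 $ 1 = (1::real)" "axis (1::3) 1 $ 2 = (0::real)" "axis (1::3) 1 $ 3 = (0::real)"
  "axis (2::3) 1 $ 1 = (0::real)" "axis (2::3) 1 $ 2 = (1::real)" "axis (2::3) 1 $ 3 = (0::real)"
  "axis (3::3) 1 $ 1 = (0::real)" "axis (3::3) 1 $ 2 = (0::real)" "axis (3::3) 1 $ 3 = (1::real)"
  by (simp_all add: axis_def)

lemma focal_form_quadratic:
  "focal_form H n \<nu> = (n \<bullet> n) * \<nu>\<^sup>2 + focal_linear H n * \<nu> + focal_form H n 0"
  unfolding focal_linear_def focal_form_def Let_def inner_vec_def sum_3 inner_real_def
    vector_add_component vector_minus_component vector_scaleR_component cross_components
    axis_components_3 real_scaleR_def
  by algebra

lemma focal_form_scale: "focal_form H (s *\<^sub>R n) \<nu> = s\<^sup>2 * focal_form H n \<nu>"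
  unfolding focal_form_def Let_def
  by (simp add: inner_add_right power2_eq_square algebra_simps)

text \<open>
  Cramer's rule for the matrix with rows \<open>a\<close>, \<open>b\<close>, \<open>c\<close>.
\<close>

lemma cramer_cross3:
  fixes a b c v :: "real^3"
  shows "(a \<bullet> v) *\<^sub>R (b \<times> c) + (b \<bullet> v) *\<^sub>R (c \<times> a) + (c \<bullet> v) *\<^sub>R (a \<times> b) = (a \<bullet> (b \<times> c)) *\<^sub>R v"
  unfolding vec_eq_iff forall_3 inner_vec_def sum_3 inner_real_def vector_add_component
    vector_scaleR_component cross_components real_scaleR_def
  by (intro conjI; algebra)

text \<open>
  The hypothesis says that \<open>v\<close> is a principal direction: \<open>(H - \<nu> I) v\<close> is normal to the surface.
\<close>

lemma focal_form_zero:
  fixes H :: "real^3^3"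
  assumes "v \<noteq> 0" "n \<bullet> v = 0" and Hv: "\<And>i. H $ i \<bullet> v - \<nu> * v $ i = \<kappa> * n $ i"
  shows "focal_form H n \<nu> = 0"
proof -
  define M where "M = (\<lambda>i. H $ i - \<nu> *\<^sub>R axis i 1)"
  have Mv: "M i \<bullet> v = \<kappa> * n $ i" for i
    using Hv[of i] by (simp add: M_def inner_diff_left inner_axis' )
  have form: "focal_form H n \<nu> =
     n \<bullet> (n $ 1 *\<^sub>R (M 2 \<times> M 3) + n $ 2 *\<^sub>R (M 3 \<times> M 1) + n $ 3 *\<^sub>R (M 1 \<times> M 2))"
    by (simp add: focal_form_def M_def Let_def)
  show ?thesis
  proof (cases "\<kappa> = 0")
    case False
    have "\<kappa> * focal_form H n \<nu> =
      n \<bullet> ((M 1 \<bullet> v) *\<^sub>R (M 2 \<times> M 3) + (M 2 \<bullet> v) *\<^sub>R (M 3 \<times> M 1) + (M 3 \<bullet> v) *\<^sub>R (M 1 \<times> M 2))"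
      by (simp add: form Mv inner_add_right algebra_simps)
    also have "\<dots> = 0" unfolding cramer_cross3 using assms by simp
    finally show ?thesis using False by simp
  next
    case True
    \<comment> \<open>All rows are orthogonal to \<open>v\<close>, hence their cross products are multiples of \<open>v\<close>.\<close>
    have "n \<bullet> (M i \<times> M j) = 0" for i j
    proof -
      have "(v \<bullet> v) * (n \<bullet> (M i \<times> M j)) =
        (n \<bullet> v) * (v \<bullet> (M i \<times> M j)) + (M i \<bullet> v) * (n \<bullet> (v \<times> M j)) + (M j \<bullet> v) * (n \<bullet> (M i \<times> v))"
        unfolding inner_vec_def sum_3 inner_real_def cross_components by algebra
      then show ?thesis using Mv True assms by simp
    qed
    then show ?thesis by (simp add: form inner_add_right)
  qed
qed

lemma cross_triple_expand:
  fixes y g :: "real^3"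
  shows "y \<times> (g \<times> y) = (y \<bullet> y) *\<^sub>R g - (g \<bullet> y) *\<^sub>R y"
  unfolding vec_eq_iff forall_3 inner_vec_def sum_3 inner_real_def
    vector_minus_component vector_scaleR_component cross_components real_scaleR_def
  by (intro conjI; algebra)

context canal_family
begin

text \<open>
  By \<open>normal_parallel_radius\<close> the gradient is a multiple of the radius vector at every point of
  the circle. Differentiating this relation along the circle (Rodrigues' formula) shows that the
  tangent of the circle is a principal direction, and the sphere of the family the curvature sphere.
\<close>

lemma focal_value:
  assumes p: "\<And>x. x \<in> sweep \<Longrightarrow> p x = 0"
    and G: "\<And>x. (p has_derivative (\<lambda>h. G x \<bullet> h)) (at x)"
    and polyG: "\<And>i. real_polynomial_function (\<lambda>x. G x $ i)"
    and H: "\<And>i x. ((\<lambda>x. G x $ i) has_derivative (\<lambda>h. H x $ i \<bullet> h)) (at x)"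
    and t: "poly w t \<noteq> 0" "poly R t \<noteq> 0" and curved: "T t \<times> T' t \<noteq> 0"
    and x: "x \<in> circle t"
  shows "\<exists>\<nu>. poly w t *\<^sub>R G x = \<nu> *\<^sub>R Y t x \<and> focal_form (H x) (G x) \<nu> = 0"
proof -
  define \<rho> where "\<rho> = (poly R t)\<^sup>2"
  have \<rho>: "\<rho> \<noteq> 0" using t by (simp add: \<rho>_def)
  have GY: "\<rho> *\<^sub>R G z = (G z \<bullet> Y t z) *\<^sub>R Y t z" if z: "z \<in> circle t" for z
  proof -
    have "(Y t z \<bullet> Y t z) *\<^sub>R G z = (G z \<bullet> Y t z) *\<^sub>R Y t z + Y t z \<times> (G z \<times> Y t z)"
      by (simp add: cross_triple_expand)
    then show ?thesis
      using z normal_parallel_radius[OF p G polyG t curved z] by (simp add: circle_def \<rho>_def)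
  qed
  define v where "v = T t \<times> Y t x"
  have v0: "v \<noteq> 0" using T_cross_Y[OF t x] by (simp add: v_def)
  have Yv: "Y t x \<bullet> v = 0" by (simp add: v_def dot_cross_self)
  have Gv: "G x \<bullet> v = 0"
    using arg_cong[OF GY[OF x], of "\<lambda>u. u \<bullet> v"] Yv \<rho> by simp
  define grad where "grad = (\<lambda>j. \<rho> *\<^sub>R H x $ j - (Y t x $ j *\<^sub>R ((\<Sum>k\<in>UNIV. Y t x $ k *\<^sub>R H x $ k) + poly w t *\<^sub>R G x)
     + ((G x \<bullet> Y t x) * poly w t) *\<^sub>R axis j 1))"
  define \<kappa>' where "\<kappa>' = (\<Sum>k\<in>UNIV. Y t x $ k * (H x $ k \<bullet> v))"
  have key: "\<rho> * (H x $ j \<bullet> v) - Y t x $ j * \<kappa>' - (G x \<bullet> Y t x) * poly w t * v $ j = 0" for j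
  proof -
    have dY: "((\<lambda>z. Y t z $ k) has_derivative (\<lambda>h. poly w t * h $ k)) (at x)" for k
      unfolding Y_def vector_minus_component vector_scaleR_component
      by (auto intro!: derivative_eq_intros bounded_linear_imp_has_derivative bounded_linear_vec_nth)
    have "grad j \<bullet> v = 0"
      unfolding v_def
    proof (rule gradient_along_circle[OF _ _ t(1) x])
      show "\<rho> * G z $ j - (G z \<bullet> Y t z) * Y t z $ j = 0" if "z \<in> circle t" for z
        using GY[OF that] by (simp add: vec_eq_iff)
      show "((\<lambda>z. \<rho> * G z $ j - (G z \<bullet> Y t z) * Y t z $ j) has_derivative (\<bullet>) (grad j)) (at x)"
        unfolding inner_vec_def[of "G _"] sum_3 inner_real_def
        by (auto intro!: derivative_eq_intros dY H ext
            simp: grad_def inner_diff_left inner_add_left inner_axis' sum_3 inner_vec_def[of "G _"] algebra_simps)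
    qed
    then show ?thesis
      by (simp add: grad_def \<kappa>'_def inner_diff_left inner_add_left inner_sum_left inner_axis' Gv algebra_simps)
  qed
  define \<nu> where "\<nu> = poly w t * (G x \<bullet> Y t x) / \<rho>"
  have "focal_form (H x) (Y t x) \<nu> = 0"
  proof (rule focal_form_zero[OF v0 Yv])
    fix i
    show "H x $ i \<bullet> v - \<nu> * v $ i = (\<kappa>' / \<rho>) * Y t x $ i"
      using key[of i] \<rho> by (simp add: \<nu>_def field_simps)
  qed
  moreover obtain s where s: "G x = s *\<^sub>R Y t x" "\<nu> = poly w t * s"
  proof (rule that[of "(G x \<bullet> Y t x) / \<rho>"])
    have "G x = (1 / \<rho>) *\<^sub>R (\<rho> *\<^sub>R G x)" using \<rho> by simp
    then show "G x = ((G x \<bullet> Y t x) / \<rho>) *\<^sub>R Y t x" unfolding GY[OF x] by simp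
  qed (simp add: \<nu>_def)
  ultimately have "focal_form (H x) (G x) \<nu> = 0" "poly w t *\<^sub>R G x = \<nu> *\<^sub>R Y t x"
    by (simp_all add: focal_form_scale)
  then show ?thesis by blast
qed

end

section \<open>Generic points and a polynomial of least degree\<close>

text \<open>
  Excluded are families of points, whose envelope is the spine itself, and straight spines.
\<close>

locale curved_canal_family = canal_family +
  assumes R_nonzero: "R \<noteq> 0"
    and curved: "\<exists>t. T t \<times> T' t \<noteq> 0"
begin

lemma cofinite_regular: "\<forall>\<^sub>F t in cofinite. poly w t \<noteq> 0 \<and> poly R t \<noteq> 0 \<and> T t \<times> T' t \<noteq> 0"
proof -
  obtain s i where s: "(T s \<times> T' s) $ i \<noteq> 0" using curved by (auto simp: vec_eq_iff)
  have "real_polynomial_function (\<lambda>t. (T t \<times> T' t) $ i)"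
    by (intro real_polynomial_function_cross3 polynomial_T)
      (simp add: T'_def real_polynomial_function_poly)
  then obtain q where q: "\<And>t. (T t \<times> T' t) $ i = poly q t"
    using real_polynomial_function_real_imp_poly by blast
  then have "q \<noteq> 0" using s by auto
  then have "finite ({t. poly w t = 0} \<union> {t. poly R t = 0} \<union> {t. poly q t = 0})"
    using w_nonzero R_nonzero by (simp add: poly_roots_finite)
  then show ?thesis
    unfolding eventually_cofinite by (rule finite_subset[rotated]) (auto simp flip: q)
qed

text \<open>
  For all but finitely many \<open>t\<close> the property holds at all but finitely many points of the circle.
  Polynomial functions satisfy a zero-one law for this notion, which expresses the irreducibility of
  the envelope.
\<close>

definition generically :: "(real \<Rightarrow> real^3 \<Rightarrow> bool) \<Rightarrow> bool" where
  "generically P \<longleftrightarrow> (\<forall>\<^sub>F t in cofinite. finite {x \<in> circle t. \<not> P t x})"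

lemma generically_conj:
  assumes "generically P" "generically Q"
  shows "generically (\<lambda>t x. P t x \<and> Q t x)"
  using assms unfolding generically_def
proof eventually_elim
  case (elim t)
  have "{x \<in> circle t. \<not> (P t x \<and> Q t x)} = {x \<in> circle t. \<not> P t x} \<union> {x \<in> circle t. \<not> Q t x}" by blast
  then show ?case using elim by simp
qed

lemma generically_mono:
  assumes "generically P"
    and "\<And>t x. poly w t \<noteq> 0 \<Longrightarrow> poly R t \<noteq> 0 \<Longrightarrow> T t \<times> T' t \<noteq> 0 \<Longrightarrow> x \<in> circle t \<Longrightarrow> P t x \<Longrightarrow> Q t x"
  shows "generically Q"
  using assms(1) cofinite_regular unfolding generically_def
proof eventually_elim
  case (elim t)
  then have "{x \<in> circle t. \<not> Q t x} \<subseteq> {x \<in> circle t. \<not> P t x}" using assms(2) by blast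
  with elim show ?case using finite_subset by blast
qed

lemma generically_parameter:
  assumes "\<forall>\<^sub>F t in cofinite. Q t"
  shows "generically (\<lambda>t x. Q t)"
  using assms unfolding generically_def by eventually_elim simp

lemma generically_witness:
  assumes "generically P"
  obtains t x where "poly w t \<noteq> 0" "poly R t \<noteq> 0" "x \<in> circle t" "P t x"
proof -
  have "\<forall>\<^sub>F t in cofinite. poly w t \<noteq> 0 \<and> poly R t \<noteq> 0 \<and> (\<exists>x\<in>circle t. P t x)"
    using assms cofinite_regular unfolding generically_def
  proof eventually_elim
    case (elim t)
    then have "infinite (circle t - {x \<in> circle t. \<not> P t x})"
      by (intro Diff_infinite_finite infinite_circle) auto
    then have "circle t - {x \<in> circle t. \<not> P t x} \<noteq> {}" by (metis finite.emptyI)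
    with elim show ?case by auto
  qed
  moreover have "(cofinite :: real filter) \<noteq> bot" by (simp add: infinite_UNIV_char_0)
  ultimately obtain t where "poly w t \<noteq> 0 \<and> poly R t \<noteq> 0 \<and> (\<exists>x\<in>circle t. P t x)"
    using eventually_happens' by blast
  then show ?thesis using that by blast
qed

lemma generically_nonzero:
  assumes "real_polynomial_function F" "x \<in> sweep" "F x \<noteq> 0"
  shows "generically (\<lambda>t x. F x \<noteq> 0)"
proof (rule ccontr)
  assume "\<not> generically (\<lambda>t x. F x \<noteq> 0)"
  then have "infinite {t. infinite {x \<in> circle t. F x = 0}}"
    by (simp add: generically_def eventually_cofinite)
  moreover have "finite {t. poly w t = 0}" using w_nonzero by (rule poly_roots_finite)
  ultimately have "infinite ({t. infinite {x \<in> circle t. F x = 0}} - {t. poly w t = 0})"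
    by (rule Diff_infinite_finite[rotated])
  then have "infinite {t. poly w t \<noteq> 0 \<and> infinite {x \<in> circle t. F x = 0}}"
    by (rule infinite_super[rotated]) blast
  from vanishing_on_infinitely_many_circles[OF assms(1) this assms(2)] assms(3) show False by simp
qed

lemma generically_zero_imp_vanishing:
  assumes "real_polynomial_function F" "generically (\<lambda>t x. F x = 0)" "x \<in> sweep"
  shows "F x = 0"
proof (rule ccontr)
  assume "F x \<noteq> 0"
  from generically_conj[OF generically_nonzero[OF assms(1,3) this] assms(2)]
  show False by (rule generically_witness) simp
qed

lemma sweep_nonempty: obtains x where "x \<in> sweep"
proof -
  have "generically (\<lambda>t x. True)" by (simp add: generically_def)
  then obtain t x where "poly w t \<noteq> 0" "x \<in> circle t" by (rule generically_witness)
  then show ?thesis using that by (auto simp: sweep_def)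
qed

text \<open>
  Dimension count with the monomials of degree at most \<open>e\<close> in each variable: there are \<open>(e + 1)\<^sup>3\<close> of
  them and about \<open>18 * K * e\<^sup>2\<close> linear conditions for vanishing on the circles.
\<close>

lemma nonzero_vanishing_polynomial:
  obtains p where "real_polynomial_function p" "\<And>x. x \<in> sweep \<Longrightarrow> p x = 0" "p \<noteq> (\<lambda>x. 0)"
proof -
  obtain s where "poly w s \<noteq> 0"
    using w_nonzero by (metis poly_all_0_iff_0)
  then obtain a where a: "a \<times> T s \<noteq> 0"
    using nonparallel_vector_exists[OF T_nonzero] by blast
  show ?thesis
  proof (rule reduced_frame[of a])
    fix E K
    assume E: "\<And>t. poly E t = a \<times> T t \<bullet> a \<times> T t"
      and K: "\<And>d (I :: (nat \<times> nat \<times> nat) set) f. finite I \<Longrightarrow> (\<And>m. m \<in> I \<Longrightarrow> polyfun_degree d (f m)) \<Longrightarrow>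
      2 * (d + 1) * (K * d + 1) < card I \<Longrightarrow>
      \<exists>c. (\<exists>m\<in>I. c m \<noteq> 0) \<and> (\<forall>t x. poly w t \<noteq> 0 \<longrightarrow> poly E t \<noteq> 0 \<longrightarrow> x \<in> circle t \<longrightarrow>
         (\<Sum>m\<in>I. c m * f m x) = 0)"
    define e where "e = 6 * (3 * K + 1)"
    define I where "I = Sigma {..e} (\<lambda>_. Sigma {..e} (\<lambda>_. {..e}))"
    define f :: "nat \<times> nat \<times> nat \<Rightarrow> real^3 \<Rightarrow> real"
      where "f = (\<lambda>(i, j, k) x. x $ 1 ^ i * x $ 2 ^ j * x $ 3 ^ k)"
    have f: "polyfun_degree (3 * e) (f m)" if "m \<in> I" for m
    proof -
      obtain i j k where m: "m = (i, j, k)" by (cases m) auto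
      have "polyfun_degree (i + j + k) (f m)"
        using polyfun_degree.mult[OF polyfun_degree.mult[OF polyfun_degree_power polyfun_degree_power]
            polyfun_degree_power]
        by (simp add: m f_def)
      moreover have "i + j + k \<le> 3 * e" using that m by (auto simp: I_def)
      ultimately show ?thesis by (rule polyfun_degree_mono)
    qed
    have "2 * (3 * e + 1) * (K * (3 * e) + 1) \<le> 2 * (3 * (e + 1)) * ((3 * K + 1) * (e + 1))"
      by (intro mult_mono) (auto simp: algebra_simps)
    also have "\<dots> = e * (e + 1) ^ 2" by (simp add: e_def power2_eq_square algebra_simps)
    also have "\<dots> < (e + 1) * (e + 1) ^ 2" by simp
    also have "\<dots> = card I" by (simp add: I_def power2_eq_square)
    finally have card: "2 * (3 * e + 1) * (K * (3 * e) + 1) < card I" .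
    have "finite I" by (simp add: I_def)
    from K[OF this f card] obtain c where c': "(\<exists>m\<in>I. c m \<noteq> 0) \<and> (\<forall>t x. poly w t \<noteq> 0 \<longrightarrow>
        poly E t \<noteq> 0 \<longrightarrow> x \<in> circle t \<longrightarrow> (\<Sum>m\<in>I. c m * f m x) = 0)" ..
    have c: "\<exists>m\<in>I. c m \<noteq> 0"
      "\<And>t x. poly w t \<noteq> 0 \<Longrightarrow> poly E t \<noteq> 0 \<Longrightarrow> x \<in> circle t \<Longrightarrow> (\<Sum>m\<in>I. c m * f m x) = 0"
      using c' by simp_all
    define p where "p = (\<lambda>x. \<Sum>m\<in>I. c m * f m x)"
    have pp: "real_polynomial_function p"
      unfolding p_def
      by (intro real_polynomial_function_sum polyfun_intros \<open>finite I\<close>)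
        (use f polyfun_degree_imp_polynomial in blast)
    show thesis
    proof (rule that[OF pp])
      have "E \<noteq> 0" using E[of s] a by auto
      then have "\<forall>\<^sub>F t in cofinite. poly E t \<noteq> 0"
        by (simp add: eventually_cofinite poly_roots_finite)
      then have "generically (\<lambda>t x. poly E t \<noteq> 0)" by (rule generically_parameter)
      then have "generically (\<lambda>t x. p x = 0)"
        by (rule generically_mono) (simp add: p_def c(2))
      then show "p x = 0" if "x \<in> sweep" for x
        using generically_zero_imp_vanishing[OF pp _ that] by blast
      show "p \<noteq> (\<lambda>x. 0)"
      proof
        assume p0: "p = (\<lambda>x. 0)"
        have "(\<Sum>i\<le>e. \<Sum>j\<le>e. \<Sum>k\<le>e. c (i, j, k) * (x$1 ^ i * x$2 ^ j * x$3 ^ k)) = p x" for x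
          by (simp add: p_def I_def f_def sum.Sigma case_prod_unfold)
        then have "c (i, j, k) = 0" if "i \<le> e" "j \<le> e" "k \<le> e" for i j k
          using monomials_independent[where n = e and a = "\<lambda>i j k. c (i, j, k)"] that p0 by simp
        then show False using c(1) by (auto simp: I_def)
      qed
    qed
  qed
qed

text \<open>
  For a polynomial of least degree, a partial derivative that is not zero has smaller degree and
  therefore cannot vanish on the envelope.
\<close>

lemma defining_polynomial:
  obtains p and G :: "real^3 \<Rightarrow> real^3" where "\<And>x. x \<in> sweep \<Longrightarrow> p x = 0"
    "real_polynomial_function p"
    "\<And>x. (p has_derivative (\<lambda>h. G x \<bullet> h)) (at x)"
    "\<And>i. real_polynomial_function (\<lambda>x. G x $ i)"
    "\<exists>i. \<exists>x\<in>sweep. G x $ i \<noteq> 0"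
proof -
  let ?V = "\<lambda>d p. polyfun_degree d p \<and> (\<forall>x\<in>sweep. p x = 0) \<and> p \<noteq> (\<lambda>x. 0)"
  have "\<exists>d p. ?V d p"
    using nonzero_vanishing_polynomial polynomial_imp_polyfun_degree by metis
  define d where "d = (LEAST d. \<exists>p. ?V d p)"
  have "\<exists>p. ?V d p" unfolding d_def using \<open>\<exists>d p. ?V d p\<close> by (rule LeastI_ex)
  then obtain p where p: "polyfun_degree d p" "\<And>x. x \<in> sweep \<Longrightarrow> p x = 0" "p \<noteq> (\<lambda>x. 0)" by blast
  have least: "d \<le> e" if "?V e q" for e q
    unfolding d_def using that by (intro Least_le) blast
  obtain G where G: "\<And>x. (p has_derivative (\<lambda>h. G x \<bullet> h)) (at x)"
     "\<And>i. d = 0 \<Longrightarrow> G x $ i = 0" "\<And>i. polyfun_degree (d - 1) (\<lambda>x. G x $ i)" for x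
    using polyfun_degree_gradient[OF p(1)] by metis
  show ?thesis
  proof (rule that[of p G])
    show "real_polynomial_function (\<lambda>x. G x $ i)" for i
      using G(3) polyfun_degree_imp_polynomial by blast
    show "\<exists>i. \<exists>x\<in>sweep. G x $ i \<noteq> 0"
    proof (rule ccontr)
      assume no: "\<not> (\<exists>i. \<exists>x\<in>sweep. G x $ i \<noteq> 0)"
      have "G x $ i = 0" for x i
      proof (rule ccontr)
        assume nz: "G x $ i \<noteq> 0"
        then have "d \<noteq> 0" using G(2) by blast
        moreover have "(\<lambda>x. G x $ i) \<noteq> (\<lambda>x. 0)" using nz by metis
        then have "d \<le> d - 1" using least[of "d - 1" "\<lambda>x. G x $ i"] G(3) no by blast
        ultimately show False by linarith
      qed
      then have "G x = 0" for x by (simp add: vec_eq_iff)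
      then have "(p has_derivative (\<lambda>h. 0)) (at x)" for x using G(1)[of x] by simp
      then obtain k where k: "\<And>x. p x = k"
        using has_derivative_zero_constant[of UNIV p] by auto
      obtain x where "x \<in> sweep" by (rule sweep_nonempty)
      then have "k = 0" using p(2) k by metis
      then show False using p(3) k by auto
    qed
  qed (use p G polyfun_degree_imp_polynomial in auto)
qed

end

section \<open>Elimination modulo the focal quadratic\<close>

text \<open>
  The analogue of \<open>homogenized_substitution\<close> for the substitution of a vector \<open>V / b\<close> into a polynomial
  function on space.
\<close>

lemma cleared_composition:
  fixes b :: "'a::real_normed_vector \<Rightarrow> real" and V :: "'a \<Rightarrow> real^3"
  assumes F: "polyfun_degree d F" and b: "real_polynomial_function b"
    and V: "\<And>i. real_polynomial_function (\<lambda>x. V x $ i)"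
  shows "\<exists>F'. real_polynomial_function F' \<and> (\<forall>x y. b x *\<^sub>R y = V x \<longrightarrow> F' x = b x ^ d * F y)"
  using F
proof induction
  case (const a)
  show ?case by (intro exI[of _ "\<lambda>_. a"]) (auto intro: real_polynomial_function.intros)
next
  case (coord i)
  show ?case by (intro exI[of _ "\<lambda>x. V x $ i"]) (auto simp: vec_eq_iff V)
next
  case (add d f g)
  then obtain f' g' where "real_polynomial_function f'" "real_polynomial_function g'"
    "\<forall>x y. b x *\<^sub>R y = V x \<longrightarrow> f' x = b x ^ d * f y" "\<forall>x y. b x *\<^sub>R y = V x \<longrightarrow> g' x = b x ^ d * g y" by blast
  then show ?case
    by (intro exI[of _ "\<lambda>x. f' x + g' x"]) (auto simp: distrib_left intro: real_polynomial_function.intros(3))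
next
  case (mult d f e g)
  then obtain f' g' where "real_polynomial_function f'" "real_polynomial_function g'"
    "\<forall>x y. b x *\<^sub>R y = V x \<longrightarrow> f' x = b x ^ d * f y" "\<forall>x y. b x *\<^sub>R y = V x \<longrightarrow> g' x = b x ^ e * g y" by blast
  then show ?case
    by (intro exI[of _ "\<lambda>x. f' x * g' x"]) (auto simp: power_add intro: real_polynomial_function.intros(4))
next
  case (weaken d f)
  then obtain f' where "real_polynomial_function f'"
    "\<forall>x y. b x *\<^sub>R y = V x \<longrightarrow> f' x = b x ^ d * f y" by blast
  then show ?case
    by (intro exI[of _ "\<lambda>x. b x * f' x"]) (auto intro: real_polynomial_function.intros(4) b)
qed

text \<open>
  Points \<open>y = x - G x / \<nu>\<close> on the normal at \<open>x\<close>, where \<open>\<nu>\<close> is a root of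
  \<open>g2 x * \<nu>\<^sup>2 + g1 x * \<nu> + g0 x\<close>. A polynomial in \<open>x\<close> and \<open>y\<close> is rational in \<open>\<nu>\<close>; after multiplication by
  powers of \<open>\<nu>\<close> and of the leading coefficient \<open>g2\<close> it becomes linear in \<open>\<nu>\<close>.
\<close>

locale quadratic_elimination =
  fixes G :: "real^3 \<Rightarrow> real^3" and g0 g1 g2 :: "real^3 \<Rightarrow> real"
  assumes polyG: "\<And>i. real_polynomial_function (\<lambda>x. G x $ i)"
    and polyg: "real_polynomial_function g0" "real_polynomial_function g1" "real_polynomial_function g2"
begin

definition focal :: "real^3 \<Rightarrow> real \<Rightarrow> real^3 \<Rightarrow> bool" where
  "focal x \<nu> y \<longleftrightarrow> \<nu> \<noteq> 0 \<and> G x = \<nu> *\<^sub>R (x - y) \<and> g2 x * \<nu>\<^sup>2 + g1 x * \<nu> + g0 x = 0"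

definition reduces :: "nat \<Rightarrow> nat \<Rightarrow> (real^3 \<Rightarrow> real^3 \<Rightarrow> real) \<Rightarrow> bool" where
  "reduces k N \<Theta> \<longleftrightarrow> (\<exists>a b. real_polynomial_function a \<and> real_polynomial_function b \<and>
     (\<forall>x \<nu> y. focal x \<nu> y \<longrightarrow> g2 x ^ k * \<nu> ^ N * \<Theta> x y = a x * \<nu> + b x))"

lemma focalD: "focal x \<nu> y \<Longrightarrow> g2 x * \<nu>\<^sup>2 = - (g1 x * \<nu>) - g0 x"
  by (simp add: focal_def)

text \<open>
  Raising the exponent of \<open>\<nu>\<close> costs a factor \<open>g2\<close>, because it produces \<open>\<nu>\<^sup>2\<close>, which has to be eliminated.
\<close>

lemma reduces_raise:
  assumes "reduces k N \<Theta>"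
  shows "reduces (Suc k) N \<Theta>" "reduces (Suc k) (Suc N) \<Theta>"
proof -
  obtain a b where ab: "real_polynomial_function a" "real_polynomial_function b"
    "\<And>x \<nu> y. focal x \<nu> y \<Longrightarrow> g2 x ^ k * \<nu> ^ N * \<Theta> x y = a x * \<nu> + b x"
    using assms unfolding reduces_def by blast
  show "reduces (Suc k) N \<Theta>"
    unfolding reduces_def
  proof (intro exI conjI allI impI)
    show "real_polynomial_function (\<lambda>x. g2 x * a x)" "real_polynomial_function (\<lambda>x. g2 x * b x)"
      using ab polyg by (auto intro: real_polynomial_function.intros(4))
    fix x \<nu> y assume "focal x \<nu> y"
    then have "g2 x * (g2 x ^ k * \<nu> ^ N * \<Theta> x y) = g2 x * (a x * \<nu> + b x)" using ab(3) by simp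
    then show "g2 x ^ Suc k * \<nu> ^ N * \<Theta> x y = g2 x * a x * \<nu> + g2 x * b x"
      by (simp add: algebra_simps)
  qed
  show "reduces (Suc k) (Suc N) \<Theta>"
    unfolding reduces_def
  proof (intro exI conjI allI impI)
    show "real_polynomial_function (\<lambda>x. g2 x * b x - a x * g1 x)" "real_polynomial_function (\<lambda>x. - (a x * g0 x))"
      by (intro polyfun_intros ab polyg)+
    fix x \<nu> y assume f: "focal x \<nu> y"
    have "g2 x ^ Suc k * \<nu> ^ Suc N * \<Theta> x y = g2 x * \<nu> * (g2 x ^ k * \<nu> ^ N * \<Theta> x y)" by simp
    also have "\<dots> = a x * (g2 x * \<nu>\<^sup>2) + g2 x * b x * \<nu>"
      unfolding ab(3)[OF f] by (simp add: algebra_simps power2_eq_square)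
    also have "\<dots> = (g2 x * b x - a x * g1 x) * \<nu> + - (a x * g0 x)"
      unfolding focalD[OF f] by (simp add: algebra_simps)
    finally show "g2 x ^ Suc k * \<nu> ^ Suc N * \<Theta> x y = (g2 x * b x - a x * g1 x) * \<nu> + - (a x * g0 x)" .
  qed
qed

lemma reduces_raise_many:
  assumes "reduces k N \<Theta>"
  shows "reduces (k + i + j) (N + j) \<Theta>"
proof -
  have "reduces (k + i) N \<Theta>" by (induction i) (use assms reduces_raise in auto)
  then show ?thesis by (induction j) (use reduces_raise in auto)
qed

definition reducible :: "(real^3 \<Rightarrow> real^3 \<Rightarrow> real) \<Rightarrow> bool" where
  "reducible \<Theta> \<longleftrightarrow> (\<exists>k N. reduces k N \<Theta>)"

lemma reducible_add:
  assumes "reducible \<Theta>" "reducible \<Theta>'"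
  shows "reducible (\<lambda>x y. \<Theta> x y + \<Theta>' x y)"
proof -
  obtain k N k' N' where "reduces k N \<Theta>" "reduces k' N' \<Theta>'" using assms unfolding reducible_def by blast
  from this(1)[THEN reduces_raise_many, of "k' + N" N'] this(2)[THEN reduces_raise_many, of "k + N'" N]
  have "reduces (k + k' + N + N') (N + N') \<Theta>" "reduces (k + k' + N + N') (N + N') \<Theta>'"
    by (simp_all add: ac_simps)
  then obtain a b a' b' where ab: "real_polynomial_function a" "real_polynomial_function b"
    "real_polynomial_function a'" "real_polynomial_function b'"
    "\<And>x \<nu> y. focal x \<nu> y \<Longrightarrow> g2 x ^ (k + k' + N + N') * \<nu> ^ (N + N') * \<Theta> x y = a x * \<nu> + b x"
    "\<And>x \<nu> y. focal x \<nu> y \<Longrightarrow> g2 x ^ (k + k' + N + N') * \<nu> ^ (N + N') * \<Theta>' x y = a' x * \<nu> + b' x"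
    unfolding reduces_def by blast
  have "reduces (k + k' + N + N') (N + N') (\<lambda>x y. \<Theta> x y + \<Theta>' x y)"
    unfolding reduces_def
  proof (intro exI conjI allI impI)
    show "real_polynomial_function (\<lambda>x. a x + a' x)" "real_polynomial_function (\<lambda>x. b x + b' x)"
      by (intro polyfun_intros ab)+
    fix x \<nu> y assume f: "focal x \<nu> y"
    have "g2 x ^ (k + k' + N + N') * \<nu> ^ (N + N') * (\<Theta> x y + \<Theta>' x y) = (a x * \<nu> + b x) + (a' x * \<nu> + b' x)"
      by (simp only: distrib_left ab(5,6)[OF f])
    also have "\<dots> = (a x + a' x) * \<nu> + (b x + b' x)" by (simp add: algebra_simps)
    finally show "g2 x ^ (k + k' + N + N') * \<nu> ^ (N + N') * (\<Theta> x y + \<Theta>' x y) = (a x + a' x) * \<nu> + (b x + b' x)" .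
  qed
  then show ?thesis unfolding reducible_def by blast
qed

lemma reducible_mult:
  assumes "reducible \<Theta>" "reducible \<Theta>'"
  shows "reducible (\<lambda>x y. \<Theta> x y * \<Theta>' x y)"
proof -
  obtain k N k' N' where "reduces k N \<Theta>" "reduces k' N' \<Theta>'" using assms unfolding reducible_def by blast
  then obtain a b a' b' where ab: "real_polynomial_function a" "real_polynomial_function b"
    "real_polynomial_function a'" "real_polynomial_function b'"
    "\<And>x \<nu> y. focal x \<nu> y \<Longrightarrow> g2 x ^ k * \<nu> ^ N * \<Theta> x y = a x * \<nu> + b x"
    "\<And>x \<nu> y. focal x \<nu> y \<Longrightarrow> g2 x ^ k' * \<nu> ^ N' * \<Theta>' x y = a' x * \<nu> + b' x"
    unfolding reduces_def by blast
  have "reduces (Suc (k + k')) (N + N') (\<lambda>x y. \<Theta> x y * \<Theta>' x y)"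
    unfolding reduces_def
  proof (intro exI conjI allI impI)
    show "real_polynomial_function (\<lambda>x. g2 x * (a x * b' x + b x * a' x) - a x * a' x * g1 x)"
      "real_polynomial_function (\<lambda>x. g2 x * (b x * b' x) - a x * a' x * g0 x)"
      by (intro polyfun_intros ab polyg)+
    fix x \<nu> y assume f: "focal x \<nu> y"
    have "g2 x ^ Suc (k + k') * \<nu> ^ (N + N') * (\<Theta> x y * \<Theta>' x y) =
      g2 x * ((g2 x ^ k * \<nu> ^ N * \<Theta> x y) * (g2 x ^ k' * \<nu> ^ N' * \<Theta>' x y))"
      by (simp add: power_add)
    also have "\<dots> = a x * a' x * (g2 x * \<nu>\<^sup>2) + g2 x * (a x * b' x + b x * a' x) * \<nu> + g2 x * (b x * b' x)"
      unfolding ab(5,6)[OF f] by (simp add: algebra_simps power2_eq_square)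
    also have "\<dots> = (g2 x * (a x * b' x + b x * a' x) - a x * a' x * g1 x) * \<nu> +
      (g2 x * (b x * b' x) - a x * a' x * g0 x)"
      unfolding focalD[OF f] by (simp add: algebra_simps)
    finally show "g2 x ^ Suc (k + k') * \<nu> ^ (N + N') * (\<Theta> x y * \<Theta>' x y) =
      (g2 x * (a x * b' x + b x * a' x) - a x * a' x * g1 x) * \<nu> + (g2 x * (b x * b' x) - a x * a' x * g0 x)" .
  qed
  then show ?thesis unfolding reducible_def by blast
qed

lemma reducible_point:
  assumes "real_polynomial_function f"
  shows "reducible (\<lambda>x y. f x)"
proof -
  have "reduces 0 0 (\<lambda>x y. f x)" unfolding reduces_def
    by (intro exI[of _ "\<lambda>x. 0"] exI[of _ f]) (auto intro: assms real_polynomial_function.intros)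
  then show ?thesis unfolding reducible_def by blast
qed

lemma reducible_coordinate: "reducible (\<lambda>x y. y $ i)"
proof -
  have "reduces 0 1 (\<lambda>x y. y $ i)" unfolding reduces_def
  proof (intro exI conjI allI impI)
    show "real_polynomial_function (\<lambda>x. x $ i)" "real_polynomial_function (\<lambda>x. - G x $ i)"
      by (intro polyfun_intros polyG)+
    show "g2 x ^ 0 * \<nu> ^ 1 * y $ i = x $ i * \<nu> + - G x $ i" if "focal x \<nu> y" for x \<nu> y
    proof -
      have "G x = \<nu> *\<^sub>R (x - y)" using that by (simp add: focal_def)
      then show ?thesis by (simp add: right_diff_distrib)
    qed
  qed
  then show ?thesis unfolding reducible_def by blast
qed

lemma reducible_center:
  assumes "real_polynomial_function F"
  shows "reducible (\<lambda>x y. F y)"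
proof -
  obtain d where "polyfun_degree d F" using polynomial_imp_polyfun_degree[OF assms] by blast
  then show ?thesis
  proof induction
    case (const a)
    then show ?case by (intro reducible_point real_polynomial_function.intros)
  qed (auto intro: reducible_coordinate reducible_add reducible_mult)
qed

end

context canal_family
begin

section \<open>The spine curve\<close>

definition center :: "real \<Rightarrow> real^3" where "center t = (1 / poly w t) *\<^sub>R poly_vec C t"

lemma Y_eq: "poly w t \<noteq> 0 \<Longrightarrow> Y t x = poly w t *\<^sub>R (x - center t)"
  by (simp add: Y_def center_def scaleR_diff_right)

lemma circle_distance:
  assumes "poly w t \<noteq> 0" "x \<in> circle t"
  shows "(x - center t) \<bullet> (x - center t) = (poly R t / poly w t)\<^sup>2"
proof -
  have "(poly w t)\<^sup>2 * ((x - center t) \<bullet> (x - center t)) = (poly R t)\<^sup>2"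
    using assms by (simp add: circle_def Y_eq power2_eq_square)
  then show ?thesis using assms by (simp add: power_divide field_simps)
qed

lemma cofinite_w: "\<forall>\<^sub>F t in cofinite. poly w t \<noteq> 0"
  using poly_roots_finite[OF w_nonzero] by (simp add: eventually_cofinite)

lemma polynomial_along_center:
  assumes "real_polynomial_function F"
  obtains q d where "\<And>t. poly w t \<noteq> 0 \<Longrightarrow> poly q t = poly w t ^ d * F (center t)"
proof -
  obtain d where d: "polyfun_degree d F" using polynomial_imp_polyfun_degree[OF assms] by blast
  have "\<exists>F'. real_polynomial_function F' \<and> (\<forall>t y. poly w t *\<^sub>R y = poly_vec C t \<longrightarrow> F' t = poly w t ^ d * F y)"
    by (rule cleared_composition[OF d]) (simp_all add: real_polynomial_function_poly)
  then obtain F' where F': "real_polynomial_function F'"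
    "\<And>t y. poly w t *\<^sub>R y = poly_vec C t \<Longrightarrow> F' t = poly w t ^ d * F y" by blast
  obtain q where "\<And>t. F' t = poly q t" using real_polynomial_function_real_imp_poly[OF F'(1)] by blast
  then show ?thesis using that F'(2)[of _ "center _"] by (metis Y_def Y_eq diff_self right_minus_eq scale_zero_right)
qed

text \<open>
  A rational identity along the spine that may involve the parameter: clear denominators and count
  zeros. The polynomial \<open>u\<close> is the parameter itself in the main application.
\<close>

lemma center_identity:
  assumes F: "real_polynomial_function F" "real_polynomial_function F'"
    and inf: "infinite {t. poly w t \<noteq> 0 \<and> F (center t) = poly u t * F' (center t)}" and t: "poly w t \<noteq> 0"
  shows "F (center t) = poly u t * F' (center t)"
proof -
  obtain q d where q: "\<And>t. poly w t \<noteq> 0 \<Longrightarrow> poly q t = poly w t ^ d * F (center t)"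
    using polynomial_along_center[OF F(1)] by blast
  obtain q' d' where q': "\<And>t. poly w t \<noteq> 0 \<Longrightarrow> poly q' t = poly w t ^ d' * F' (center t)"
    using polynomial_along_center[OF F(2)] by blast
  have *: "poly (w ^ d' * q - w ^ d * u * q') t = poly w t ^ (d + d') * (F (center t) - poly u t * F' (center t))"
    if "poly w t \<noteq> 0" for t using that by (simp add: q q' power_add algebra_simps)
  have "{t. poly w t \<noteq> 0 \<and> F (center t) = poly u t * F' (center t)} \<subseteq> {t. poly (w ^ d' * q - w ^ d * u * q') t = 0}"
  proof safe
    fix t assume h: "poly w t \<noteq> 0" "F (center t) = poly u t * F' (center t)"
    show "poly (w ^ d' * q - w ^ d * u * q') t = 0" unfolding *[OF h(1)] using h(2) by simp
  qed
  then have "infinite {t. poly (w ^ d' * q - w ^ d * u * q') t = 0}" using inf infinite_super by blast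
  then have "w ^ d' * q - w ^ d * u * q' = 0" using poly_roots_finite by blast
  then show ?thesis using *[OF t] t by simp
qed

lemma center_zero:
  assumes "real_polynomial_function F" "infinite {t. poly w t \<noteq> 0 \<and> F (center t) = 0}" "poly w t \<noteq> 0"
  shows "F (center t) = 0"
  using center_identity[of F "\<lambda>_. 0" 0 t] assms real_polynomial_function.intros(2) by auto

text \<open>
  The cone of normals along the circle at \<open>t\<close> has the equation \<open>(z \<bullet> T)\<^sup>2 = U\<^sup>2 * (z \<bullet> z)\<close> with
  \<open>z = y - c t\<close>. For \<open>y = c s\<close> divide by \<open>(s - t)\<^sup>2\<close> and let \<open>s\<close> tend to \<open>t\<close>: then \<open>z\<close> becomes the tangent
  and the equation becomes \<open>T \<bullet> T = U\<^sup>2\<close>. The division is carried out on polynomials.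
\<close>

lemma spine_not_in_cone:
  assumes t: "poly w t \<noteq> 0"
    and cone: "\<And>s. poly w s \<noteq> 0 \<Longrightarrow> ((center s - center t) \<bullet> T t)\<^sup>2 =
      (poly U t)\<^sup>2 * ((center s - center t) \<bullet> (center s - center t))"
  shows False
proof -
  define Z where "Z = (\<lambda>i. smult (poly w t) (C $ i) - smult (poly (C $ i) t) w)"
  have "poly (Z i) t = 0" for i by (simp add: Z_def mult.commute)
  then have "\<exists>V. Z i = [:- t, 1:] * V" for i by (simp add: poly_eq_0_iff_dvd dvd_def)
  then obtain V where V: "\<And>i. Z i = [:- t, 1:] * V i" by metis
  have Vt: "poly (V i) t = T t $ i" for i
  proof -
    have "poly (pderiv (Z i)) t = poly (V i) t"
      unfolding V pderiv_mult by (simp add: pderiv_pCons)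
    then show ?thesis
      by (simp add: Z_def pderiv_diff pderiv_smult T_eq mult.commute)
  qed
  define q where "q = (\<Sum>i\<in>UNIV. smult (T t $ i) (V i))\<^sup>2 - smult ((poly U t)\<^sup>2) (\<Sum>i\<in>UNIV. (V i)\<^sup>2)"
  have "poly q s = 0" if s: "poly w s \<noteq> 0" "s \<noteq> t" for s
  proof -
    define \<mu> where "\<mu> = (s - t) / (poly w s * poly w t)"
    have \<mu>: "\<mu> \<noteq> 0" using s t by (simp add: \<mu>_def)
    have "(center s - center t) $ i = \<mu> * poly (V i) s" for i
    proof -
      have "poly (Z i) s = (s - t) * poly (V i) s" unfolding V by (simp add: algebra_simps)
      then show ?thesis using s t by (simp add: center_def \<mu>_def Z_def field_simps)
    qed
    then have "center s - center t = \<mu> *\<^sub>R (\<chi> i. poly (V i) s)" by (simp add: vec_eq_iff)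
    with cone[OF s(1)] have "\<mu>\<^sup>2 * (((\<chi> i. poly (V i) s) \<bullet> T t)\<^sup>2) =
        \<mu>\<^sup>2 * ((poly U t)\<^sup>2 * ((\<chi> i. poly (V i) s) \<bullet> (\<chi> i. poly (V i) s)))"
      by (simp add: power_mult_distrib power2_eq_square mult_ac)
    then have "((\<chi> i. poly (V i) s) \<bullet> T t)\<^sup>2 = (poly U t)\<^sup>2 * ((\<chi> i. poly (V i) s) \<bullet> (\<chi> i. poly (V i) s))"
      using \<mu> by simp
    then show ?thesis
      by (simp add: q_def inner_vec_def poly_sum power2_eq_square mult.commute)
  qed
  then have "UNIV - ({s. poly w s = 0} \<union> {t}) \<subseteq> {s. poly q s = 0}" by auto
  moreover have "infinite (UNIV - ({s. poly w s = 0} \<union> {t}))"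
    using poly_roots_finite[OF w_nonzero] by (intro Diff_infinite_finite) (auto simp: infinite_UNIV_char_0)
  ultimately have "infinite {s. poly q s = 0}" using infinite_super by blast
  then have "q = 0" using poly_roots_finite by blast
  then have "poly q t = 0" by simp
  then have "(T t \<bullet> T t)\<^sup>2 = (poly U t)\<^sup>2 * (T t \<bullet> T t)"
    by (simp add: q_def inner_vec_def poly_sum Vt power2_eq_square)
  then have "T t \<bullet> T t = (poly U t)\<^sup>2"
    using T_nonzero[OF t] by (simp add: power2_eq_square)
  then show False using U_less[OF t] by simp
qed

end

section \<open>Two sphere families with the same envelope\<close>

lemma real_polynomial_focal_form:
  fixes G :: "real^3 \<Rightarrow> real^3" and H :: "real^3 \<Rightarrow> real^3^3"
  assumes polyG: "\<And>i. real_polynomial_function (\<lambda>x. G x $ i)"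
    and polyH: "\<And>i j. real_polynomial_function (\<lambda>x. H x $ i $ j)"
  shows "real_polynomial_function (\<lambda>x. focal_form (H x) (G x) k)"
proof -
  have M: "real_polynomial_function (\<lambda>x. (H x $ i - k *\<^sub>R axis i 1) $ j)" for i j
    by (simp only: vector_minus_component vector_scaleR_component) (intro polyfun_intros polyH)
  have MM: "real_polynomial_function (\<lambda>x. ((H x $ i - k *\<^sub>R axis i 1) \<times> (H x $ j - k *\<^sub>R axis j 1)) $ l)" for i j l
    by (intro real_polynomial_function_cross3 M)
  show ?thesis
    unfolding focal_form_def Let_def
  proof (rule real_polynomial_function_inner[OF polyG])
    fix l
    show "real_polynomial_function (\<lambda>x. (G x $ 1 *\<^sub>R ((H x $ 2 - k *\<^sub>R axis 2 1) \<times> (H x $ 3 - k *\<^sub>R axis 3 1)) +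
      G x $ 2 *\<^sub>R ((H x $ 3 - k *\<^sub>R axis 3 1) \<times> (H x $ 1 - k *\<^sub>R axis 1 1)) +
      G x $ 3 *\<^sub>R ((H x $ 1 - k *\<^sub>R axis 1 1) \<times> (H x $ 2 - k *\<^sub>R axis 2 1))) $ l)"
      unfolding vector_add_component vector_scaleR_component real_scaleR_def
      by (intro real_polynomial_function.intros(3,4) polyG MM)
  qed
qed

lemma cofinite_imp_infinite:
  assumes "\<forall>\<^sub>F t :: real in cofinite. Q t"
  shows "infinite {t. Q t}"
proof
  assume "finite {t. Q t}"
  then have "finite ({t. Q t} \<union> {t. \<not> Q t})" using assms by (simp add: eventually_cofinite)
  moreover have "{t. Q t} \<union> {t. \<not> Q t} = UNIV" by blast
  ultimately show False by (simp add: infinite_UNIV_char_0)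
qed

lemma (in curved_canal_family) generically_focal_value:
  assumes p: "\<And>x. x \<in> sweep \<Longrightarrow> p x = 0"
    and G: "\<And>x. (p has_derivative (\<lambda>h. G x \<bullet> h)) (at x)"
    and polyG: "\<And>i. real_polynomial_function (\<lambda>x. G x $ i)"
    and H: "\<And>i x. ((\<lambda>x. G x $ i) has_derivative (\<lambda>h. H x $ i \<bullet> h)) (at x)"
    and i: "x0 \<in> sweep" "G x0 $ i \<noteq> 0"
  shows "generically (\<lambda>t x. \<exists>\<nu>. \<nu> \<noteq> 0 \<and> G x = \<nu> *\<^sub>R (x - center t) \<and> focal_form (H x) (G x) \<nu> = 0)"
proof (rule generically_mono[OF generically_nonzero[OF polyG i]])
  fix t x
  assume t: "poly w t \<noteq> 0" "poly R t \<noteq> 0" "T t \<times> T' t \<noteq> 0" "x \<in> circle t" and nz: "G x $ i \<noteq> 0"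
  from focal_value[OF p G polyG H t] obtain \<nu> where
    \<nu>: "poly w t *\<^sub>R G x = \<nu> *\<^sub>R Y t x" "focal_form (H x) (G x) \<nu> = 0" by blast
  from \<nu>(1) have "poly w t *\<^sub>R G x = poly w t *\<^sub>R (\<nu> *\<^sub>R (x - center t))"
    using t(1) by (simp add: Y_eq mult.commute)
  then have "G x = \<nu> *\<^sub>R (x - center t)" using t(1) by (simp only: scaleR_cancel_left) simp
  moreover have "\<nu> \<noteq> 0" using nz calculation by auto
  ultimately show "\<exists>\<nu>. \<nu> \<noteq> 0 \<and> G x = \<nu> *\<^sub>R (x - center t) \<and> focal_form (H x) (G x) \<nu> = 0"
    using \<nu>(2) by blast
qed

text \<open>
  Two families with the same vanishing ideal of the envelope and of the spine. The
  quotient \<open>P / D\<close> recovers the parameter of the second family; along the first one it is the change of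
  parameter.
\<close>

locale canal_pair = A: curved_canal_family w C R + B: curved_canal_family w2 C2 R2
  for w C R w2 C2 R2 +
  fixes P D :: "real^3 \<Rightarrow> real"
  assumes same_ideal: "real_polynomial_function F \<Longrightarrow> (\<forall>x\<in>A.sweep. F x = 0) \<longleftrightarrow> (\<forall>x\<in>B.sweep. F x = 0)"
    and polyP: "real_polynomial_function P" and polyD: "real_polynomial_function D"
    and proper: "\<forall>\<^sub>F s in cofinite. D (B.center s) \<noteq> 0 \<and> P (B.center s) = s * D (B.center s)"
    and same_spine: "real_polynomial_function F \<Longrightarrow>
      (\<forall>t. poly w t \<noteq> 0 \<longrightarrow> F (A.center t) = 0) \<longleftrightarrow> (\<forall>s. poly w2 s \<noteq> 0 \<longrightarrow> F (B.center s) = 0)"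
begin

lemma transfer_nonzero:
  assumes "real_polynomial_function F" "B.generically (\<lambda>s x. F x \<noteq> 0)"
  shows "A.generically (\<lambda>t x. F x \<noteq> 0)"
proof -
  obtain s x where "poly w2 s \<noteq> 0" "x \<in> B.circle s" "F x \<noteq> 0"
    using assms(2) by (rule B.generically_witness)
  then have "\<not> (\<forall>x\<in>B.sweep. F x = 0)" by (auto simp: B.sweep_def)
  then obtain y where "y \<in> A.sweep" "F y \<noteq> 0" using same_ideal[OF assms(1)] by blast
  then show ?thesis using A.generically_nonzero[OF assms(1)] by blast
qed

lemma transfer_zero:
  assumes "real_polynomial_function F" "B.generically (\<lambda>s x. F x = 0)"
  shows "x \<in> A.sweep \<Longrightarrow> F x = 0"
  using B.generically_zero_imp_vanishing[OF assms] same_ideal[OF assms(1)] by blast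

lemma inverse_on_spine:
  assumes "poly w2 s \<noteq> 0"
  shows "P (B.center s) = s * D (B.center s)"
proof -
  have "\<forall>\<^sub>F s in cofinite. poly w2 s \<noteq> 0 \<and> P (B.center s) = poly [:0, 1:] s * D (B.center s)"
    using proper B.cofinite_w by eventually_elim simp
  then have "infinite {s. poly w2 s \<noteq> 0 \<and> P (B.center s) = poly [:0, 1:] s * D (B.center s)}"
    by (rule cofinite_imp_infinite)
  from B.center_identity[OF polyP polyD this assms] show ?thesis by simp
qed

text \<open>
  Both families use the same polynomial, so that \<open>G\<close>, the Hessian \<open>H\<close> and the quadratic equation for \<open>\<nu>\<close>
  are the same. Each family selects one root of it.
\<close>

lemma common_normal:
  obtains G :: "real^3 \<Rightarrow> real^3" and H :: "real^3 \<Rightarrow> real^3^3" where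
    "\<And>i. real_polynomial_function (\<lambda>x. G x $ i)"
    "\<And>i j. real_polynomial_function (\<lambda>x. H x $ i $ j)"
    "A.generically (\<lambda>t x. \<exists>\<nu>. \<nu> \<noteq> 0 \<and> G x = \<nu> *\<^sub>R (x - A.center t) \<and> focal_form (H x) (G x) \<nu> = 0)"
    "B.generically (\<lambda>s x. \<exists>\<nu>. \<nu> \<noteq> 0 \<and> G x = \<nu> *\<^sub>R (x - B.center s) \<and> focal_form (H x) (G x) \<nu> = 0)"
proof -
  obtain p and G :: "real^3 \<Rightarrow> real^3" where p: "\<And>x. x \<in> A.sweep \<Longrightarrow> p x = 0"
    and G: "\<And>x. (p has_derivative (\<lambda>h. G x \<bullet> h)) (at x)"
    and polyp: "real_polynomial_function p"
    and polyG: "\<And>i. real_polynomial_function (\<lambda>x. G x $ i)"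
    and ex: "\<exists>i. \<exists>x\<in>A.sweep. G x $ i \<noteq> 0"
    by (rule A.defining_polynomial) blast
  have "\<exists>Hi :: real^3 \<Rightarrow> real^3. (\<forall>x. ((\<lambda>x. G x $ i) has_derivative (\<lambda>h. Hi x \<bullet> h)) (at x)) \<and>
      (\<forall>j. real_polynomial_function (\<lambda>x. Hi x $ j))" for i
    by (rule polynomial_gradient[OF polyG[of i]]) blast
  then obtain H' :: "3 \<Rightarrow> real^3 \<Rightarrow> real^3" where H': "\<And>i x. ((\<lambda>x. G x $ i) has_derivative (\<lambda>h. H' i x \<bullet> h)) (at x)"
    "\<And>i j. real_polynomial_function (\<lambda>x. H' i x $ j)"
    by metis
  define H where "H = (\<lambda>x. (\<chi> i. H' i x) :: real^3^3)"
  have H: "((\<lambda>x. G x $ i) has_derivative (\<lambda>h. H x $ i \<bullet> h)) (at x)" for i x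
    using H'(1) by (simp add: H_def)
  obtain i x where i: "x \<in> A.sweep" "G x $ i \<noteq> 0" using ex by blast
  then obtain x' where i': "x' \<in> B.sweep" "G x' $ i \<noteq> 0" using same_ideal[OF polyG[of i]] by blast
  have pB: "p x = 0" if "x \<in> B.sweep" for x using same_ideal[OF polyp] p that by blast
  show thesis
  proof (rule that[of G H])
    show "real_polynomial_function (\<lambda>x. H x $ i $ j)" for i j using H'(2) by (simp add: H_def)
    show "A.generically (\<lambda>t x. \<exists>\<nu>. \<nu> \<noteq> 0 \<and> G x = \<nu> *\<^sub>R (x - A.center t) \<and> focal_form (H x) (G x) \<nu> = 0)"
      by (rule A.generically_focal_value[OF p G polyG H i])
    show "B.generically (\<lambda>s x. \<exists>\<nu>. \<nu> \<noteq> 0 \<and> G x = \<nu> *\<^sub>R (x - B.center s) \<and> focal_form (H x) (G x) \<nu> = 0)"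
      by (rule B.generically_focal_value[OF pB G polyG H i'])
  qed (use polyG in blast)
qed

text \<open>
  The relation \<open>Wh y * \<parallel>x - y\<parallel>\<^sup>2 = Rh y\<close> separates the two families: it holds for the centres \<open>y\<close> of the
  second family and fails for those of the first one. Reduced modulo the quadratic equation for
  \<open>\<nu>\<close>, it becomes \<open>a x * \<nu> + b x = 0\<close>, which determines the root \<open>\<nu>\<close> of the second family rationally, and
  with it the centre and its parameter \<open>P' / D'\<close>.
\<close>

lemma rational_parameter:
  assumes polyW: "real_polynomial_function Wh" and polyR: "real_polynomial_function Rh"
    and zeroB: "\<And>s x. poly w2 s \<noteq> 0 \<Longrightarrow> x \<in> B.circle s \<Longrightarrow>
      Wh (B.center s) * ((x - B.center s) \<bullet> (x - B.center s)) = Rh (B.center s)"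
    and nonzeroA: "\<forall>\<^sub>F t in cofinite. \<forall>x\<in>A.circle t.
      Wh (A.center t) * ((x - A.center t) \<bullet> (x - A.center t)) \<noteq> Rh (A.center t)"
  obtains P' D' G where "real_polynomial_function P'" "real_polynomial_function D'"
    "\<And>i. real_polynomial_function (\<lambda>x. G x $ i)"
    "B.generically (\<lambda>s x. D' x \<noteq> 0 \<and> P' x = s * D' x)"
    "A.generically (\<lambda>t x. \<exists>\<nu>. \<nu> \<noteq> 0 \<and> G x = \<nu> *\<^sub>R (x - A.center t))"
    "B.generically (\<lambda>s x. \<exists>\<nu>. \<nu> \<noteq> 0 \<and> G x = \<nu> *\<^sub>R (x - B.center s))"
proof -
  obtain G :: "real^3 \<Rightarrow> real^3" and H :: "real^3 \<Rightarrow> real^3^3" where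
    polyG: "\<And>i. real_polynomial_function (\<lambda>x. G x $ i)" and
    polyH: "\<And>i j. real_polynomial_function (\<lambda>x. H x $ i $ j)" and
    focA: "A.generically (\<lambda>t x. \<exists>\<nu>. \<nu> \<noteq> 0 \<and> G x = \<nu> *\<^sub>R (x - A.center t) \<and> focal_form (H x) (G x) \<nu> = 0)" and
    focB: "B.generically (\<lambda>s x. \<exists>\<nu>. \<nu> \<noteq> 0 \<and> G x = \<nu> *\<^sub>R (x - B.center s) \<and> focal_form (H x) (G x) \<nu> = 0)"
    by (rule common_normal) blast
  define g0 where "g0 = (\<lambda>x. focal_form (H x) (G x) 0)"
  define g1 where "g1 = (\<lambda>x. focal_linear (H x) (G x))"
  define g2 where "g2 = (\<lambda>x. G x \<bullet> G x)"
  have polyff: "real_polynomial_function (\<lambda>x. focal_form (H x) (G x) k)" for k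
    using real_polynomial_focal_form polyG polyH by blast
  have polyg2: "real_polynomial_function g2"
    unfolding g2_def by (intro real_polynomial_function_inner polyG)
  have polyg1: "real_polynomial_function g1"
    unfolding g1_def focal_linear_def by (intro polyfun_intros polyff polyg2[unfolded g2_def])
  interpret quadratic_elimination G g0 g1 g2
    by unfold_locales (use polyG polyff polyg1 polyg2 in \<open>auto simp: g0_def\<close>)
  have focal_iff: "focal x \<nu> y" if "\<nu> \<noteq> 0" "G x = \<nu> *\<^sub>R (x - y)" "focal_form (H x) (G x) \<nu> = 0" for x \<nu> y
  proof (unfold focal_def, intro conjI that(1,2))
    show "g2 x * \<nu>\<^sup>2 + g1 x * \<nu> + g0 x = 0"
      unfolding g0_def g1_def g2_def using that(3) by (subst (asm) focal_form_quadratic)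
  qed
  have "reducible (\<lambda>x y. Wh y * ((\<Sum>i\<in>UNIV. (x $ i + (-1) * y $ i) * (x $ i + (-1) * y $ i))) + (-1) * Rh y)"
    unfolding sum_3
    by (intro reducible_add reducible_mult reducible_center reducible_coordinate reducible_point
        polyW polyR polyfun_intros)
  moreover have "(\<lambda>x y. Wh y * ((\<Sum>i\<in>UNIV. (x $ i + (-1) * y $ i) * (x $ i + (-1) * y $ i))) + (-1) * Rh y)
     = (\<lambda>x y. Wh y * ((x - y) \<bullet> (x - y)) - Rh y)"
    by (simp add: inner_vec_def)
  ultimately have "reducible (\<lambda>x y. Wh y * ((x - y) \<bullet> (x - y)) - Rh y)" by (simp only:)
  then obtain k N a b where ab: "real_polynomial_function a" "real_polynomial_function b"
    "\<And>x \<nu> y. focal x \<nu> y \<Longrightarrow> g2 x ^ k * \<nu> ^ N * (Wh y * ((x - y) \<bullet> (x - y)) - Rh y) = a x * \<nu> + b x"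
    unfolding reducible_def reduces_def by blast
  have gB: "B.generically (\<lambda>s x. \<exists>\<nu>. \<nu> \<noteq> 0 \<and> G x = \<nu> *\<^sub>R (x - B.center s) \<and> a x * \<nu> + b x = 0)"
  proof (rule B.generically_mono[OF focB])
    fix s x assume s: "poly w2 s \<noteq> 0" "x \<in> B.circle s"
      and "\<exists>\<nu>. \<nu> \<noteq> 0 \<and> G x = \<nu> *\<^sub>R (x - B.center s) \<and> focal_form (H x) (G x) \<nu> = 0"
    then obtain \<nu> where \<nu>: "\<nu> \<noteq> 0" "G x = \<nu> *\<^sub>R (x - B.center s)" "focal_form (H x) (G x) \<nu> = 0" by blast
    have "a x * \<nu> + b x = 0" using ab(3)[OF focal_iff[OF \<nu>]] zeroB[OF s] by simp
    then show "\<exists>\<nu>. \<nu> \<noteq> 0 \<and> G x = \<nu> *\<^sub>R (x - B.center s) \<and> a x * \<nu> + b x = 0" using \<nu> by blast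
  qed
  have gA: "A.generically (\<lambda>t x. \<exists>\<nu>. a x * \<nu> + b x \<noteq> 0)"
  proof (rule A.generically_mono[OF A.generically_conj[OF focA A.generically_parameter[OF nonzeroA]]])
    fix t x assume t: "poly w t \<noteq> 0" "poly R t \<noteq> 0" "x \<in> A.circle t"
      and h: "(\<exists>\<nu>. \<nu> \<noteq> 0 \<and> G x = \<nu> *\<^sub>R (x - A.center t) \<and> focal_form (H x) (G x) \<nu> = 0) \<and>
        (\<forall>x\<in>A.circle t. Wh (A.center t) * ((x - A.center t) \<bullet> (x - A.center t)) \<noteq> Rh (A.center t))"
    then obtain \<nu> where \<nu>: "\<nu> \<noteq> 0" "G x = \<nu> *\<^sub>R (x - A.center t)" "focal_form (H x) (G x) \<nu> = 0" by blast
    have "x - A.center t \<noteq> 0" using A.circle_distance[OF t(1,3)] t by auto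
    then have "g2 x \<noteq> 0" using \<nu> by (simp add: g2_def)
    moreover have "Wh (A.center t) * ((x - A.center t) \<bullet> (x - A.center t)) - Rh (A.center t) \<noteq> 0"
      using h t(3) by simp
    ultimately have "a x * \<nu> + b x \<noteq> 0"
      using \<nu>(1) ab(3)[OF focal_iff[OF \<nu>]] by (metis mult_eq_0_iff power_not_zero)
    then show "\<exists>\<nu>. a x * \<nu> + b x \<noteq> 0" by blast
  qed
  \<comment> \<open>If \<open>a\<close> vanished on the surface, then so would \<open>b\<close>, contrary to the first family.\<close>
  have "\<exists>x\<in>B.sweep. a x \<noteq> 0"
  proof (rule ccontr)
    assume "\<not> (\<exists>x\<in>B.sweep. a x \<noteq> 0)"
    then have a0: "\<forall>x\<in>B.sweep. a x = 0" by blast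
    have "B.generically (\<lambda>s x. b x = 0)"
      by (rule B.generically_mono[OF gB]) (use a0 in \<open>auto simp: B.sweep_def\<close>)
    then have b0: "\<forall>x\<in>A.sweep. b x = 0" using transfer_zero[OF ab(2)] by blast
    have a0': "\<forall>x\<in>A.sweep. a x = 0" using a0 same_ideal[OF ab(1)] by blast
    show False
      using gA by (rule A.generically_witness) (use a0' b0 in \<open>auto simp: A.sweep_def\<close>)
  qed
  then obtain x0 where x0: "x0 \<in> B.sweep" "a x0 \<noteq> 0" by blast
  have gB': "B.generically (\<lambda>s x. b x \<noteq> 0 \<and> b x *\<^sub>R B.center s = b x *\<^sub>R x + a x *\<^sub>R G x)"
  proof (rule B.generically_mono[OF B.generically_conj[OF gB B.generically_nonzero[OF ab(1) x0]]])
    fix s x assume "(\<exists>\<nu>. \<nu> \<noteq> 0 \<and> G x = \<nu> *\<^sub>R (x - B.center s) \<and> a x * \<nu> + b x = 0) \<and> a x \<noteq> 0"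
    then obtain \<nu> where \<nu>: "\<nu> \<noteq> 0" "G x = \<nu> *\<^sub>R (x - B.center s)" "a x * \<nu> + b x = 0" "a x \<noteq> 0" by blast
    have b: "b x = - (a x * \<nu>)" using \<nu>(3) by simp
    show "b x \<noteq> 0 \<and> b x *\<^sub>R B.center s = b x *\<^sub>R x + a x *\<^sub>R G x"
      using \<nu>(1,4) unfolding \<nu>(2) b by (simp add: algebra_simps)
  qed
  obtain d where d: "polyfun_degree d P" "polyfun_degree d D"
  proof -
    obtain d1 d2 where "polyfun_degree d1 P" "polyfun_degree d2 D"
      using polynomial_imp_polyfun_degree polyP polyD by blast
    then show ?thesis using that[of "max d1 d2"] by (meson polyfun_degree_mono max.cobounded1 max.cobounded2)
  qed
  have polyV: "real_polynomial_function (\<lambda>x. (b x *\<^sub>R x + a x *\<^sub>R G x) $ i)" for i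
    by (simp only: vector_add_component vector_scaleR_component real_scaleR_def)
      (intro polyfun_intros polyG ab)
  obtain P' where P': "real_polynomial_function P'"
    "\<And>x y. b x *\<^sub>R y = b x *\<^sub>R x + a x *\<^sub>R G x \<Longrightarrow> P' x = b x ^ d * P y"
    using cleared_composition[OF d(1) ab(2) polyV] by blast
  obtain D' where D': "real_polynomial_function D'"
    "\<And>x y. b x *\<^sub>R y = b x *\<^sub>R x + a x *\<^sub>R G x \<Longrightarrow> D' x = b x ^ d * D y"
    using cleared_composition[OF d(2) ab(2) polyV] by blast
  show thesis
  proof (rule that[OF P'(1) D'(1) polyG])
    show "B.generically (\<lambda>s x. D' x \<noteq> 0 \<and> P' x = s * D' x)"
    proof (rule B.generically_mono[OF B.generically_conj[OF gB' B.generically_parameter[OF proper]]])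
      fix s x assume h: "(b x \<noteq> 0 \<and> b x *\<^sub>R B.center s = b x *\<^sub>R x + a x *\<^sub>R G x) \<and>
        D (B.center s) \<noteq> 0 \<and> P (B.center s) = s * D (B.center s)"
      then have e: "b x *\<^sub>R B.center s = b x *\<^sub>R x + a x *\<^sub>R G x" by blast
      show "D' x \<noteq> 0 \<and> P' x = s * D' x" unfolding P'(2)[OF e] D'(2)[OF e] using h by simp
    qed
    show "A.generically (\<lambda>t x. \<exists>\<nu>. \<nu> \<noteq> 0 \<and> G x = \<nu> *\<^sub>R (x - A.center t))"
      by (rule A.generically_mono[OF focA]) blast
    show "B.generically (\<lambda>t x. \<exists>\<nu>. \<nu> \<noteq> 0 \<and> G x = \<nu> *\<^sub>R (x - B.center t))"
      by (rule B.generically_mono[OF focB]) blast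
  qed
qed

lemma nonzero_along_spine:
  assumes "real_polynomial_function F" "\<forall>\<^sub>F s in cofinite. F (B.center s) \<noteq> 0"
  shows "\<forall>\<^sub>F t in cofinite. F (A.center t) \<noteq> 0"
proof -
  have "\<forall>\<^sub>F s in cofinite. poly w2 s \<noteq> 0 \<and> F (B.center s) \<noteq> 0"
    using assms(2) B.cofinite_w by eventually_elim simp
  from infinite_imp_nonempty[OF cofinite_imp_infinite[OF this]]
  obtain s where "poly w2 s \<noteq> 0" "F (B.center s) \<noteq> 0" by blast
  then obtain t where t: "poly w t \<noteq> 0" "F (A.center t) \<noteq> 0" using same_spine[OF assms(1)] by blast
  obtain q d where q: "\<And>t. poly w t \<noteq> 0 \<Longrightarrow> poly q t = poly w t ^ d * F (A.center t)"
    using A.polynomial_along_center[OF assms(1)] by blast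
  have "q \<noteq> 0" using q[OF t(1)] t by auto
  then have "\<forall>\<^sub>F t in cofinite. poly q t \<noteq> 0" by (simp add: eventually_cofinite poly_roots_finite)
  then show ?thesis using A.cofinite_w
    by eventually_elim (use q in auto)
qed

text \<open>
  By hypothesis infinitely many normals along one circle of the first family contain a centre of the
  second family. Infinitely many distinct such centres would put the spine on the cone of normals.
  Otherwise one centre lies on infinitely many normals; as these meet in the apex \<open>c t\<close> only, it is the
  apex.
\<close>

lemma corresponding_parameter:
  assumes good: "infinite {x \<in> A.circle t. \<exists>\<sigma>. poly w2 \<sigma> \<noteq> 0 \<and>
      (x - B.center \<sigma>) \<bullet> (x - B.center \<sigma>) = (poly R2 \<sigma> / poly w2 \<sigma>)\<^sup>2 \<and>
      (x - B.center \<sigma>) \<times> (x - A.center t) = 0}"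
    and t: "poly w t \<noteq> 0" "poly R t \<noteq> 0"
  obtains \<sigma> where "poly w2 \<sigma> \<noteq> 0" "B.center \<sigma> = A.center t"
    "(poly R t / poly w t)\<^sup>2 = (poly R2 \<sigma> / poly w2 \<sigma>)\<^sup>2"
proof -
  define X where "X = {x \<in> A.circle t. \<exists>\<sigma>. poly w2 \<sigma> \<noteq> 0 \<and>
      (x - B.center \<sigma>) \<bullet> (x - B.center \<sigma>) = (poly R2 \<sigma> / poly w2 \<sigma>)\<^sup>2 \<and>
      (x - B.center \<sigma>) \<times> (x - A.center t) = 0}"
  have X: "infinite X" using good by (simp add: X_def)
  have "\<forall>x\<in>X. \<exists>\<sigma>. poly w2 \<sigma> \<noteq> 0 \<and>
      (x - B.center \<sigma>) \<bullet> (x - B.center \<sigma>) = (poly R2 \<sigma> / poly w2 \<sigma>)\<^sup>2 \<and>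
      (x - B.center \<sigma>) \<times> (x - A.center t) = 0"
    by (simp add: X_def)
  from bchoice[OF this] obtain \<sigma> where \<sigma>: "\<And>x. x \<in> X \<Longrightarrow> poly w2 (\<sigma> x) \<noteq> 0"
    "\<And>x. x \<in> X \<Longrightarrow> (x - B.center (\<sigma> x)) \<bullet> (x - B.center (\<sigma> x)) = (poly R2 (\<sigma> x) / poly w2 (\<sigma> x))\<^sup>2"
    "\<And>x. x \<in> X \<Longrightarrow> (x - B.center (\<sigma> x)) \<times> (x - A.center t) = 0" by blast
  have Xc: "x \<in> A.circle t" if "x \<in> X" for x using that by (simp add: X_def)
  have dist: "(x - A.center t) \<bullet> (x - A.center t) = (poly R t / poly w t)\<^sup>2" if "x \<in> X" for x
    using A.circle_distance[OF t(1) Xc[OF that]] .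
  define z where "z = (\<lambda>s. B.center s - A.center t)"
  have zx: "z (\<sigma> x) \<times> (x - A.center t) = 0" if "x \<in> X" for x
  proof -
    have "z (\<sigma> x) = (x - A.center t) - (x - B.center (\<sigma> x))" by (simp add: z_def)
    then have "z (\<sigma> x) \<times> (x - A.center t) =
        (x - A.center t) \<times> (x - A.center t) - (x - B.center (\<sigma> x)) \<times> (x - A.center t)"
      by (simp only: Cross3.left_diff_distrib)
    then show ?thesis unfolding \<sigma>(3)[OF that] cross_refl by simp
  qed
  show ?thesis
  proof (cases "finite (\<sigma> ` X)")
    case False
    \<comment> \<open>Infinitely many centres of the second family lie on the cone of normals along the circle.\<close>
    define q where "q = (\<lambda>y. ((y - A.center t) \<bullet> A.T t)\<^sup>2
       - (poly (A.U) t)\<^sup>2 * ((y - A.center t) \<bullet> (y - A.center t)))"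
    have polyq: "real_polynomial_function q"
      unfolding q_def
      by (intro polyfun_intros real_polynomial_function_inner;
          simp only: vector_minus_component; intro polyfun_intros)
    have "q (B.center (\<sigma> x)) = 0" if x: "x \<in> X" for x
    proof -
      define u where "u = x - A.center t"
      have uu: "u \<bullet> u \<noteq> 0" using dist[OF x] t by (simp add: u_def)
      have "(u \<bullet> u) *\<^sub>R z (\<sigma> x) = (z (\<sigma> x) \<bullet> u) *\<^sub>R u + u \<times> (z (\<sigma> x) \<times> u)"
        by (simp add: cross_triple_expand)
      then have zu: "(u \<bullet> u) *\<^sub>R z (\<sigma> x) = (z (\<sigma> x) \<bullet> u) *\<^sub>R u"
        using zx[OF x] by (simp add: u_def)
      define k where "k = (z (\<sigma> x) \<bullet> u) / (u \<bullet> u)"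
      have "z (\<sigma> x) = (1 / (u \<bullet> u)) *\<^sub>R ((u \<bullet> u) *\<^sub>R z (\<sigma> x))" using uu by simp
      then have k: "z (\<sigma> x) = k *\<^sub>R u" unfolding zu by (simp add: k_def)
      have "A.Y t x = poly w t *\<^sub>R u" using t by (simp add: A.Y_eq u_def)
      with Xc[OF x] have c: "(poly w t)\<^sup>2 * (u \<bullet> u) = (poly R t)\<^sup>2"
         "poly w t * (u \<bullet> A.T t) = - (poly R t * poly A.U t)"
        by (auto simp: A.circle_def power2_eq_square)
      have "(poly w t)\<^sup>2 * (u \<bullet> A.T t)\<^sup>2 = (poly w t * (u \<bullet> A.T t))\<^sup>2" by (simp add: power_mult_distrib)
      also have "\<dots> = (poly R t)\<^sup>2 * (poly A.U t)\<^sup>2" unfolding c(2) by (simp add: power_mult_distrib)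
      also have "\<dots> = (poly w t)\<^sup>2 * ((poly A.U t)\<^sup>2 * (u \<bullet> u))" unfolding c(1)[symmetric] by simp
      finally have "(u \<bullet> A.T t)\<^sup>2 = (poly A.U t)\<^sup>2 * (u \<bullet> u)" using t by simp
      then have "(z (\<sigma> x) \<bullet> A.T t)\<^sup>2 = (poly A.U t)\<^sup>2 * (z (\<sigma> x) \<bullet> z (\<sigma> x))"
        unfolding k by (simp add: power_mult_distrib power2_eq_square)
      then show ?thesis by (simp add: q_def z_def)
    qed
    then have "\<sigma> ` X \<subseteq> {s. poly w2 s \<noteq> 0 \<and> q (B.center s) = 0}" using \<sigma>(1) by blast
    with False have "infinite {s. poly w2 s \<noteq> 0 \<and> q (B.center s) = 0}" using infinite_super by blast
    then have "\<forall>s. poly w2 s \<noteq> 0 \<longrightarrow> q (B.center s) = 0" using B.center_zero[OF polyq] by blast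
    then have "\<forall>s. poly w s \<noteq> 0 \<longrightarrow> q (A.center s) = 0" using same_spine[OF polyq] by blast
    then show ?thesis using A.spine_not_in_cone[OF t(1)] by (simp add: q_def)
  next
    case True
    then obtain s where s: "s \<in> \<sigma> ` X" "infinite {x \<in> X. \<sigma> x = s}"
      using pigeonhole_infinite[OF X True] by auto
    have "z s = 0"
    proof (rule ccontr)
      assume nz: "z s \<noteq> 0"
      define k where "k = \<bar>poly R t / poly w t\<bar> / norm (z s)"
      have "{x \<in> X. \<sigma> x = s} \<subseteq> {A.center t + k *\<^sub>R z s, A.center t - k *\<^sub>R z s}"
      proof
        fix x assume "x \<in> {x \<in> X. \<sigma> x = s}"
        then have x: "x \<in> X" "\<sigma> x = s" by auto
        define u where "u = x - A.center t"
        define l where "l = (u \<bullet> z s) / (z s \<bullet> z s)"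
        have "z s \<times> u = 0" using zx[OF x(1)] x(2) by (simp add: u_def)
        then have "u \<times> z s = 0" by (metis cross_skew minus_zero)
        then have "(z s \<bullet> z s) *\<^sub>R u = (u \<bullet> z s) *\<^sub>R z s"
          using cross_triple_expand[of "z s" u] by simp
        moreover have "u = (1 / (z s \<bullet> z s)) *\<^sub>R ((z s \<bullet> z s) *\<^sub>R u)" using nz by simp
        ultimately have u: "u = l *\<^sub>R z s" by (simp add: l_def)
        have "norm u = \<bar>poly R t / poly w t\<bar>"
          using dist[OF x(1)] by (simp add: u_def norm_eq_sqrt_inner)
        then have "\<bar>l\<bar> = k" using nz unfolding u by (simp add: k_def eq_divide_eq del: abs_divide)
        then have "l = k \<or> l = - k" by linarith
        moreover have "x = A.center t + l *\<^sub>R z s"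
          using u by (simp add: u_def diff_eq_eq add.commute)
        ultimately show "x \<in> {A.center t + k *\<^sub>R z s, A.center t - k *\<^sub>R z s}" by auto
      qed
      then show False using s(2) by (meson finite.emptyI finite.insertI finite_subset)
    qed
    obtain x where x: "x \<in> X" "\<sigma> x = s" using s(1) by blast
    show ?thesis
    proof (rule that[of s])
      show "poly w2 s \<noteq> 0" using \<sigma>(1) x by blast
      show c: "B.center s = A.center t" using \<open>z s = 0\<close> by (simp add: z_def)
      show "(poly R t / poly w t)\<^sup>2 = (poly R2 s / poly w2 s)\<^sup>2"
        using dist[OF x(1)] \<sigma>(2)[OF x(1)] x(2) c by simp
    qed
  qed
qed

text \<open>
  The function \<open>\<delta>\<close> is, up to a denominator, the difference of the squared radii at corresponding
  parameters. It vanishes either almost everywhere or almost nowhere. In the second case the relation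
  of \<open>rational_parameter\<close> is available, and \<open>corresponding_parameter\<close> shows that \<open>\<delta>\<close> vanishes after
  all.
\<close>

lemma radius_condition:
  "\<forall>\<^sub>F t in cofinite. D (A.center t) \<noteq> 0 \<and>
     (poly R t / poly w t)\<^sup>2 * (poly w2 (P (A.center t) / D (A.center t)))\<^sup>2
       = (poly R2 (P (A.center t) / D (A.center t)))\<^sup>2"
proof -
  define m where "m = max (degree (w2\<^sup>2)) (degree (R2\<^sup>2))"
  obtain Wh where Wh: "real_polynomial_function Wh" "\<And>y s. P y = s * D y \<Longrightarrow> Wh y = D y ^ m * poly (w2\<^sup>2) s"
    by (rule homogenized_substitution[OF polyP polyD, of "w2\<^sup>2" m]) (simp_all add: m_def)
  obtain Rh where Rh: "real_polynomial_function Rh" "\<And>y s. P y = s * D y \<Longrightarrow> Rh y = D y ^ m * poly (R2\<^sup>2) s"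
    by (rule homogenized_substitution[OF polyP polyD, of "R2\<^sup>2" m]) (simp_all add: m_def)
  have Dnz: "\<forall>\<^sub>F t in cofinite. D (A.center t) \<noteq> 0"
    by (rule nonzero_along_spine[OF polyD]) (use proper in eventually_elim, simp)
  define \<delta> where "\<delta> = (\<lambda>t. Wh (A.center t) * (poly R t / poly w t)\<^sup>2 - Rh (A.center t))"
  have "(\<forall>\<^sub>F t in cofinite. \<delta> t = 0) \<or> (\<forall>\<^sub>F t in cofinite. \<delta> t \<noteq> 0)"
  proof -
    obtain q1 d1 where q1: "\<And>t. poly w t \<noteq> 0 \<Longrightarrow> poly q1 t = poly w t ^ d1 * Wh (A.center t)"
      using A.polynomial_along_center[OF Wh(1)] by blast
    obtain q2 d2 where q2: "\<And>t. poly w t \<noteq> 0 \<Longrightarrow> poly q2 t = poly w t ^ d2 * Rh (A.center t)"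
      using A.polynomial_along_center[OF Rh(1)] by blast
    define e where "e = R\<^sup>2 * w ^ d2 * q1 - w\<^sup>2 * w ^ d1 * q2"
    have e: "poly e t = poly w t ^ (d1 + d2 + 2) * \<delta> t" if "poly w t \<noteq> 0" for t
      using that by (simp add: e_def q1 q2 \<delta>_def power_add power2_eq_square field_simps)
    show ?thesis
    proof (cases "e = 0")
      case True
      have "\<forall>\<^sub>F t in cofinite. \<delta> t = 0"
        using A.cofinite_w by eventually_elim (use e True in auto)
      then show ?thesis ..
    next
      case False
      then have "\<forall>\<^sub>F t in cofinite. poly e t \<noteq> 0" by (simp add: eventually_cofinite poly_roots_finite)
      then have "\<forall>\<^sub>F t in cofinite. \<delta> t \<noteq> 0"
        using A.cofinite_w by eventually_elim (use e in auto)
      then show ?thesis ..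
    qed
  qed
  moreover have False if nz: "\<forall>\<^sub>F t in cofinite. \<delta> t \<noteq> 0"
  proof -
    have "\<forall>\<^sub>F t in cofinite. \<forall>x\<in>A.circle t.
      Wh (A.center t) * ((x - A.center t) \<bullet> (x - A.center t)) \<noteq> Rh (A.center t)"
      using nz A.cofinite_w
    proof eventually_elim
      case (elim t)
      then show ?case using A.circle_distance by (auto simp: \<delta>_def)
    qed
    moreover have "Wh (B.center s) * ((x - B.center s) \<bullet> (x - B.center s)) = Rh (B.center s)"
      if "poly w2 s \<noteq> 0" "x \<in> B.circle s" for s x
      unfolding Wh(2)[OF inverse_on_spine[OF that(1)]] Rh(2)[OF inverse_on_spine[OF that(1)]]
        B.circle_distance[OF that] using that(1) by (simp add: power_divide)
    ultimately obtain P' D' G where PDG: "real_polynomial_function P'" "real_polynomial_function D'"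
      "\<And>i. real_polynomial_function (\<lambda>x. G x $ i)"
      "B.generically (\<lambda>s x. D' x \<noteq> 0 \<and> P' x = s * D' x)"
      "A.generically (\<lambda>t x. \<exists>\<nu>. \<nu> \<noteq> 0 \<and> G x = \<nu> *\<^sub>R (x - A.center t))"
      "B.generically (\<lambda>s x. \<exists>\<nu>. \<nu> \<noteq> 0 \<and> G x = \<nu> *\<^sub>R (x - B.center s))"
      using rational_parameter[OF Wh(1) Rh(1)] by blast
    define M where "M = degree w2 + (\<Sum>i\<in>UNIV. degree (C2 $ i)) + degree R2"
    have CM: "degree (C2 $ i) \<le> M" for i
      using member_le_sum[of i UNIV "\<lambda>i. degree (C2 $ i)"] by (simp add: M_def)
    obtain Wc where Wc: "real_polynomial_function Wc" "\<And>x s. P' x = s * D' x \<Longrightarrow> Wc x = D' x ^ M * poly w2 s"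
      by (rule homogenized_substitution[OF PDG(1,2), of w2 M]) (simp_all add: M_def)
    obtain Rc where Rc: "real_polynomial_function Rc" "\<And>x s. P' x = s * D' x \<Longrightarrow> Rc x = D' x ^ M * poly R2 s"
      by (rule homogenized_substitution[OF PDG(1,2), of R2 M]) (simp_all add: M_def)
    have "\<exists>Q. real_polynomial_function Q \<and> (\<forall>x s. P' x = s * D' x \<longrightarrow> Q x = D' x ^ M * poly (C2 $ i) s)" for i
      by (rule homogenized_substitution[OF PDG(1,2) CM[of i]]) blast
    then obtain Cc where Cc: "\<And>i. real_polynomial_function (Cc i)"
      "\<And>i x s. P' x = s * D' x \<Longrightarrow> Cc i x = D' x ^ M * poly (C2 $ i) s" by metis
    define Yc where "Yc = (\<lambda>x. Wc x *\<^sub>R x - (\<chi> i. Cc i x))"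
    have polyYc: "real_polynomial_function (\<lambda>x. Yc x $ i)" for i
      by (simp add: Yc_def) (intro polyfun_intros Wc(1) Cc(1))
    have Yc: "Yc x = D' x ^ M *\<^sub>R B.Y s x" if "P' x = s * D' x" for x s
      by (simp add: Yc_def B.Y_def Wc(2)[OF that] Cc(2)[OF that] vec_eq_iff algebra_simps)
    have D'A: "A.generically (\<lambda>t x. D' x \<noteq> 0)"
      by (rule transfer_nonzero[OF PDG(2)]) (rule B.generically_mono[OF PDG(4)], blast)
    have WcA: "A.generically (\<lambda>t x. Wc x \<noteq> 0)"
      by (rule transfer_nonzero[OF Wc(1)]) (rule B.generically_mono[OF PDG(4)], auto simp: Wc(2))
    have sphereA: "Yc x \<bullet> Yc x - (Rc x)\<^sup>2 = 0" if "x \<in> A.sweep" for x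
    proof (rule transfer_zero[OF _ _ that])
      show "real_polynomial_function (\<lambda>x. Yc x \<bullet> Yc x - (Rc x)\<^sup>2)"
        by (intro polyfun_intros real_polynomial_function_inner polyYc Rc(1))
      show "B.generically (\<lambda>s x. Yc x \<bullet> Yc x - (Rc x)\<^sup>2 = 0)"
      proof (rule B.generically_mono[OF PDG(4)])
        fix s x assume s: "x \<in> B.circle s" "D' x \<noteq> 0 \<and> P' x = s * D' x"
        then show "Yc x \<bullet> Yc x - (Rc x)\<^sup>2 = 0"
          by (simp add: Yc[of x s] Rc(2)[of x s] B.circle_def power_mult_distrib) (simp add: power2_eq_square)
      qed
    qed
    have normalA: "G x \<times> Yc x = 0" if "x \<in> A.sweep" for x
    proof -
      have "(G x \<times> Yc x) $ i = 0" for i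
      proof (rule transfer_zero[OF _ _ that])
        show "real_polynomial_function (\<lambda>x. (G x \<times> Yc x) $ i)"
          by (intro real_polynomial_function_cross3 polyYc PDG(3))
        show "B.generically (\<lambda>s x. (G x \<times> Yc x) $ i = 0)"
        proof (rule B.generically_mono[OF B.generically_conj[OF PDG(4,6)]])
          fix s x assume s: "poly w2 s \<noteq> 0" "(D' x \<noteq> 0 \<and> P' x = s * D' x) \<and> (\<exists>\<nu>. \<nu> \<noteq> 0 \<and> G x = \<nu> *\<^sub>R (x - B.center s))"
          then obtain \<nu> where "G x = \<nu> *\<^sub>R (x - B.center s)" by blast
          then show "(G x \<times> Yc x) $ i = 0"
            using s by (simp add: Yc[of x s] B.Y_eq cross_mult_left cross_mult_right)
        qed
      qed
      then show ?thesis by (simp add: vec_eq_iff)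
    qed
    have "A.generically (\<lambda>t x. \<exists>\<sigma>. poly w2 \<sigma> \<noteq> 0 \<and>
      (x - B.center \<sigma>) \<bullet> (x - B.center \<sigma>) = (poly R2 \<sigma> / poly w2 \<sigma>)\<^sup>2 \<and>
      (x - B.center \<sigma>) \<times> (x - A.center t) = 0)"
    proof (rule A.generically_mono[OF A.generically_conj[OF A.generically_conj[OF D'A WcA] PDG(5)]])
      fix t x assume t: "poly w t \<noteq> 0" "x \<in> A.circle t"
        and h: "(D' x \<noteq> 0 \<and> Wc x \<noteq> 0) \<and> (\<exists>\<nu>. \<nu> \<noteq> 0 \<and> G x = \<nu> *\<^sub>R (x - A.center t))"
      then obtain \<nu> where \<nu>: "\<nu> \<noteq> 0" "G x = \<nu> *\<^sub>R (x - A.center t)" by blast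
      have xs: "x \<in> A.sweep" using t by (auto simp: A.sweep_def)
      define \<sigma> where "\<sigma> = P' x / D' x"
      have \<sigma>: "P' x = \<sigma> * D' x" using h by (simp add: \<sigma>_def)
      have w2: "poly w2 \<sigma> \<noteq> 0" using h Wc(2)[OF \<sigma>] by auto
      have Yc': "Yc x = (D' x ^ M * poly w2 \<sigma>) *\<^sub>R (x - B.center \<sigma>)"
        using Yc[OF \<sigma>] w2 by (simp add: B.Y_eq)
      have "(D' x ^ M)\<^sup>2 * ((poly w2 \<sigma>)\<^sup>2 * ((x - B.center \<sigma>) \<bullet> (x - B.center \<sigma>))) = (D' x ^ M)\<^sup>2 * (poly R2 \<sigma>)\<^sup>2"
        using sphereA[OF xs] unfolding Yc' Rc(2)[OF \<sigma>] by (simp add: power2_eq_square algebra_simps)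
      then have "(poly w2 \<sigma>)\<^sup>2 * ((x - B.center \<sigma>) \<bullet> (x - B.center \<sigma>)) = (poly R2 \<sigma>)\<^sup>2" using h by simp
      then have 1: "(x - B.center \<sigma>) \<bullet> (x - B.center \<sigma>) = (poly R2 \<sigma> / poly w2 \<sigma>)\<^sup>2"
        using w2 by (simp add: power_divide field_simps)
      have "(x - A.center t) \<times> (x - B.center \<sigma>) = 0"
        using normalA[OF xs] h w2 \<nu> unfolding Yc' by (simp add: cross_mult_left cross_mult_right)
      then have 2: "(x - B.center \<sigma>) \<times> (x - A.center t) = 0" by (metis cross_skew minus_zero)
      show "\<exists>\<sigma>. poly w2 \<sigma> \<noteq> 0 \<and>
        (x - B.center \<sigma>) \<bullet> (x - B.center \<sigma>) = (poly R2 \<sigma> / poly w2 \<sigma>)\<^sup>2 \<and>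
        (x - B.center \<sigma>) \<times> (x - A.center t) = 0" using w2 1 2 by blast
    qed
    then have "\<forall>\<^sub>F t in cofinite. \<delta> t = 0"
      using A.cofinite_regular unfolding A.generically_def
    proof eventually_elim
      case (elim t)
      let ?Q = "\<lambda>x. \<exists>\<sigma>. poly w2 \<sigma> \<noteq> 0 \<and>
        (x - B.center \<sigma>) \<bullet> (x - B.center \<sigma>) = (poly R2 \<sigma> / poly w2 \<sigma>)\<^sup>2 \<and>
        (x - B.center \<sigma>) \<times> (x - A.center t) = 0"
      have "infinite (A.circle t - {x \<in> A.circle t. \<not> ?Q x})"
        using elim by (intro Diff_infinite_finite A.infinite_circle) auto
      moreover have "A.circle t - {x \<in> A.circle t. \<not> ?Q x} = {x \<in> A.circle t. ?Q x}" by blast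
      ultimately have inf: "infinite {x \<in> A.circle t. ?Q x}" by simp
      obtain \<sigma> where \<sigma>: "poly w2 \<sigma> \<noteq> 0" "B.center \<sigma> = A.center t"
        "(poly R t / poly w t)\<^sup>2 = (poly R2 \<sigma> / poly w2 \<sigma>)\<^sup>2"
        by (rule corresponding_parameter[OF inf]) (use elim in auto)
      have "P (A.center t) = \<sigma> * D (A.center t)" using inverse_on_spine[OF \<sigma>(1)] \<sigma>(2) by simp
      then show "\<delta> t = 0"
        unfolding \<delta>_def Wh(2)[OF \<open>P (A.center t) = _\<close>] Rh(2)[OF \<open>P (A.center t) = _\<close>] \<sigma>(3)
        using \<sigma>(1) by (simp add: power_divide)
    qed
    with nz have "\<forall>\<^sub>F t :: real in cofinite. False" by eventually_elim simp
    then show False using cofinite_imp_infinite by fastforce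
  qed
  ultimately have "\<forall>\<^sub>F t in cofinite. \<delta> t = 0" by blast
  then show ?thesis using Dnz
  proof eventually_elim
    case (elim t)
    define \<sigma> where "\<sigma> = P (A.center t) / D (A.center t)"
    have \<sigma>: "P (A.center t) = \<sigma> * D (A.center t)" using elim by (simp add: \<sigma>_def)
    have "D (A.center t) ^ m * ((poly R t / poly w t)\<^sup>2 * (poly w2 \<sigma>)\<^sup>2) = D (A.center t) ^ m * (poly R2 \<sigma>)\<^sup>2"
      using elim(1) by (simp add: \<delta>_def Wh(2)[OF \<sigma>] Rh(2)[OF \<sigma>] mult_ac)
    then show ?case using elim(2) by (simp add: \<sigma>_def)
  qed
qed

end

section \<open>Values of rational functions\<close>

text \<open>
  Relational, so that being defined and having a value are propagated through the field operations
  together.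
\<close>

definition ratfun_value :: "ratfun \<Rightarrow> real \<Rightarrow> real \<Rightarrow> bool" where
  "ratfun_value h t y \<longleftrightarrow> ratfun_defined_at h t \<and> ratfun_at h t = y"

text \<open>
  Any representation as a quotient may be used where its denominator does not vanish: by coprimality
  the reduced denominator does not vanish there either.
\<close>

lemma ratfun_value_Fract:
  assumes "poly q t \<noteq> 0"
  shows "ratfun_value (Fract p q) t (poly p t / poly q t)"
proof -
  define n where "n = fst (quot_of_fract (Fract p q))"
  define d where "d = snd (quot_of_fract (Fract p q))"
  have cop: "coprime n d" and d0: "d \<noteq> 0" by (simp_all add: n_def d_def coprime_quot_of_fract)
  have q0: "q \<noteq> 0" using assms by auto
  have "Fract n d = Fract p q" by (simp add: n_def d_def)
  then have "n * q = p * d" using d0 q0 by (simp add: eq_fract)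
  then have e: "poly n t * poly q t = poly p t * poly d t" by (metis poly_mult)
  have "poly d t \<noteq> 0"
  proof
    assume dz: "poly d t = 0"
    then have "poly n t = 0" using e assms by simp
    with dz have "[:-t, 1:] dvd n" "[:-t, 1:] dvd d" by (simp_all add: poly_eq_0_iff_dvd)
    with cop have "is_unit [:-t, 1:]" by (rule coprime_common_divisor)
    then show False by (simp add: is_unit_poly_iff)
  qed
  then show ?thesis using e assms
    by (simp add: ratfun_value_def ratfun_defined_at_def ratfun_at_def n_def[symmetric] d_def[symmetric] field_simps)
qed

lemma ratfun_value_cases:
  assumes "ratfun_value h t y"
  obtains n d where "h = Fract n d" "poly d t \<noteq> 0" "y = poly n t / poly d t"
  using assms that[of "fst (quot_of_fract h)" "snd (quot_of_fract h)"]
  by (auto simp: ratfun_value_def ratfun_defined_at_def ratfun_at_def)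

lemma ratfun_value_const: "ratfun_value (ratfun_const a) t a"
  using ratfun_value_Fract[of 1 t "[:a:]"] by (simp add: ratfun_const_def to_fract_def)

lemma ratfun_value_add:
  assumes "ratfun_value g t x" "ratfun_value h t y"
  shows "ratfun_value (g + h) t (x + y)"
proof -
  obtain n d where g: "g = Fract n d" "poly d t \<noteq> 0" "x = poly n t / poly d t" using assms(1) by (rule ratfun_value_cases)
  obtain n' d' where h: "h = Fract n' d'" "poly d' t \<noteq> 0" "y = poly n' t / poly d' t" using assms(2) by (rule ratfun_value_cases)
  have "d \<noteq> 0" "d' \<noteq> 0" using g(2) h(2) by auto
  then have "g + h = Fract (n * d' + n' * d) (d * d')" unfolding g(1) h(1) by (rule add_fract)
  moreover have "x + y = poly (n * d' + n' * d) t / poly (d * d') t"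
    using g h by (simp add: add_frac_eq)
  ultimately show ?thesis using ratfun_value_Fract[of "d * d'" t "n * d' + n' * d"] g(2) h(2) by simp
qed

lemma ratfun_value_mult:
  assumes "ratfun_value g t x" "ratfun_value h t y"
  shows "ratfun_value (g * h) t (x * y)"
proof -
  obtain n d where g: "g = Fract n d" "poly d t \<noteq> 0" "x = poly n t / poly d t" using assms(1) by (rule ratfun_value_cases)
  obtain n' d' where h: "h = Fract n' d'" "poly d' t \<noteq> 0" "y = poly n' t / poly d' t" using assms(2) by (rule ratfun_value_cases)
  have "g * h = Fract (n * n') (d * d')" unfolding g(1) h(1) by (rule mult_fract)
  then show ?thesis using ratfun_value_Fract[of "d * d'" t "n * n'"] g h by simp
qed

lemma ratfun_value_divide:
  assumes "ratfun_value g t x" "ratfun_value h t y" "y \<noteq> 0"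
  shows "ratfun_value (g / h) t (x / y)"
proof -
  obtain n d where g: "g = Fract n d" "poly d t \<noteq> 0" "x = poly n t / poly d t" using assms(1) by (rule ratfun_value_cases)
  obtain n' d' where h: "h = Fract n' d'" "poly d' t \<noteq> 0" "y = poly n' t / poly d' t" using assms(2) by (rule ratfun_value_cases)
  have "g / h = Fract (n * d') (d * n')" unfolding g(1) h(1) by (rule divide_fract)
  then show ?thesis using ratfun_value_Fract[of "d * n'" t "n * d'"] g h assms(3) by simp
qed

lemma ratfun_value_power2: "ratfun_value g t x \<Longrightarrow> ratfun_value (g\<^sup>2) t (x\<^sup>2)"
  by (simp add: power2_eq_square ratfun_value_mult)

lemma ratfun_value_sum:
  assumes "finite I" "\<And>i. i \<in> I \<Longrightarrow> ratfun_value (g i) t (x i)"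
  shows "ratfun_value (sum g I) t (sum x I)"
  using assms
proof (induction I rule: finite_induct)
  case empty
  show ?case using ratfun_value_Fract[of 1 t 0] by (simp add: Zero_fract_def)
qed (simp add: ratfun_value_add)

lemma ratfun_value_poly:
  assumes "ratfun_value \<phi> t s"
  shows "ratfun_value (poly (map_poly ratfun_const n) \<phi>) t (poly n s)"
proof (induction n)
  case 0
  show ?case using ratfun_value_Fract[of 1 t 0] by (simp add: Zero_fract_def)
next
  case (pCons a n)
  have "ratfun_const 0 = 0" by (simp add: ratfun_const_def)
  then show ?case using pCons
    by (simp add: map_poly_pCons ratfun_value_add ratfun_value_mult ratfun_value_const assms)
qed

lemma ratfun_value_compose:
  assumes "ratfun_value \<phi> t s" "ratfun_value h s y"
  shows "ratfun_value (ratfun_compose h \<phi>) t y"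
  using ratfun_value_divide[OF ratfun_value_poly[OF assms(1)] ratfun_value_poly[OF assms(1)]] assms(2)
  by (simp add: ratfun_compose_def ratfun_value_def ratfun_defined_at_def ratfun_at_def)

lemma ratfun_value_unique: "ratfun_value h t x \<Longrightarrow> ratfun_value h t y \<Longrightarrow> x = y"
  by (simp add: ratfun_value_def)

lemma cofinite_ratfun_defined: "\<forall>\<^sub>F t in cofinite. ratfun_defined_at h t"
  unfolding ratfun_defined_at_def eventually_cofinite by (simp add: poly_roots_finite)

lemma ratfun_eqI:
  assumes "\<forall>\<^sub>F t in cofinite. \<exists>y. ratfun_value g t y \<and> ratfun_value h t y"
  shows "g = h"
proof -
  define n d where "n = fst (quot_of_fract g)" and "d = snd (quot_of_fract g)"
  define n' d' where "n' = fst (quot_of_fract h)" and "d' = snd (quot_of_fract h)"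
  have nz: "d \<noteq> 0" "d' \<noteq> 0" by (simp_all add: d_def d'_def)
  have "infinite {t. \<exists>y. ratfun_value g t y \<and> ratfun_value h t y}"
    using assms by (rule cofinite_imp_infinite)
  moreover have "{t. \<exists>y. ratfun_value g t y \<and> ratfun_value h t y} \<subseteq> {t. poly (n * d' - n' * d) t = 0}"
    by (auto simp: ratfun_value_def ratfun_defined_at_def ratfun_at_def n_def d_def n'_def d'_def field_simps)
  ultimately have "infinite {t. poly (n * d' - n' * d) t = 0}" using infinite_super by blast
  then have "n * d' - n' * d = 0" using poly_roots_finite by blast
  then have "Fract n d = Fract n' d'" using nz by (simp add: eq_fract)
  then show ?thesis by (simp add: n_def d_def n'_def d'_def)
qed

definition curve_value :: "ratcurve \<Rightarrow> real \<Rightarrow> real^3 \<Rightarrow> bool" where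
  "curve_value c t y \<longleftrightarrow> (\<forall>i. ratfun_value (c $ i) t (y $ i))"

lemma curve_value_iff: "curve_value c t y \<longleftrightarrow> curve_defined_at c t \<and> curve_at c t = y"
  by (auto simp: curve_value_def curve_defined_at_def curve_at_def ratfun_value_def vec_eq_iff)

lemma curve_eqI:
  assumes "\<forall>\<^sub>F t in cofinite. \<exists>y. curve_value g t y \<and> curve_value h t y"
  shows "g = h"
  unfolding vec_eq_iff
proof
  fix i
  show "g $ i = h $ i"
    by (rule ratfun_eqI, rule eventually_mono[OF assms]) (auto simp: curve_value_def)
qed

lemma cofinite_curve_defined: "\<forall>\<^sub>F t in cofinite. curve_defined_at c t"
  unfolding curve_defined_at_def by (subst eventually_all_finite) (auto intro: cofinite_ratfun_defined)

lemma curve_value_compose: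
  "ratfun_value \<phi> t s \<Longrightarrow> curve_value c s y \<Longrightarrow> curve_value (curve_compose c \<phi>) t y"
  by (simp add: curve_value_def curve_compose_def ratfun_value_compose)

lemma curve_value_affine:
  assumes "curve_value c t y"
  shows "curve_value (affine_image_curve Q b c) t (Q *v y + b)"
  using assms
  by (auto simp: curve_value_def affine_image_curve_def matrix_vector_mult_def
      intro!: ratfun_value_add ratfun_value_sum ratfun_value_mult ratfun_value_const)

lemma affine_image_inverse:
  assumes "orthogonal_matrix Q"
  shows "affine_image_curve (transpose Q) (- (transpose Q *v b)) (affine_image_curve Q b c) = c"
proof (rule curve_eqI, rule eventually_mono[OF cofinite_curve_defined[of c]])
  fix t assume "curve_defined_at c t"
  then have 1: "curve_value c t (curve_at c t)" by (simp add: curve_value_iff)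
  have "transpose Q *v (Q *v curve_at c t + b) + - (transpose Q *v b) = curve_at c t"
    using assms by (simp add: matrix_vector_right_distrib matrix_vector_mul_assoc orthogonal_matrix_def)
  with curve_value_affine[OF curve_value_affine[OF 1, of Q b], of "transpose Q" "- (transpose Q *v b)"]
  have "curve_value (affine_image_curve (transpose Q) (- (transpose Q *v b)) (affine_image_curve Q b c)) t (curve_at c t)"
    by simp
  with 1 show "\<exists>y. curve_value (affine_image_curve (transpose Q) (- (transpose Q *v b)) (affine_image_curve Q b c)) t y \<and> curve_value c t y"
    by blast
qed

section \<open>From rational curves to cleared sphere families\<close>

text \<open>
  The common denominator \<open>w\<close> vanishes exactly at the parameters where the family is not defined.
\<close>

definition represents :: "ratcurve \<Rightarrow> ratfun \<Rightarrow> real poly \<Rightarrow> real poly ^ 3 \<Rightarrow> real poly \<Rightarrow> bool" where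
  "represents c r w C R \<longleftrightarrow> w \<noteq> 0 \<and> (\<forall>t. poly w t \<noteq> 0 \<longleftrightarrow> curve_defined_at c t \<and> ratfun_defined_at r t) \<and>
    (\<forall>t. poly w t \<noteq> 0 \<longrightarrow> curve_at c t = (1 / poly w t) *\<^sub>R poly_vec C t \<and> ratfun_at r t = poly R t / poly w t)"

lemma representation_exists:
  obtains w C R where "represents c r w C R"
proof -
  define n where "n = (\<lambda>i. fst (quot_of_fract (c $ i)))"
  define d where "d = (\<lambda>i. snd (quot_of_fract (c $ i)))"
  define nr where "nr = fst (quot_of_fract r)"
  define dr where "dr = snd (quot_of_fract r)"
  define w where "w = prod d UNIV * dr"
  define C where "C = ((\<chi> i. n i * prod d (UNIV - {i}) * dr) :: real poly ^ 3)"
  define R where "R = nr * prod d UNIV"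
  have dn: "d i \<noteq> 0" "dr \<noteq> 0" for i by (simp_all add: d_def dr_def)
  have split: "prod d UNIV = d i * prod d (UNIV - {i})" for i
    by (rule prod.remove) auto
  have wt: "poly w t \<noteq> 0 \<longleftrightarrow> (\<forall>i. poly (d i) t \<noteq> 0) \<and> poly dr t \<noteq> 0" for t
    by (auto simp: w_def poly_prod)
  show thesis
  proof (rule that[of w C R], unfold represents_def, intro conjI allI impI)
    show "w \<noteq> 0" using dn by (simp add: w_def)
    show "poly w t \<noteq> 0 \<longleftrightarrow> curve_defined_at c t \<and> ratfun_defined_at r t" for t
      by (simp add: wt curve_defined_at_def ratfun_defined_at_def d_def dr_def)
    fix t assume t: "poly w t \<noteq> 0"
    show "ratfun_at r t = poly R t / poly w t"
      using t by (simp add: ratfun_at_def R_def w_def nr_def dr_def)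
    show "curve_at c t = (1 / poly w t) *\<^sub>R poly_vec C t"
      unfolding vec_eq_iff
    proof
      fix i
      have "poly (d i) t \<noteq> 0" "poly dr t \<noteq> 0" "poly (prod d (UNIV - {i})) t \<noteq> 0"
        using t by (auto simp: wt poly_prod)
      moreover have "poly w t = poly (d i) t * poly (prod d (UNIV - {i})) t * poly dr t"
        by (simp only: w_def split[of i] poly_mult)
      moreover have "curve_at c t $ i = poly (n i) t / poly (d i) t"
        by (simp add: curve_at_def ratfun_at_def n_def d_def)
      ultimately show "curve_at c t $ i = ((1 / poly w t) *\<^sub>R poly_vec C t) $ i"
        by (simp add: C_def)
    qed
  qed
qed

lemma polynomial_along_curve:
  assumes "real_polynomial_function F"
  obtains h where "\<And>t. curve_defined_at c t \<Longrightarrow> ratfun_value h t (F (curve_at c t))"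
proof -
  obtain w C R where rep: "represents c 0 w C R" by (rule representation_exists)
  have w0: "poly w t \<noteq> 0" if "curve_defined_at c t" for t
    using that rep by (simp add: represents_def ratfun_defined_at_def)
  obtain d where d: "polyfun_degree d F" using polynomial_imp_polyfun_degree[OF assms] by blast
  have "\<exists>F'. real_polynomial_function F' \<and> (\<forall>t y. poly w t *\<^sub>R y = poly_vec C t \<longrightarrow> F' t = poly w t ^ d * F y)"
    by (rule cleared_composition[OF d]) (simp_all add: real_polynomial_function_poly)
  then obtain F' where F': "real_polynomial_function F'"
    "\<And>t y. poly w t *\<^sub>R y = poly_vec C t \<Longrightarrow> F' t = poly w t ^ d * F y" by blast
  obtain q where q: "\<And>t. F' t = poly q t" using real_polynomial_function_real_imp_poly[OF F'(1)] by blast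
  show thesis
  proof (rule that[of "Fract q (w ^ d)"])
    fix t assume "curve_defined_at c t"
    then have t: "poly w t \<noteq> 0" by (rule w0)
    moreover from this have "curve_at c t = (1 / poly w t) *\<^sub>R poly_vec C t"
      using rep unfolding represents_def by blast
    ultimately have "poly w t *\<^sub>R curve_at c t = poly_vec C t" by simp
    then have "poly q t = poly w t ^ d * F (curve_at c t)" using F'(2) by (simp flip: q)
    then show "ratfun_value (Fract q (w ^ d)) t (F (curve_at c t))"
      using ratfun_value_Fract[of "w ^ d" t q] t by simp
  qed
qed

lemma curve_zero:
  assumes "real_polynomial_function F" "infinite {t. curve_defined_at c t \<and> F (curve_at c t) = 0}"
    and "curve_defined_at c t"
  shows "F (curve_at c t) = 0"
proof -
  obtain h where h: "\<And>t. curve_defined_at c t \<Longrightarrow> ratfun_value h t (F (curve_at c t))"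
    using polynomial_along_curve[OF assms(1)] by blast
  have "{t. curve_defined_at c t \<and> F (curve_at c t) = 0} \<subseteq> {t. poly (fst (quot_of_fract h)) t = 0}"
    using h by (force simp: ratfun_value_def ratfun_defined_at_def ratfun_at_def)
  then have "infinite {t. poly (fst (quot_of_fract h)) t = 0}" using assms(2) infinite_super by blast
  then have "fst (quot_of_fract h) = 0" using poly_roots_finite by blast
  then show ?thesis using h[OF assms(3)] by (simp add: ratfun_value_def ratfun_at_def)
qed

lemma rational_curve_has_vector_derivative:
  assumes t: "poly w t \<noteq> 0"
  shows "((\<lambda>s. (1 / poly w s) *\<^sub>R poly_vec C s) has_vector_derivative
    (1 / (poly w t)\<^sup>2) *\<^sub>R poly_vec (\<chi> i. cleared_deriv w (C $ i)) t) (at t)"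
proof (rule has_vector_derivative_vec_componentI)
  fix i
  have "((\<lambda>s. poly (C $ i) s / poly w s) has_real_derivative
     (poly (pderiv (C $ i)) t * poly w t - poly (C $ i) t * poly (pderiv w) t) / (poly w t * poly w t)) (at t)"
    by (rule DERIV_divide[OF poly_DERIV poly_DERIV t])
  then show "((\<lambda>s. ((1 / poly w s) *\<^sub>R poly_vec C s) $ i) has_real_derivative
    ((1 / (poly w t)\<^sup>2) *\<^sub>R poly_vec (\<chi> i. cleared_deriv w (C $ i)) t) $ i) (at t)"
    by (simp add: cleared_deriv_def power2_eq_square)
qed

lemma rational_function_has_real_derivative:
  assumes t: "poly w t \<noteq> 0"
  shows "((\<lambda>s. poly R s / poly w s) has_real_derivative poly (cleared_deriv w R) t / (poly w t)\<^sup>2) (at t)"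
  using DERIV_divide[OF poly_DERIV[of R] poly_DERIV t] by (simp add: cleared_deriv_def power2_eq_square)

context canal_family
begin

lemma center_has_vector_derivative:
  "poly w t \<noteq> 0 \<Longrightarrow> (center has_vector_derivative (1 / (poly w t)\<^sup>2) *\<^sub>R T t) (at t)"
  using rational_curve_has_vector_derivative[of w t C] by (simp add: center_def[abs_def] T_def)

lemma radius_has_real_derivative:
  "poly w t \<noteq> 0 \<Longrightarrow> ((\<lambda>s. poly R s / poly w s) has_real_derivative poly U t / (poly w t)\<^sup>2) (at t)"
  using rational_function_has_real_derivative[of w t R] by (simp add: U_def)

lemma circle_iff:
  assumes "poly w t \<noteq> 0"
  shows "x \<in> circle t \<longleftrightarrow> (norm (x - center t))\<^sup>2 - (poly R t / poly w t)\<^sup>2 = 0 \<and>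
    (x - center t) \<bullet> ((1 / (poly w t)\<^sup>2) *\<^sub>R T t) + (poly R t / poly w t) * (poly U t / (poly w t)\<^sup>2) = 0"
proof -
  have "Y t x \<bullet> Y t x = (poly w t)\<^sup>2 * (norm (x - center t))\<^sup>2"
    using assms unfolding power2_norm_eq_inner by (simp add: Y_eq power2_eq_square)
  moreover have "Y t x \<bullet> T t = poly w t * ((x - center t) \<bullet> T t)" using assms by (simp add: Y_eq)
  ultimately show ?thesis
    using assms by (auto simp: circle_def field_simps power_divide power3_eq_cube power2_eq_square)
qed

end

lemma represents_derivatives:
  assumes rep: "represents c r w C R" and t: "poly w t \<noteq> 0"
  shows "(curve_at c has_vector_derivative (1 / (poly w t)\<^sup>2) *\<^sub>R poly_vec (\<chi> i. cleared_deriv w (C $ i)) t) (at t)"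
    and "(ratfun_at r has_real_derivative poly (cleared_deriv w R) t / (poly w t)\<^sup>2) (at t)"
proof -
  have o: "open {s. poly w s \<noteq> 0}" by (intro open_Collect_neq continuous_intros)
  show "(curve_at c has_vector_derivative (1 / (poly w t)\<^sup>2) *\<^sub>R poly_vec (\<chi> i. cleared_deriv w (C $ i)) t) (at t)"
    by (rule has_vector_derivative_transform_within_open[OF rational_curve_has_vector_derivative[OF t] o])
      (use rep t in \<open>auto simp: represents_def\<close>)
  show "(ratfun_at r has_real_derivative poly (cleared_deriv w R) t / (poly w t)\<^sup>2) (at t)"
    by (rule has_field_derivative_transform_within_open[OF rational_function_has_real_derivative[OF t] o])
      (use rep t in \<open>auto simp: represents_def\<close>)
qed

lemma represents_family:
  assumes rep: "represents c r w C R" and fam: "sphere_family c r"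
  shows "canal_family w C R"
proof
  show "w \<noteq> 0" using rep by (simp add: represents_def)
  fix t assume t: "poly w t \<noteq> 0"
  let ?T = "poly_vec (\<chi> i. cleared_deriv w (C $ i)) t"
  have "(norm (vector_derivative (curve_at c) (at t)))\<^sup>2 > (deriv (ratfun_at r) t)\<^sup>2"
    using fam rep t by (simp add: sphere_family_def represents_def)
  then have "(poly (cleared_deriv w R) t / (poly w t)\<^sup>2)\<^sup>2 < (norm ((1 / (poly w t)\<^sup>2) *\<^sub>R ?T))\<^sup>2"
    unfolding vector_derivative_at[OF represents_derivatives(1)[OF rep t]]
      DERIV_imp_deriv[OF represents_derivatives(2)[OF rep t]] .
  then have "(poly (cleared_deriv w R) t)\<^sup>2 / ((poly w t)\<^sup>2)\<^sup>2 < (?T \<bullet> ?T) / ((poly w t)\<^sup>2)\<^sup>2"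
    unfolding power2_norm_eq_inner by (simp add: power_divide power2_eq_square[of "(poly w t)\<^sup>2"])
  then show "(poly (cleared_deriv w R) t)\<^sup>2 < ?T \<bullet> ?T"
    using t by (simp add: divide_less_cancel)
qed

lemma represents_char_circle:
  assumes rep: "represents c r w C R" and fam: "canal_family w C R" and t: "poly w t \<noteq> 0"
  shows "char_circle c r t = canal_family.circle w C R t"
proof -
  interpret canal_family w C R by (rule fam)
  have "curve_at c t = center t" "ratfun_at r t = poly R t / poly w t"
    using rep t by (simp_all add: represents_def center_def)
  then show ?thesis
    unfolding char_circle_def vector_derivative_at[OF represents_derivatives(1)[OF rep t]]
      DERIV_imp_deriv[OF represents_derivatives(2)[OF rep t]]
    using circle_iff[OF t] by (auto simp: T_def U_def)
qed

lemma represents_canal_surface: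
  assumes rep: "represents c r w C R" and fam: "canal_family w C R"
  shows "canal_surface c r = zariski_closure (canal_family.sweep w C R)"
proof -
  interpret canal_family w C R by (rule fam)
  have "(\<Union>t\<in>{t. curve_defined_at c t \<and> ratfun_defined_at r t}. char_circle c r t) = sweep"
    unfolding sweep_def using represents_char_circle[OF rep fam] rep by (simp add: represents_def)
  then show ?thesis by (simp add: canal_surface_def)
qed

section \<open>Affine images of Zariski closures\<close>

lemma vanishing_on_zariski_closure:
  "real_polynomial_function F \<Longrightarrow> (\<forall>x\<in>zariski_closure X. F x = 0) \<longleftrightarrow> (\<forall>x\<in>X. F x = 0)"
  by (auto simp: zariski_closure_def)

lemma real_polynomial_affine:
  fixes Q :: "real^3^3"
  assumes "real_polynomial_function F"
  shows "real_polynomial_function (\<lambda>x. F (Q *v x + b))"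
proof (rule real_polynomial_function_substitute[OF assms])
  show "real_polynomial_function (\<lambda>x. (Q *v x + b) $ i)" for i
    by (simp add: matrix_vector_mult_def sum_3) (intro polyfun_intros)
qed

lemma orthogonal_affine_inverse:
  assumes "orthogonal_matrix (Q :: real^3^3)"
  shows "Q *v (transpose Q *v x + - (transpose Q *v b)) + b = x"
    and "transpose Q *v (Q *v x + b) + - (transpose Q *v b) = x"
proof -
  have *: "Q *v (transpose Q *v y) = y" "transpose Q *v (Q *v y) = y" for y
    using assms by (simp_all only: matrix_vector_mul_assoc orthogonal_matrix_def matrix_vector_mul_lid)
  show "Q *v (transpose Q *v x + - (transpose Q *v b)) + b = x"
    by (simp only: add_uminus_conv_diff matrix_vector_mult_diff_distrib *) simp
  show "transpose Q *v (Q *v x + b) + - (transpose Q *v b) = x"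
    by (simp only: matrix_vector_right_distrib *) simp
qed

lemma zariski_closure_affine_image:
  assumes Q: "orthogonal_matrix (Q :: real^3^3)"
  shows "zariski_closure ((\<lambda>x. Q *v x + b) ` X) = (\<lambda>x. Q *v x + b) ` zariski_closure X"
proof -
  define f where "f = (\<lambda>x. Q *v x + b)"
  define g where "g = (\<lambda>x. transpose Q *v x + - (transpose Q *v b))"
  have fg: "f (g x) = x" "g (f x) = x" for x
    using orthogonal_affine_inverse[OF Q] by (simp_all add: f_def g_def)
  have poly: "real_polynomial_function (\<lambda>x. F (f x))" "real_polynomial_function (\<lambda>x. F (g x))"
    if "real_polynomial_function F" for F
    unfolding f_def g_def by (rule real_polynomial_affine[OF that])+
  have "zariski_closure (f ` X) = f ` zariski_closure X"
  proof (intro subset_antisym subsetI)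
    fix y assume y: "y \<in> zariski_closure (f ` X)"
    have "g y \<in> zariski_closure X"
      unfolding zariski_closure_def
    proof (intro CollectI allI impI)
      fix p assume p: "real_polynomial_function p" "\<forall>y\<in>X. p y = 0"
      then have "\<forall>z\<in>f ` X. p (g z) = 0" by (auto simp: fg)
      then show "p (g y) = 0" using y poly(2)[OF p(1)] by (auto simp: zariski_closure_def)
    qed
    then show "y \<in> f ` zariski_closure X" by (metis fg(1) imageI)
  next
    fix y assume "y \<in> f ` zariski_closure X"
    then obtain x where x: "x \<in> zariski_closure X" "y = f x" by blast
    show "y \<in> zariski_closure (f ` X)"
      unfolding zariski_closure_def
    proof (intro CollectI allI impI)
      fix p assume p: "real_polynomial_function p" "\<forall>y\<in>f ` X. p y = 0"
      then show "p y = 0" using x poly(1)[OF p(1)] by (auto simp: zariski_closure_def)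
    qed
  qed
  then show ?thesis by (simp add: f_def)
qed

section \<open>Straight spine curves\<close>

text \<open>
  The quotient has derivative zero on an interval that contains no zero of \<open>g\<close>.
\<close>

lemma proportional_polys:
  assumes "cleared_deriv g f = 0" "g \<noteq> 0"
  obtains k where "f = smult k g"
proof -
  define M where "M = Max (insert 0 {t. poly g t = 0})"
  have fin: "finite {t. poly g t = 0}" using assms(2) by (rule poly_roots_finite)
  have nz: "poly g t \<noteq> 0" if "t > M" for t
  proof
    assume "poly g t = 0"
    then have "t \<le> M" unfolding M_def using fin by (intro Max_ge) auto
    with that show False by simp
  qed
  have "\<exists>k. \<forall>t\<in>{M<..}. poly f t / poly g t = k"
  proof (rule has_field_derivative_zero_constant)
    show "((\<lambda>t. poly f t / poly g t) has_field_derivative 0) (at t within {M<..})" if "t \<in> {M<..}" for t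
    proof -
      have "poly g t \<noteq> 0" using nz that by simp
      from rational_function_has_real_derivative[OF this, of f] assms(1)
      have "((\<lambda>t. poly f t / poly g t) has_real_derivative 0) (at t)" by simp
      then show ?thesis by (rule has_field_derivative_at_within)
    qed
  qed simp
  then obtain k where k: "\<And>t. t > M \<Longrightarrow> poly f t / poly g t = k" by auto
  have "{M<..} \<subseteq> {t. poly (f - smult k g) t = 0}"
    using k nz by (auto simp: field_simps)
  then have "infinite {t. poly (f - smult k g) t = 0}" using infinite_Ioi infinite_super by blast
  then have "f - smult k g = 0" using poly_roots_finite by blast
  then show thesis using that by simp
qed

text \<open>
  If \<open>T\<close> and \<open>T'\<close> are parallel, then the quotients of the components of \<open>T\<close> have derivative zero, so that
  \<open>T\<close> has a constant direction \<open>u\<close>; integrating once more, the centre moves on a line.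
\<close>

lemma (in canal_family) straight_spine:
  assumes "\<And>t. T t \<times> T' t = 0"
  obtains u v where "u \<noteq> 0" "\<And>t. poly w t \<noteq> 0 \<Longrightarrow> (center t - v) \<times> u = 0"
proof -
  define q where "q = (\<lambda>i. cleared_deriv w (C $ i))"
  have T: "T t $ i = poly (q i) t" "T' t $ i = poly (pderiv (q i)) t" for t i
    by (simp_all add: T_def T'_def q_def)
  have comp: "poly (q i) t * poly (pderiv (q j)) t = poly (q j) t * poly (pderiv (q i)) t" for i j t
    using assms[of t] exhaust_3[of i] exhaust_3[of j]
    by (auto simp: vec_eq_iff forall_3 cross_components T)
  then have q_prop: "cleared_deriv (q k) (q j) = 0" for j k
    using comp[where i = j and j = k] by (intro poly_eq_poly_eq_iff[THEN iffD1] ext) (simp add: cleared_deriv_def mult.commute)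
  obtain s where "poly w s \<noteq> 0" using w_nonzero by (metis poly_all_0_iff_0)
  then have "T s \<noteq> 0" by (rule T_nonzero)
  then obtain k where "T s $ k \<noteq> 0" by (auto simp: vec_eq_iff)
  then have k: "q k \<noteq> 0" by (auto simp: T)
  have "\<exists>\<kappa>. q j = smult \<kappa> (q k)" for j
    by (rule proportional_polys[OF q_prop k]) blast
  then obtain \<kappa> where \<kappa>: "\<And>j. q j = smult (\<kappa> j) (q k)" by metis
  have "\<kappa> k = 1"
  proof -
    have "smult (\<kappa> k - 1) (q k) = 0" using \<kappa>[of k] by (simp add: smult_diff_left)
    then show ?thesis using k by simp
  qed
  have "\<exists>\<mu>. C $ j - smult (\<kappa> j) (C $ k) = smult \<mu> w" for j
  proof -
    have "cleared_deriv w (C $ j - smult (\<kappa> j) (C $ k)) = q j - smult (\<kappa> j) (q k)"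
      by (simp add: q_def cleared_deriv_def pderiv_diff pderiv_smult algebra_simps smult_diff_right)
    also have "\<dots> = 0" using \<kappa>[of j] by simp
    finally show ?thesis by (rule proportional_polys[OF _ w_nonzero]) blast
  qed
  then obtain \<mu> where \<mu>: "\<And>j. C $ j - smult (\<kappa> j) (C $ k) = smult (\<mu> j) w" by metis
  show thesis
  proof (rule that[of "\<chi> j. \<kappa> j" "\<chi> j. \<mu> j"])
    show "(\<chi> j. \<kappa> j) \<noteq> (0 :: real^3)" using \<open>\<kappa> k = 1\<close> by (auto simp: vec_eq_iff intro!: exI[of _ k])
    fix t assume t: "poly w t \<noteq> 0"
    have "center t - (\<chi> j. \<mu> j) = center t $ k *\<^sub>R (\<chi> j. \<kappa> j)"
      unfolding vec_eq_iff
    proof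
      fix j
      have "poly (C $ j) t = \<kappa> j * poly (C $ k) t + \<mu> j * poly w t"
        using arg_cong[OF \<mu>[of j], of "\<lambda>p. poly p t"] by simp
      then show "(center t - (\<chi> j. \<mu> j)) $ j = (center t $ k *\<^sub>R (\<chi> j. \<kappa> j)) $ j"
        using t by (simp add: center_def add_divide_distrib)
    qed
    then show "(center t - (\<chi> j. \<mu> j)) \<times> (\<chi> j. \<kappa> j) = 0" by (simp add: cross_mult_left)
  qed
qed

lemma represents_curved:
  assumes rep: "represents c r w C R" and fam: "canal_family w C R"
    and nc: "\<not> collinear (curve_image c)"
  shows "\<exists>t. canal_family.T w C t \<times> canal_family.T' w C t \<noteq> 0"
proof (rule ccontr)
  interpret canal_family w C R by (rule fam)
  assume "\<not> (\<exists>t. T t \<times> T' t \<noteq> 0)"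
  then have "\<And>t. T t \<times> T' t = 0" by blast
  then obtain u v where uv: "u \<noteq> 0" "\<And>t. poly w t \<noteq> 0 \<Longrightarrow> (center t - v) \<times> u = 0"
    by (rule straight_spine) blast
  have "((y - v) \<times> u) $ i = 0" if y: "y \<in> curve_image c" for y i
  proof -
    obtain t where t: "curve_defined_at c t" "y = curve_at c t" using y by (auto simp: curve_image_def)
    have "((curve_at c t - v) \<times> u) $ i = 0"
    proof (rule curve_zero[OF _ _ t(1)])
      show "real_polynomial_function (\<lambda>y. ((y - v) \<times> u) $ i)"
        by (rule real_polynomial_function_cross3)
          (simp_all add: polyfun_intros)
      have "infinite {t. poly w t \<noteq> 0}" using cofinite_w by (rule cofinite_imp_infinite)
      then show "infinite {t. curve_defined_at c t \<and> ((curve_at c t - v) \<times> u) $ i = 0}"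
        by (rule infinite_super[rotated]) (use rep uv(2) in \<open>auto simp: represents_def center_def\<close>)
    qed
    then show ?thesis by (simp add: t(2))
  qed
  then have cr: "(y - v) \<times> u = 0" if "y \<in> curve_image c" for y using that by (simp add: vec_eq_iff)
  have line: "y - v = (((y - v) \<bullet> u) / (u \<bullet> u)) *\<^sub>R u" if "y \<in> curve_image c" for y
  proof -
    have "(u \<bullet> u) *\<^sub>R (y - v) = ((y - v) \<bullet> u) *\<^sub>R u"
      using cross_triple_expand[of u "y - v"] cr[OF that] by simp
    moreover have "y - v = (1 / (u \<bullet> u)) *\<^sub>R ((u \<bullet> u) *\<^sub>R (y - v))" using uv(1) by simp
    ultimately show ?thesis by simp
  qed
  have "collinear (curve_image c)"
    unfolding collinear_def
  proof (intro exI ballI)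
    fix x y assume "x \<in> curve_image c" "y \<in> curve_image c"
    from line[OF this(1)] line[OF this(2)]
    have "x - y = (((x - v) \<bullet> u) / (u \<bullet> u)) *\<^sub>R u - (((y - v) \<bullet> u) / (u \<bullet> u)) *\<^sub>R u"
      by (metis diff_diff_eq2 diff_add_cancel add_diff_cancel_right)
    then show "x - y = (((x - v) \<bullet> u) / (u \<bullet> u) - ((y - v) \<bullet> u) / (u \<bullet> u)) *\<^sub>R u"
      by (simp add: scaleR_diff_left)
  qed
  with nc show False by blast
qed

section \<open>Isometric images of canal surfaces\<close>

lemma orthogonal_matrix_inner:
  assumes "orthogonal_matrix (Q :: real^3^3)"
  shows "(Q *v x) \<bullet> (Q *v y) = x \<bullet> y"
proof -
  have "(Q *v x) \<bullet> (Q *v y) = ((Q *v x) v* Q) \<bullet> y" by (simp add: dot_lmul_matrix)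
  also have "(Q *v x) v* Q = transpose Q *v (Q *v x)" by simp
  also have "\<dots> = x" using assms by (simp only: matrix_vector_mul_assoc orthogonal_matrix_def matrix_vector_mul_lid)
  finally show ?thesis .
qed

lemma isometric_image:
  fixes b :: "real^3"
  assumes Q: "orthogonal_matrix Q" and fam: "sphere_family c r"
  defines "c2 \<equiv> affine_image_curve Q b c"
  shows "curve_defined_at c2 t \<longleftrightarrow> curve_defined_at c t"
    and "curve_defined_at c t \<Longrightarrow> curve_at c2 t = Q *v curve_at c t + b"
    and "sphere_family c2 r"
    and "canal_surface c2 r = (\<lambda>x. Q *v x + b) ` canal_surface c r"
    and "spine_curve c2 = (\<lambda>x. Q *v x + b) ` spine_curve c"
proof -
  have val: "curve_value c2 t (Q *v y + b)" if "curve_value c t y" for t y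
    unfolding c2_def using that by (rule curve_value_affine)
  have val': "curve_value c t (transpose Q *v y + - (transpose Q *v b))" if "curve_value c2 t y" for t y
    using curve_value_affine[OF that, of "transpose Q" "- (transpose Q *v b)"] affine_image_inverse[OF Q, of b c]
    by (simp add: c2_def)
  show d: "curve_defined_at c2 t \<longleftrightarrow> curve_defined_at c t" for t
    using val[of t "curve_at c t"] val'[of t "curve_at c2 t"] by (auto simp: curve_value_iff)
  show a: "curve_at c2 t = Q *v curve_at c t + b" if "curve_defined_at c t" for t
    using val[of t "curve_at c t"] that by (simp add: curve_value_iff)
  obtain w C R where rep: "represents c r w C R" by (rule representation_exists)
  have der: "vector_derivative (curve_at c2) (at t) = Q *v vector_derivative (curve_at c) (at t)"
    if t: "curve_defined_at c t" "ratfun_defined_at r t" for t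
  proof -
    have wt: "poly w t \<noteq> 0" using rep t by (simp add: represents_def)
    note D = represents_derivatives(1)[OF rep wt]
    have "((\<lambda>s. Q *v curve_at c s + b) has_vector_derivative
        Q *v ((1 / (poly w t)\<^sup>2) *\<^sub>R poly_vec (\<chi> i. cleared_deriv w (C $ i)) t)) (at t)"
      using bounded_linear.has_vector_derivative[OF matrix_vector_mul_bounded_linear D]
      by (simp only: has_vector_derivative_add_const)
    moreover have "open {s. poly w s \<noteq> 0}" by (intro open_Collect_neq continuous_intros)
    ultimately have "(curve_at c2 has_vector_derivative
        Q *v ((1 / (poly w t)\<^sup>2) *\<^sub>R poly_vec (\<chi> i. cleared_deriv w (C $ i)) t)) (at t)"
      by (rule has_vector_derivative_transform_within_open) (use wt rep a in \<open>auto simp: represents_def\<close>)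
    then show ?thesis unfolding vector_derivative_at[OF D] by (rule vector_derivative_at)
  qed
  have normQ: "norm (Q *v x) = norm x" for x
    using orthogonal_matrix_inner[OF Q, of x x] by (simp add: norm_eq_sqrt_inner)
  show "sphere_family c2 r"
    using fam unfolding sphere_family_def by (simp add: d der normQ)
  have circ: "char_circle c2 r t = (\<lambda>x. Q *v x + b) ` char_circle c r t"
    if t: "curve_defined_at c t" "ratfun_defined_at r t" for t
  proof -
    have *: "Q *v x + b \<in> char_circle c2 r t \<longleftrightarrow> x \<in> char_circle c r t" for x
    proof -
      have "Q *v x + b - curve_at c2 t = Q *v (x - curve_at c t)"
        by (simp add: a[OF t(1)] matrix_vector_mult_diff_distrib)
      then show ?thesis
        by (simp only: char_circle_def mem_Collect_eq der[OF t] normQ orthogonal_matrix_inner[OF Q])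
    qed
    show ?thesis
    proof (intro subset_antisym subsetI)
      fix y assume "y \<in> char_circle c2 r t"
      then have "transpose Q *v y + - (transpose Q *v b) \<in> char_circle c r t"
        using *[of "transpose Q *v y + - (transpose Q *v b)"] orthogonal_affine_inverse(1)[OF Q] by simp
      then show "y \<in> (\<lambda>x. Q *v x + b) ` char_circle c r t"
        using orthogonal_affine_inverse(1)[OF Q, of y b] by (metis imageI)
    qed (use * in auto)
  qed
  have "(\<Union>t\<in>{t. curve_defined_at c2 t \<and> ratfun_defined_at r t}. char_circle c2 r t) =
      (\<lambda>x. Q *v x + b) ` (\<Union>t\<in>{t. curve_defined_at c t \<and> ratfun_defined_at r t}. char_circle c r t)"
    using circ by (auto simp: d)
  then show "canal_surface c2 r = (\<lambda>x. Q *v x + b) ` canal_surface c r"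
    by (simp add: canal_surface_def zariski_closure_affine_image[OF Q])
  have "curve_image c2 = (\<lambda>x. Q *v x + b) ` curve_image c"
    by (auto simp: curve_image_def d a)
  then show "spine_curve c2 = (\<lambda>x. Q *v x + b) ` spine_curve c"
    by (simp add: spine_curve_def zariski_closure_affine_image[OF Q])
qed

section \<open>Changes of parameter on the spine curve\<close>

text \<open>
  Equality of spine curves in the form in which it is used: polynomial identities transfer from one
  curve to the other.
\<close>

lemma spine_zero:
  assumes "spine_curve c = spine_curve c'" "real_polynomial_function F"
    and "infinite {t. curve_defined_at c t \<and> F (curve_at c t) = 0}" "curve_defined_at c' t"
  shows "F (curve_at c' t) = 0"
proof -
  have "\<forall>x\<in>curve_image c. F x = 0" using curve_zero[OF assms(2,3)] by (auto simp: curve_image_def)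
  then have "\<forall>x\<in>spine_curve c'. F x = 0"
    using vanishing_on_zariski_closure[OF assms(2)] assms(1) by (metis spine_curve_def)
  then have "\<forall>x\<in>curve_image c'. F x = 0"
    using vanishing_on_zariski_closure[OF assms(2)] by (simp add: spine_curve_def)
  then show ?thesis using assms(4) by (simp add: curve_image_def)
qed

lemma spine_nonzero:
  assumes "spine_curve c = spine_curve c'" "real_polynomial_function F"
    and "\<forall>\<^sub>F t in cofinite. F (curve_at c t) \<noteq> 0"
  shows "\<forall>\<^sub>F t in cofinite. F (curve_at c' t) \<noteq> 0"
proof (rule ccontr)
  assume "\<not> (\<forall>\<^sub>F t in cofinite. F (curve_at c' t) \<noteq> 0)"
  then have inf: "infinite {t. F (curve_at c' t) = 0}" by (simp add: eventually_cofinite)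
  have "infinite ({t. F (curve_at c' t) = 0} - {t. \<not> curve_defined_at c' t})"
    using inf cofinite_curve_defined[of c'] by (intro Diff_infinite_finite) (auto simp: eventually_cofinite)
  then have inf': "infinite {t. curve_defined_at c' t \<and> F (curve_at c' t) = 0}"
    by (rule infinite_super[rotated]) auto
  have "\<forall>\<^sub>F t :: real in cofinite. False"
    using assms(3) cofinite_curve_defined[of c]
    by eventually_elim (use spine_zero[OF assms(1)[symmetric] assms(2) inf'] in blast)
  then show False using cofinite_imp_infinite by fastforce
qed

text \<open>
  The identity \<open>c (P y / D y) = y\<close> holds at the points of \<open>c\<close>, hence, with denominators cleared, on the
  spine curve, hence at the points of \<open>c'\<close>. The cleared denominator does not vanish identically along
  \<open>c'\<close>, because it does not along \<open>c\<close>.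
\<close>

lemma spine_parameter_change:
  assumes spine: "spine_curve c = spine_curve c'"
    and P: "real_polynomial_function P" and D: "real_polynomial_function D"
    and proper: "\<forall>\<^sub>F t in cofinite. curve_defined_at c t \<and> D (curve_at c t) \<noteq> 0 \<and> P (curve_at c t) / D (curve_at c t) = t"
  obtains \<phi> where "\<forall>\<^sub>F t in cofinite. ratfun_value \<phi> t (P (curve_at c' t) / D (curve_at c' t)) \<and>
     curve_value c (P (curve_at c' t) / D (curve_at c' t)) (curve_at c' t)"
proof -
  obtain hP where hP: "\<And>t. curve_defined_at c' t \<Longrightarrow> ratfun_value hP t (P (curve_at c' t))"
    using polynomial_along_curve[OF P] by blast
  obtain hD where hD: "\<And>t. curve_defined_at c' t \<Longrightarrow> ratfun_value hD t (D (curve_at c' t))"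
    using polynomial_along_curve[OF D] by blast
  obtain w C R where rep: "represents c 0 w C R" by (rule representation_exists)
  have def0: "ratfun_defined_at 0 t" for t by (simp add: ratfun_defined_at_def)
  have wdef: "poly w t \<noteq> 0 \<longleftrightarrow> curve_defined_at c t" for t using rep def0 by (simp add: represents_def)
  have cat: "curve_at c t = (1 / poly w t) *\<^sub>R poly_vec C t" if "poly w t \<noteq> 0" for t
    using rep that by (simp add: represents_def)
  define m where "m = degree w + (\<Sum>i\<in>UNIV. degree (C $ i))"
  have Cm: "degree (C $ i) \<le> m" for i
    using member_le_sum[of i UNIV "\<lambda>i. degree (C $ i)"] by (simp add: m_def)
  obtain Wh where Wh: "real_polynomial_function Wh" "\<And>y s. P y = s * D y \<Longrightarrow> Wh y = D y ^ m * poly w s"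
    by (rule homogenized_substitution[OF P D, of w m]) (simp_all add: m_def)
  have "\<exists>G. real_polynomial_function G \<and> (\<forall>y s. P y = s * D y \<longrightarrow> G y = D y ^ m * poly (C $ i) s)" for i
    by (rule homogenized_substitution[OF P D Cm[of i]]) blast
  then obtain Ch where Ch: "\<And>i. real_polynomial_function (Ch i)"
    "\<And>i y s. P y = s * D y \<Longrightarrow> Ch i y = D y ^ m * poly (C $ i) s" by metis
  have PD: "\<forall>\<^sub>F t in cofinite. curve_defined_at c t \<and> D (curve_at c t) \<noteq> 0 \<and> P (curve_at c t) = t * D (curve_at c t)"
    using proper by eventually_elim (auto simp: field_simps)
  have Dc': "\<forall>\<^sub>F t in cofinite. D (curve_at c' t) \<noteq> 0"
    by (rule spine_nonzero[OF spine D], use PD in eventually_elim) simp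
  have Whc': "\<forall>\<^sub>F t in cofinite. Wh (curve_at c' t) \<noteq> 0"
    by (rule spine_nonzero[OF spine Wh(1)], use PD in eventually_elim) (simp add: Wh(2) wdef)
  have eq: "Wh (curve_at c' t) * curve_at c' t $ i - Ch i (curve_at c' t) = 0" if "curve_defined_at c' t" for t i
  proof (rule spine_zero[OF spine _ _ that])
    show "real_polynomial_function (\<lambda>y. Wh y * y $ i - Ch i y)" by (intro polyfun_intros Wh(1) Ch(1))
    have "\<forall>\<^sub>F t in cofinite. curve_defined_at c t \<and> Wh (curve_at c t) * curve_at c t $ i - Ch i (curve_at c t) = 0"
      using PD
    proof eventually_elim
      case (elim t)
      then have t: "poly w t \<noteq> 0" "P (curve_at c t) = t * D (curve_at c t)" by (simp_all add: wdef)
      have "poly w t * curve_at c t $ i = poly (C $ i) t" using cat[OF t(1)] t(1) by simp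
      then show ?case using elim by (simp add: Wh(2)[OF t(2)] Ch(2)[OF t(2)] mult.assoc)
    qed
    then show "infinite {t. curve_defined_at c t \<and> Wh (curve_at c t) * curve_at c t $ i - Ch i (curve_at c t) = 0}"
      by (rule cofinite_imp_infinite)
  qed
  show thesis
  proof (rule that[of "hP / hD"])
    show "\<forall>\<^sub>F t in cofinite. ratfun_value (hP / hD) t (P (curve_at c' t) / D (curve_at c' t)) \<and>
     curve_value c (P (curve_at c' t) / D (curve_at c' t)) (curve_at c' t)"
      using Dc' Whc' cofinite_curve_defined[of c']
    proof eventually_elim
      case (elim t)
      define s where "s = P (curve_at c' t) / D (curve_at c' t)"
      have s: "P (curve_at c' t) = s * D (curve_at c' t)" using elim by (simp add: s_def)
      have ws: "poly w s \<noteq> 0" using elim(2) by (auto simp: Wh(2)[OF s])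
      have "D (curve_at c' t) ^ m * (poly w s * curve_at c' t $ i) = D (curve_at c' t) ^ m * poly (C $ i) s" for i
        using eq[OF elim(3), of i] by (simp add: Wh(2)[OF s] Ch(2)[OF s] mult.assoc)
      then have "poly w s * curve_at c' t $ i = poly (C $ i) s" for i using elim(1) by simp
      then have "curve_at c s = curve_at c' t"
        using ws by (simp add: cat vec_eq_iff field_simps)
      then have "curve_value c s (curve_at c' t)" using ws by (simp add: curve_value_iff wdef)
      moreover have "ratfun_value (hP / hD) t s"
        unfolding s_def by (rule ratfun_value_divide[OF hP[OF elim(3)] hD[OF elim(3)] elim(1)])
      ultimately show ?case by (simp add: s_def)
    qed
  qed
qed

section \<open>Rational functions with a rational left inverse\<close>

text \<open>
  The numerator of \<open>g (p / q)\<close> over the denominator \<open>q ^ k\<close>.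
\<close>

definition homogenization :: "nat \<Rightarrow> real poly \<Rightarrow> real poly \<Rightarrow> real poly \<Rightarrow> real poly" where
  "homogenization k g p q = (\<Sum>i\<le>k. smult (coeff g i) (p ^ i * q ^ (k - i)))"

lemma poly_homogenization:
  assumes "degree g \<le> k" "poly q t \<noteq> 0"
  shows "poly (homogenization k g p q) t = poly q t ^ k * poly g (poly p t / poly q t)"
proof -
  have "poly (homogenization k g p q) t = (\<Sum>i\<le>k. coeff g i * (poly p t ^ i * poly q t ^ (k - i)))"
    by (simp add: homogenization_def poly_sum)
  also have "\<dots> = (\<Sum>i\<le>k. poly q t ^ k * (coeff g i * (poly p t / poly q t) ^ i))"
  proof (rule sum.cong)
    fix i assume "i \<in> {..k}"
    then have "poly q t ^ k = poly q t ^ i * poly q t ^ (k - i)" by (simp flip: power_add)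
    then show "coeff g i * (poly p t ^ i * poly q t ^ (k - i)) = poly q t ^ k * (coeff g i * (poly p t / poly q t) ^ i)"
      using assms(2) by (simp add: power_divide)
  qed simp
  also have "\<dots> = poly q t ^ k * poly g (poly p t / poly q t)"
    using arg_cong[OF poly_as_sum_of_monoms'[OF assms(1)], of "\<lambda>h. poly h (poly p t / poly q t)"]
    by (simp add: sum_distrib_left[symmetric] poly_sum poly_monom)
  finally show ?thesis .
qed

lemma homogenization_mod:
  "\<exists>h. homogenization k g p q = smult (coeff g k) (p ^ k) + q * h"
proof -
  have "homogenization k g p q = (\<Sum>i<k. smult (coeff g i) (p ^ i * q ^ (k - i))) + smult (coeff g k) (p ^ k)"
    by (simp add: homogenization_def lessThan_Suc_atMost[symmetric])
  also have "(\<Sum>i<k. smult (coeff g i) (p ^ i * q ^ (k - i))) = q * (\<Sum>i<k. smult (coeff g i) (p ^ i * q ^ (k - i - 1)))"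
    unfolding sum_distrib_left
  proof (rule sum.cong)
    fix i assume "i \<in> {..<k}"
    then have "k - i = Suc (k - i - 1)" by simp
    then have "q ^ (k - i) = q * q ^ (k - i - 1)" by (metis power_Suc)
    then show "smult (coeff g i) (p ^ i * q ^ (k - i)) = q * smult (coeff g i) (p ^ i * q ^ (k - i - 1))"
      by (simp add: mult.left_commute)
  qed simp
  finally show ?thesis
    by (intro exI[of _ "\<Sum>i<k. smult (coeff g i) (p ^ i * q ^ (k - i - 1))"]) (simp only: add.commute)
qed

lemma poly_eq_cofinite:
  fixes f g :: "real poly"
  assumes "\<forall>\<^sub>F t in cofinite. poly f t = poly g t"
  shows "f = g"
proof -
  have "infinite {t. poly f t = poly g t}" using assms by (rule cofinite_imp_infinite)
  then have "infinite {t. poly (f - g) t = 0}" by simp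
  then have "f - g = 0" using poly_roots_finite by blast
  then show ?thesis by simp
qed

text \<open>
  The terms of degree \<open>2 * n - 1\<close> cancel. The bound is the degree of the ramification divisor of a
  rational function of degree \<open>n\<close>; with a larger one, the homogenized chain rule would contain
  additional powers of the denominator.
\<close>

lemma degree_wronskian:
  assumes "degree u \<le> n" "degree v \<le> n" "1 \<le> n"
  shows "degree (cleared_deriv v (u :: real poly)) \<le> 2 * n - 2"
proof -
  have less: "degree (cleared_deriv v u) \<le> 2 * n - 2" if "degree u + degree v \<le> 2 * n - 1" for u v :: "real poly"
  proof -
    have *: "degree (pderiv u * v) \<le> 2 * n - 2" if "degree u + degree v \<le> 2 * n - 1" for u v :: "real poly"
    proof (cases "degree u = 0")
      case True
      then have "pderiv u = 0" by (simp add: pderiv_eq_0_iff)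
      then show ?thesis by simp
    next
      case False
      then show ?thesis using degree_mult_le[of "pderiv u" v] that by (simp add: degree_pderiv)
    qed
    show ?thesis unfolding cleared_deriv_def
      using *[of u v] *[of v u] that by (intro degree_diff_le) (simp_all add: mult.commute add.commute)
  qed
  show ?thesis
  proof (cases "degree u = n \<and> degree v = n")
    case False
    then have "degree u + degree v \<le> 2 * n - 1" using assms by linarith
    then show ?thesis by (rule less)
  next
    case True
    \<comment> \<open>The leading terms cancel: subtract a multiple of \<open>v\<close> from \<open>u\<close>.\<close>
    define k where "k = lead_coeff u / lead_coeff v"
    define \<rho> where "\<rho> = u - smult k v"
    have "v \<noteq> 0" using True assms(3) by auto
    then have v0: "lead_coeff v \<noteq> 0" by simp
    have "degree \<rho> \<le> n" unfolding \<rho>_def using True by (intro degree_diff_le) (auto intro: order_trans[OF degree_smult_le])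
    moreover have "coeff \<rho> n = 0" using True v0 by (simp add: \<rho>_def k_def)
    ultimately have "degree \<rho> < n \<or> \<rho> = 0"
      by (metis leading_coeff_0_iff nat_less_le)
    then have "degree \<rho> + degree v \<le> 2 * n - 1" using True assms by auto
    moreover have "cleared_deriv v u = cleared_deriv v \<rho>"
      by (simp add: cleared_deriv_def \<rho>_def pderiv_diff pderiv_smult algebra_simps smult_diff_right)
    ultimately show ?thesis using less by simp
  qed
qed

lemma unit_polyD: "is_unit (p :: real poly) \<Longrightarrow> \<exists>k. k \<noteq> 0 \<and> p = [:k:]"
  by (auto simp: is_unit_poly_iff)

text \<open>
  Let \<open>\<phi> = p / q\<close> and \<open>\<psi> = u / v\<close> with \<open>\<psi> (\<phi> t) = t\<close>. The homogenized denominator \<open>Vh\<close> of \<open>\<psi> \<circ> \<phi>\<close> is a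
  constant: it divides a power of \<open>q\<close> and is coprime to \<open>q\<close>. By the chain rule the Wronskian \<open>W\<close> of \<open>p\<close>
  and \<open>q\<close> divides \<open>Vh\<^sup>2\<close>, so it is a constant, too. Then \<open>p'' q = p q''\<close>, and as \<open>p\<close> and \<open>q\<close> are
  coprime, \<open>p\<close> divides \<open>p''\<close> and \<open>q\<close> divides \<open>q''\<close>, which is possible for degree at most one only.
\<close>

lemma left_invertible_rational_function_degree:
  fixes p q u v :: "real poly"
  assumes pq: "coprime p q" "q \<noteq> 0" and uv: "coprime u v"
    and inverse: "\<forall>\<^sub>F t in cofinite. poly u (poly p t / poly q t) = t * poly v (poly p t / poly q t)"
  shows "degree p \<le> 1 \<and> degree q \<le> 1"
proof -
  define n where "n = max (degree u) (degree v)"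
  have un: "degree u \<le> n" and vn: "degree v \<le> n" by (auto simp: n_def)
  define Uh where "Uh = homogenization n u p q"
  define Vh where "Vh = homogenization n v p q"
  have cq: "\<forall>\<^sub>F t in cofinite. poly q t \<noteq> 0"
    using pq(2) by (simp add: eventually_cofinite poly_roots_finite)
  have UV: "Uh = [:0, 1:] * Vh"
    by (rule poly_eq_cofinite, use inverse cq in eventually_elim)
      (simp add: Uh_def Vh_def poly_homogenization un vn)
  have n: "1 \<le> n"
  proof (rule ccontr)
    assume "\<not> 1 \<le> n"
    then have "degree u = 0" "degree v = 0" by (auto simp: n_def)
    then obtain a b where ab: "u = [:a:]" "v = [:b:]" by (metis degree_eq_zeroE)
    have "[:a:] = [:0, b:]"
      by (rule poly_eq_cofinite, use inverse in eventually_elim) (simp add: ab)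
    then have "u = 0" "v = 0" using ab by auto
    then show False using uv by simp
  qed
  \<comment> \<open>The Bezout identity of \<open>u\<close> and \<open>v\<close> shows that \<open>Vh\<close> divides a power of \<open>q\<close>.\<close>
  define a where "a = fst (bezout_coefficients u v)"
  define b where "b = snd (bezout_coefficients u v)"
  have ab: "a * u + b * v = 1"
    using bezout_coefficients_fst_snd[of u v] uv by (simp add: a_def b_def coprime_iff_gcd_eq_1)
  define N where "N = max (degree a) (degree b)"
  have "homogenization N a p q * Uh + homogenization N b p q * Vh = q ^ (N + n)"
  proof (rule poly_eq_cofinite, use cq in eventually_elim)
    case (elim t)
    define s where "s = poly p t / poly q t"
    have "poly a s * poly u s + poly b s * poly v s = 1"
      using arg_cong[OF ab, of "\<lambda>h. poly h s"] by simp
    moreover have "poly (homogenization N a p q * Uh + homogenization N b p q * Vh) t =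
        poly q t ^ (N + n) * (poly a s * poly u s + poly b s * poly v s)"
      using elim un vn by (simp add: Uh_def Vh_def poly_homogenization N_def s_def power_add algebra_simps)
    ultimately show ?case by simp
  qed
  then have "(homogenization N a p q * [:0, 1:] + homogenization N b p q) * Vh = q ^ (N + n)"
    unfolding UV by (simp only: algebra_simps)
  then have dvd: "Vh dvd q ^ (N + n)" by (metis dvd_triv_right)
  have "coprime Vh q"
  proof (rule coprimeI)
    fix g assume g: "g dvd Vh" "g dvd q"
    have "g dvd Uh" unfolding UV using g(1) by (rule dvd_mult)
    obtain h where h: "Vh = smult (coeff v n) (p ^ n) + q * h" using homogenization_mod Vh_def by blast
    obtain h' where h': "Uh = smult (coeff u n) (p ^ n) + q * h'" using homogenization_mod Uh_def by blast
    have "g dvd smult (coeff v n) (p ^ n)" using g h by (metis dvd_add_left_iff dvd_mult2)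
    moreover have "g dvd smult (coeff u n) (p ^ n)" using \<open>g dvd Uh\<close> g(2) h' by (metis dvd_add_left_iff dvd_mult2)
    moreover have "coeff v n \<noteq> 0 \<or> coeff u n \<noteq> 0"
    proof -
      have "degree u = n \<or> degree v = n" by (auto simp: n_def)
      moreover have "u \<noteq> 0" if "degree u = n" using n that by auto
      moreover have "v \<noteq> 0" if "degree v = n" using n that by auto
      ultimately show ?thesis by (metis leading_coeff_0_iff)
    qed
    ultimately have "g dvd p ^ n" by (auto simp: dvd_smult_iff)
    moreover have "coprime (p ^ n) q" using pq(1) by simp
    ultimately show "is_unit g" using g(2) coprime_common_divisor by blast
  qed
  then have "is_unit Vh" using dvd by (metis coprime_common_divisor coprime_power_right_iff dvd_refl)
  then obtain \<kappa> where \<kappa>: "\<kappa> \<noteq> 0" "Vh = [:\<kappa>:]" using unit_polyD by blast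
  \<comment> \<open>Differentiating \<open>\<psi>(\<phi>(t)) = t\<close> shows that the Wronskian of \<open>p\<close> and \<open>q\<close> divides \<open>Vh\<^sup>2\<close>.\<close>
  define W where "W = cleared_deriv q p"
  have "homogenization (2 * n - 2) (cleared_deriv v u) p q * W = Vh\<^sup>2"
  proof (rule poly_eq_cofinite, use cq in eventually_elim)
    case (elim t)
    define \<phi> where "\<phi> = (\<lambda>t. poly p t / poly q t)"
    have d\<phi>: "(\<phi> has_real_derivative poly W t / (poly q t)\<^sup>2) (at t)"
      unfolding \<phi>_def W_def by (rule rational_function_has_real_derivative[OF elim])
    have zero: "poly u (\<phi> s) - s * poly v (\<phi> s) = 0" if "poly q s \<noteq> 0" for s
    proof -
      have "poly Uh s = s * poly Vh s" unfolding UV by simp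
      then show ?thesis using that un vn by (simp add: Uh_def Vh_def poly_homogenization \<phi>_def)
    qed
    have "((\<lambda>s. poly u (\<phi> s) - s * poly v (\<phi> s)) has_real_derivative
       poly (pderiv u) (\<phi> t) * (poly W t / (poly q t)\<^sup>2) -
       (t * (poly (pderiv v) (\<phi> t) * (poly W t / (poly q t)\<^sup>2)) + 1 * poly v (\<phi> t))) (at t)"
      by (rule DERIV_diff[OF DERIV_chain2[OF poly_DERIV d\<phi>]
          DERIV_mult'[OF DERIV_ident DERIV_chain2[OF poly_DERIV d\<phi>]]])
    then have "poly (pderiv u) (\<phi> t) * (poly W t / (poly q t)\<^sup>2) -
       (t * (poly (pderiv v) (\<phi> t) * (poly W t / (poly q t)\<^sup>2)) + 1 * poly v (\<phi> t)) = 0"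
    proof (rule derivative_of_vanishing)
      have "eventually (\<lambda>s. s \<in> {s. poly q s \<noteq> 0}) (nhds t)"
        using elim by (intro eventually_nhds_in_open open_Collect_neq continuous_intros) simp
      then show "eventually (\<lambda>s. poly u (\<phi> s) - s * poly v (\<phi> s) = 0) (nhds t)"
        by eventually_elim (use zero in simp)
    qed
    then have e: "(poly (pderiv u) (\<phi> t) - t * poly (pderiv v) (\<phi> t)) * (poly W t / (poly q t)\<^sup>2) = poly v (\<phi> t)"
      by (simp add: algebra_simps)
    have "poly (cleared_deriv v u) (\<phi> t) * (poly W t / (poly q t)\<^sup>2) = (poly v (\<phi> t))\<^sup>2"
    proof -
      have "poly u (\<phi> t) = t * poly v (\<phi> t)" using zero[OF elim] by simp
      then have c: "poly (cleared_deriv v u) (\<phi> t) = poly v (\<phi> t) * (poly (pderiv u) (\<phi> t) - t * poly (pderiv v) (\<phi> t))"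
        by (simp add: cleared_deriv_def algebra_simps)
      show ?thesis unfolding c mult.assoc e by (simp add: power2_eq_square)
    qed
    then have "poly (cleared_deriv v u) (\<phi> t) * poly W t = (poly v (\<phi> t))\<^sup>2 * (poly q t)\<^sup>2"
      using elim by (simp add: field_simps)
    then have "poly q t ^ (2 * n - 2) * (poly (cleared_deriv v u) (\<phi> t) * poly W t) =
        (poly q t ^ (2 * n - 2) * (poly q t)\<^sup>2) * (poly v (\<phi> t))\<^sup>2" by (simp add: mult_ac)
    also have "poly q t ^ (2 * n - 2) * (poly q t)\<^sup>2 = (poly q t ^ n)\<^sup>2"
    proof -
      have "2 * n - 2 + 2 = n * 2" using n by simp
      then show ?thesis by (metis power_add power_mult)
    qed
    finally show ?case
      using degree_wronskian[OF un vn n] elim vn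
      by (simp add: Vh_def poly_homogenization \<phi>_def power_mult_distrib mult.assoc)
  qed
  then have "W dvd [:\<kappa>\<^sup>2:]" using \<kappa>(2) by (metis dvd_triv_right mult_to_poly power2_eq_square)
  moreover have "is_unit [:\<kappa>\<^sup>2:]" using \<kappa>(1) by (simp add: is_unit_poly_iff dvd_field_iff)
  ultimately have "is_unit W" using dvd_unit_imp_unit by blast
  then obtain \<omega> where "\<omega> \<noteq> 0" "W = [:\<omega>:]" using unit_polyD by blast
  then have "pderiv W = 0" by (simp add: pderiv_pCons)
  then have pp: "pderiv (pderiv p) * q = p * pderiv (pderiv q)"
    by (simp add: W_def cleared_deriv_def pderiv_diff pderiv_mult algebra_simps)
  have small: "degree g \<le> 1" if "g dvd pderiv (pderiv g)" for g :: "real poly"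
  proof (rule ccontr)
    assume g: "\<not> degree g \<le> 1"
    then have "pderiv (pderiv g) \<noteq> 0" by (simp add: pderiv_eq_0_iff degree_pderiv)
    from dvd_imp_degree_le[OF that this] show False using g by (simp add: degree_pderiv)
  qed
  have "q dvd p * pderiv (pderiv q)" using pp by (metis dvd_triv_right)
  then have "q dvd pderiv (pderiv q)" using pq(1) by (simp add: coprime_commute coprime_dvd_mult_right_iff)
  moreover have "p dvd pderiv (pderiv p) * q" using pp by (metis dvd_triv_left)
  then have "p dvd pderiv (pderiv p)" using pq(1) by (simp add: coprime_dvd_mult_left_iff)
  ultimately show ?thesis using small by blast
qed

lemma degree_le_1_linear:
  assumes "degree (p :: real poly) \<le> 1"
  obtains a b where "p = [:b, a:]"
proof (rule that[of "coeff p 0" "coeff p 1"])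
  show "p = [:coeff p 0, coeff p 1:]"
  proof (rule poly_eqI)
    fix i
    have "coeff p i = 0" if "i \<noteq> 0" "i \<noteq> 1" using assms that by (intro coeff_eq_0) linarith
    then show "coeff p i = coeff [:coeff p 0, coeff p 1:] i"
      by (auto simp: coeff_pCons split: nat.splits)
  qed
qed

text \<open>
  The degrees are at most one by the previous result; a vanishing determinant would make \<open>\<phi>\<close> constant.
\<close>

lemma moebius_if_left_invertible:
  assumes nonconst: "\<And>s. finite {t. ratfun_value \<phi> t s}"
    and inverse: "\<forall>\<^sub>F t in cofinite. \<exists>s. ratfun_value \<phi> t s \<and> ratfun_value \<psi> s t"
  shows "moebius_transformation \<phi>"
proof -
  define p where "p = fst (quot_of_fract \<phi>)"
  define q where "q = snd (quot_of_fract \<phi>)"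
  define u where "u = fst (quot_of_fract \<psi>)"
  define v where "v = snd (quot_of_fract \<psi>)"
  have "degree p \<le> 1 \<and> degree q \<le> 1"
  proof (rule left_invertible_rational_function_degree[of p q u v])
    show "coprime p q" "coprime u v" "q \<noteq> 0"
      by (simp_all add: p_def q_def u_def v_def coprime_quot_of_fract)
    show "\<forall>\<^sub>F t in cofinite. poly u (poly p t / poly q t) = t * poly v (poly p t / poly q t)"
      using inverse
      by eventually_elim
        (auto simp: ratfun_value_def ratfun_defined_at_def ratfun_at_def p_def q_def u_def v_def divide_eq_eq)
  qed
  then obtain \<alpha> \<beta> \<gamma> \<delta> where pq: "p = [:\<beta>, \<alpha>:]" "q = [:\<delta>, \<gamma>:]"
    by (metis degree_le_1_linear)
  have "\<alpha> * \<delta> - \<beta> * \<gamma> \<noteq> 0"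
  proof
    assume det: "\<alpha> * \<delta> - \<beta> * \<gamma> = 0"
    have "q \<noteq> 0" by (simp add: q_def)
    then have fin: "finite {t. poly q t = 0}" by (rule poly_roots_finite)
    then obtain t0 where t0: "poly q t0 \<noteq> 0"
      using ex_new_if_finite[OF infinite_UNIV_char_0[where 'a = real] fin] by blast
    have "{t. poly q t \<noteq> 0} \<subseteq> {t. ratfun_value \<phi> t (poly p t0 / poly q t0)}"
    proof safe
      fix t assume t: "poly q t \<noteq> 0"
      have "poly p t * poly q t0 = poly p t0 * poly q t"
        using det unfolding pq by (simp, algebra)
      then have "poly p t / poly q t = poly p t0 / poly q t0" using t t0 by (simp add: field_simps)
      then show "ratfun_value \<phi> t (poly p t0 / poly q t0)"
        using t by (simp add: ratfun_value_def ratfun_defined_at_def ratfun_at_def p_def q_def)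
    qed
    then have "finite {t. poly q t \<noteq> 0}" using nonconst finite_subset by blast
    then have "finite ({t. poly q t \<noteq> 0} \<union> {t. poly q t = 0})" using fin by simp
    moreover have "{t. poly q t \<noteq> 0} \<union> {t. poly q t = 0} = UNIV" by blast
    ultimately show False using infinite_UNIV_char_0[where 'a = real] by simp
  qed
  moreover have "\<phi> = Fract [:\<beta>, \<alpha>:] [:\<delta>, \<gamma>:]" using pq by (metis p_def q_def Fract_quot_of_fract)
  ultimately show ?thesis unfolding moebius_transformation_def by blast
qed

section \<open>Symmetries of canal surfaces\<close>

text \<open>
  Covers radius zero, where the circles are the points of the spine.
\<close>

lemma (in canal_family) vanishing_on_infinitely_many_whole_circles:
  assumes F: "real_polynomial_function F" and inf: "infinite {t. poly w t \<noteq> 0 \<and> (\<forall>x\<in>circle t. F x = 0)}"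
    and x: "x \<in> sweep"
  shows "F x = 0"
proof (cases "R = 0")
  case False
  have "infinite ({t. poly w t \<noteq> 0 \<and> (\<forall>x\<in>circle t. F x = 0)} - {t. poly R t = 0})"
    using inf poly_roots_finite[OF False] by (rule Diff_infinite_finite[rotated])
  moreover have "infinite {x \<in> circle t. F x = 0}"
    if "poly w t \<noteq> 0" "poly R t \<noteq> 0" "\<forall>x\<in>circle t. F x = 0" for t
  proof -
    have "{x \<in> circle t. F x = 0} = circle t" using that(3) by blast
    then show ?thesis using infinite_circle[OF that(1,2)] by simp
  qed
  then have "{t. poly w t \<noteq> 0 \<and> (\<forall>x\<in>circle t. F x = 0)} - {t. poly R t = 0}
      \<subseteq> {t. poly w t \<noteq> 0 \<and> infinite {x \<in> circle t. F x = 0}}" by auto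
  ultimately have "infinite {t. poly w t \<noteq> 0 \<and> infinite {x \<in> circle t. F x = 0}}"
    using infinite_super by blast
  then show ?thesis using vanishing_on_infinitely_many_circles[OF F _ x] by blast
next
  case True
  have poly_R: "poly R t = 0" for t using True by simp
  have point: "circle t = {center t}" if "poly w t \<noteq> 0" for t
    using that poly_R by (auto simp: circle_def Y_eq)
  have "{t. poly w t \<noteq> 0 \<and> (\<forall>x\<in>circle t. F x = 0)} \<subseteq> {t. poly w t \<noteq> 0 \<and> F (center t) = 0}"
    using point by auto
  with inf have "infinite {t. poly w t \<noteq> 0 \<and> F (center t) = 0}" using infinite_super by blast
  moreover obtain t where "poly w t \<noteq> 0" "x = center t" using x point by (auto simp: sweep_def)
  ultimately show ?thesis using center_zero[OF F] by blast
qed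

text \<open>
  On the complement \<open>V\<close> of a finite set, the derivatives of \<open>f \<circ> c = c \<circ> \<phi>\<close> and \<open>r\<^sup>2 = r\<^sup>2 \<circ> \<phi>\<close> show that \<open>f\<close>
  maps the circle at \<open>t\<close> onto the circle at \<open>\<phi> t\<close>. Working with \<open>r\<^sup>2\<close> avoids the choice of a sign.
\<close>

lemma symmetry_of_canal_surface:
  fixes Q :: "real^3^3"
  assumes fam: "sphere_family c r" and Q: "orthogonal_matrix Q"
    and moeb: "moebius_transformation \<phi>"
    and C1: "affine_image_curve Q b c = curve_compose c \<phi>" and C2: "r\<^sup>2 = (ratfun_compose r \<phi>)\<^sup>2"
  shows "(\<lambda>x. Q *v x + b) ` canal_surface c r = canal_surface c r"
proof -
  define f where "f = (\<lambda>x. Q *v x + b)"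
  define g where "g = (\<lambda>x. transpose Q *v x + - (transpose Q *v b))"
  have fg: "f (g x) = x" "g (f x) = x" for x
    using orthogonal_affine_inverse[OF Q] by (simp_all add: f_def g_def)
  obtain \<alpha> \<beta> \<gamma> \<delta> where det: "\<alpha> * \<delta> - \<beta> * \<gamma> \<noteq> 0" and \<phi>: "\<phi> = Fract [:\<beta>, \<alpha>:] [:\<delta>, \<gamma>:]"
    using moeb unfolding moebius_transformation_def by blast
  define h where "h = (\<lambda>t. poly [:\<beta>, \<alpha>:] t / poly [:\<delta>, \<gamma>:] t)"
  obtain w C R where rep: "represents c r w C R" by (rule representation_exists)
  interpret canal_family w C R by (rule represents_family[OF rep fam])
  have val: "curve_value c t (center t)" "ratfun_value r t (poly R t / poly w t)" if "poly w t \<noteq> 0" for t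
    using rep that by (simp_all add: represents_def curve_value_iff ratfun_value_def center_def)
  have S: "canal_surface c r = zariski_closure sweep" by (rule represents_canal_surface[OF rep]) unfold_locales
  have fibre: "finite {t. poly [:\<delta>, \<gamma>:] t \<noteq> 0 \<and> h t = s}" for s
  proof -
    have "[:\<beta>, \<alpha>:] - smult s [:\<delta>, \<gamma>:] \<noteq> 0" using det by auto
    then have "finite {t. poly ([:\<beta>, \<alpha>:] - smult s [:\<delta>, \<gamma>:]) t = 0}" by (rule poly_roots_finite)
    then show ?thesis by (rule finite_subset[rotated]) (auto simp: h_def divide_eq_eq algebra_simps)
  qed
  define V where "V = {t. poly [:\<delta>, \<gamma>:] t \<noteq> 0 \<and> poly w t \<noteq> 0 \<and> poly w (h t) \<noteq> 0}"
  have "finite (- V)"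
  proof -
    have "[:\<delta>, \<gamma>:] \<noteq> 0" using det by auto
    then have "finite ({t. poly [:\<delta>, \<gamma>:] t = 0} \<union> {t. poly w t = 0} \<union>
        (\<Union>s\<in>{s. poly w s = 0}. {t. poly [:\<delta>, \<gamma>:] t \<noteq> 0 \<and> h t = s}))"
      using fibre w_nonzero by (intro finite_UnI finite_UN_I poly_roots_finite) auto
    then show ?thesis by (rule finite_subset[rotated]) (auto simp: V_def)
  qed
  then have openV: "open V" using finite_imp_closed[of "- V"] by (simp add: closed_def)
  have infV: "infinite V"
    using \<open>finite (- V)\<close> infinite_UNIV_char_0[where 'a = real] by (metis Compl_partition finite_Un)
  have value_h: "ratfun_value \<phi> t (h t)" if "t \<in> V" for t
    unfolding \<phi> h_def using that by (intro ratfun_value_Fract) (simp add: V_def)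
  have center_h: "f (center t) = center (h t)" if t: "t \<in> V" for t
  proof -
    have "curve_value (affine_image_curve Q b c) t (f (center t))"
      unfolding f_def using t by (intro curve_value_affine val) (simp add: V_def)
    moreover have "curve_value (affine_image_curve Q b c) t (center (h t))"
      unfolding C1 using t by (intro curve_value_compose[OF value_h[OF t]] val) (simp add: V_def)
    ultimately show ?thesis by (simp add: curve_value_iff)
  qed
  define \<rho> where "\<rho> = (\<lambda>t. (poly R t / poly w t)\<^sup>2)"
  have rho_h: "\<rho> t = \<rho> (h t)" if t: "t \<in> V" for t
  proof -
    have "ratfun_value (r\<^sup>2) t (\<rho> t)"
      unfolding \<rho>_def using t by (intro ratfun_value_power2 val) (simp add: V_def)
    moreover have "ratfun_value (r\<^sup>2) t (\<rho> (h t))"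
      unfolding C2 \<rho>_def using t
      by (intro ratfun_value_power2 ratfun_value_compose[OF value_h[OF t]] val) (simp add: V_def)
    ultimately show ?thesis by (rule ratfun_value_unique)
  qed
  have circle_h: "f x \<in> circle (h t) \<longleftrightarrow> x \<in> circle t" if t: "t \<in> V" for t x
  proof -
    define e where "e = poly (cleared_deriv [:\<delta>, \<gamma>:] [:\<beta>, \<alpha>:]) t / (poly [:\<delta>, \<gamma>:] t)\<^sup>2"
    have wt: "poly w t \<noteq> 0" "poly w (h t) \<noteq> 0" "poly [:\<delta>, \<gamma>:] t \<noteq> 0" using t by (auto simp: V_def)
    have dh: "(h has_real_derivative e) (at t)"
      unfolding h_def e_def by (rule rational_function_has_real_derivative[OF wt(3)])
    have "poly (cleared_deriv [:\<delta>, \<gamma>:] [:\<beta>, \<alpha>:]) t = \<alpha> * \<delta> - \<beta> * \<gamma>"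
      by (simp add: cleared_deriv_def pderiv_pCons algebra_simps)
    then have e: "e \<noteq> 0" using det wt by (simp add: e_def)
    define D where "D = (\<lambda>t. (1 / (poly w t)\<^sup>2) *\<^sub>R T t)"
    define k where "k = (\<lambda>t. (poly R t / poly w t) * (poly U t / (poly w t)\<^sup>2))"
    have D: "(center has_vector_derivative D t) (at t)" if "poly w t \<noteq> 0" for t
      unfolding D_def by (rule center_has_vector_derivative[OF that])
    have k: "(\<rho> has_real_derivative 2 * k t) (at t)" if "poly w t \<noteq> 0" for t
      unfolding \<rho>_def k_def
      using DERIV_power[OF radius_has_real_derivative[OF that], of 2] by (simp add: mult_ac)
    have "((\<lambda>s. f (center s)) has_vector_derivative Q *v D t) (at t)"
      using bounded_linear.has_vector_derivative[OF matrix_vector_mul_bounded_linear D[OF wt(1)]]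
      by (simp only: f_def has_vector_derivative_add_const)
    moreover have "((\<lambda>s. f (center s)) has_vector_derivative e *\<^sub>R D (h t)) (at t)"
      by (rule has_vector_derivative_transform_within_open[OF _ openV t])
        (use vector_diff_chain_at[OF dh[unfolded has_real_derivative_iff_has_vector_derivative] D[OF wt(2)]]
          center_h in \<open>auto simp: o_def\<close>)
    ultimately have QD: "Q *v D t = e *\<^sub>R D (h t)" by (rule vector_derivative_unique_at)
    have "(\<rho> has_real_derivative (2 * k (h t)) * e) (at t)"
      by (rule has_field_derivative_transform_within_open[OF DERIV_chain2[OF k[OF wt(2)] dh] openV t])
        (use rho_h in auto)
    from DERIV_unique[OF k[OF wt(1)] this] have kk: "k t = e * k (h t)" by simp
    have diff: "f x - center (h t) = Q *v (x - center t)"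
      using center_h[OF t] by (simp add: f_def matrix_vector_mult_diff_distrib flip: center_h[OF t])
    have n: "norm (Q *v y) = norm y" for y
      using orthogonal_matrix_inner[OF Q, of y y] by (simp add: norm_eq_sqrt_inner)
    have "(x - center t) \<bullet> D t + k t = e * ((Q *v (x - center t)) \<bullet> D (h t) + k (h t))"
    proof -
      have "(x - center t) \<bullet> D t = (Q *v (x - center t)) \<bullet> (Q *v D t)" by (simp add: orthogonal_matrix_inner[OF Q])
      also have "\<dots> = e * ((Q *v (x - center t)) \<bullet> D (h t))" unfolding QD by simp
      finally show ?thesis unfolding kk by (simp add: distrib_left)
    qed
    then show ?thesis
      using circle_iff[OF wt(2), of "f x"] circle_iff[OF wt(1), of x] rho_h[OF t] e
      unfolding diff n by (simp add: D_def k_def \<rho>_def)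
  qed
  have vanish: "(\<forall>x\<in>sweep. F (f x) = 0) \<longleftrightarrow> (\<forall>x\<in>sweep. F x = 0)" if F: "real_polynomial_function F" for F
  proof
    assume *: "\<forall>x\<in>sweep. F (f x) = 0"
    have "\<forall>y\<in>circle (h t). F y = 0" if t: "t \<in> V" for t
    proof
      fix y assume "y \<in> circle (h t)"
      then have "g y \<in> circle t" using circle_h[OF t, of "g y"] fg by simp
      then have "g y \<in> sweep" using t by (auto simp: sweep_def V_def)
      then show "F y = 0" using * fg by metis
    qed
    then have "h ` V \<subseteq> {s. poly w s \<noteq> 0 \<and> (\<forall>x\<in>circle s. F x = 0)}" by (auto simp: V_def)
    moreover have "infinite (h ` V)"
    proof
      assume "finite (h ` V)"
      then have "finite (\<Union>s\<in>h ` V. {t. poly [:\<delta>, \<gamma>:] t \<noteq> 0 \<and> h t = s})" using fibre by blast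
      then have "finite V" by (rule finite_subset[rotated]) (auto simp: V_def)
      then show False using infV by blast
    qed
    ultimately have "infinite {s. poly w s \<noteq> 0 \<and> (\<forall>x\<in>circle s. F x = 0)}" using infinite_super by blast
    then show "\<forall>x\<in>sweep. F x = 0" using vanishing_on_infinitely_many_whole_circles[OF F] by blast
  next
    assume *: "\<forall>x\<in>sweep. F x = 0"
    have "\<forall>x\<in>circle t. F (f x) = 0" if t: "t \<in> V" for t
      using circle_h[OF t] t * by (auto simp: sweep_def V_def)
    then have "V \<subseteq> {t. poly w t \<noteq> 0 \<and> (\<forall>x\<in>circle t. F (f x) = 0)}" by (auto simp: V_def)
    then have "infinite {t. poly w t \<noteq> 0 \<and> (\<forall>x\<in>circle t. F (f x) = 0)}" using infV infinite_super by blast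
    moreover have "real_polynomial_function (\<lambda>x. F (f x))" unfolding f_def by (rule real_polynomial_affine[OF F])
    ultimately show "\<forall>x\<in>sweep. F (f x) = 0" using vanishing_on_infinitely_many_whole_circles by blast
  qed
  have "f x \<in> canal_surface c r \<longleftrightarrow> x \<in> canal_surface c r" for x
  proof
    assume fx: "f x \<in> canal_surface c r"
    show "x \<in> canal_surface c r"
      unfolding S zariski_closure_def
    proof (intro CollectI allI impI)
      fix p assume p: "real_polynomial_function p" "\<forall>y\<in>sweep. p y = 0"
      have pg: "real_polynomial_function (\<lambda>x. p (g x))" unfolding g_def by (rule real_polynomial_affine[OF p(1)])
      have "\<forall>y\<in>sweep. p (g y) = 0" using vanish[OF pg] p(2) by (simp add: fg)
      then have "p (g (f x)) = 0" using fx pg unfolding S zariski_closure_def by blast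
      then show "p x = 0" by (simp add: fg)
    qed
  next
    assume x: "x \<in> canal_surface c r"
    show "f x \<in> canal_surface c r"
      unfolding S zariski_closure_def
    proof (intro CollectI allI impI)
      fix p assume p: "real_polynomial_function p" "\<forall>y\<in>sweep. p y = 0"
      have "real_polynomial_function (\<lambda>x. p (f x))" unfolding f_def by (rule real_polynomial_affine[OF p(1)])
      moreover have "\<forall>y\<in>sweep. p (f y) = 0" using vanish[OF p(1)] p(2) by blast
      ultimately show "p (f x) = 0" using x unfolding S zariski_closure_def by blast
    qed
  qed
  then have "f ` canal_surface c r = canal_surface c r"
    by (metis fg(1) image_eqI subsetI subset_antisym image_subsetI)
  then show ?thesis by (simp add: f_def)
qed

lemma represents_spine_zero:
  assumes rep: "represents c r w C R" and rep': "represents c' r' w' C' R'"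
    and spine: "spine_curve c = spine_curve c'" and F: "real_polynomial_function F"
    and zero: "\<And>t. poly w t \<noteq> 0 \<Longrightarrow> F ((1 / poly w t) *\<^sub>R poly_vec C t) = 0" and t: "poly w' t \<noteq> 0"
  shows "F ((1 / poly w' t) *\<^sub>R poly_vec C' t) = 0"
proof -
  have "w \<noteq> 0" using rep by (simp add: represents_def)
  then have "\<forall>\<^sub>F t in cofinite. poly w t \<noteq> 0" by (simp add: eventually_cofinite poly_roots_finite)
  then have "infinite {t. poly w t \<noteq> 0}" by (rule cofinite_imp_infinite)
  then have "infinite {t. curve_defined_at c t \<and> F (curve_at c t) = 0}"
    by (rule infinite_super[rotated]) (use rep zero in \<open>auto simp: represents_def\<close>)
  moreover have "curve_defined_at c' t" using rep' t by (simp add: represents_def)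
  ultimately have "F (curve_at c' t) = 0" by (rule spine_zero[OF spine F])
  moreover have "curve_at c' t = (1 / poly w' t) *\<^sub>R poly_vec C' t" using rep' t by (simp add: represents_def)
  ultimately show ?thesis by simp
qed

lemma collinear_affine_image:
  fixes Q :: "real^3^3"
  assumes "collinear S"
  shows "collinear ((\<lambda>x. Q *v x + b) ` S)"
proof -
  obtain u where u: "\<And>x y. x \<in> S \<Longrightarrow> y \<in> S \<Longrightarrow> \<exists>k. x - y = k *\<^sub>R u"
    using assms unfolding collinear_def by blast
  show ?thesis
    unfolding collinear_def
  proof (intro exI[of _ "Q *v u"] ballI)
    fix x y assume "x \<in> (\<lambda>x. Q *v x + b) ` S" "y \<in> (\<lambda>x. Q *v x + b) ` S"
    then obtain x' y' where xy: "x' \<in> S" "y' \<in> S" "x = Q *v x' + b" "y = Q *v y' + b" by blast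
    then obtain k where "x' - y' = k *\<^sub>R u" using u by blast
    moreover have "x - y = Q *v (x' - y')" by (simp add: xy matrix_vector_mult_diff_distrib)
    ultimately show "\<exists>k. x - y = k *\<^sub>R (Q *v u)" by (auto simp: matrix_vector_mult_scaleR)
  qed
qed

text \<open>
  \<open>radius_condition\<close> for rational curves; \<open>E\<close> is the finite set of poles of the second
  representation.
\<close>

lemma same_radius:
  assumes fam: "sphere_family c r" "sphere_family c2 r"
    and surf: "canal_surface c r = canal_surface c2 r" and spine: "spine_curve c = spine_curve c2"
    and nc: "\<not> collinear (curve_image c)" "\<not> collinear (curve_image c2)" and r: "r \<noteq> 0"
    and P: "real_polynomial_function P" and D: "real_polynomial_function D"
    and proper: "\<forall>\<^sub>F s in cofinite. D (curve_at c2 s) \<noteq> 0 \<and> P (curve_at c2 s) = s * D (curve_at c2 s)"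
  shows "\<exists>E. finite E \<and> (\<forall>\<^sub>F t in cofinite. P (curve_at c t) / D (curve_at c t) \<notin> E \<longrightarrow>
    ratfun_defined_at r (P (curve_at c t) / D (curve_at c t)) \<and>
    (ratfun_at r t)\<^sup>2 = (ratfun_at r (P (curve_at c t) / D (curve_at c t)))\<^sup>2)"
proof -
  obtain w C R where rep: "represents c r w C R" by (rule representation_exists)
  obtain w2 C2 R2 where rep2: "represents c2 r w2 C2 R2" by (rule representation_exists)
  have R_nonzero: "R \<noteq> 0" if rep: "represents c r w C R" for c w C R
  proof
    assume "R = 0"
    have "w \<noteq> 0" using rep by (simp add: represents_def)
    then have "\<forall>\<^sub>F t in cofinite. poly w t \<noteq> 0" by (simp add: eventually_cofinite poly_roots_finite)
    then have "\<forall>\<^sub>F t in cofinite. \<exists>y. ratfun_value r t y \<and> ratfun_value 0 t y"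
    proof eventually_elim
      case (elim t)
      then have "ratfun_value r t 0" using rep \<open>R = 0\<close> by (simp add: represents_def ratfun_value_def)
      moreover have "ratfun_value 0 t 0" by (simp add: ratfun_value_def ratfun_defined_at_def ratfun_at_def)
      ultimately show ?case by blast
    qed
    then have "r = 0" by (rule ratfun_eqI)
    with r show False by blast
  qed
  interpret A: canal_family w C R by (rule represents_family[OF rep fam(1)])
  interpret B: canal_family w2 C2 R2 by (rule represents_family[OF rep2 fam(2)])
  have A_at: "curve_at c t = A.center t" "ratfun_at r t = poly R t / poly w t" if "poly w t \<noteq> 0" for t
    using rep that by (simp_all add: represents_def A.center_def)
  have B_at: "curve_at c2 t = B.center t" "ratfun_defined_at r t" "ratfun_at r t = poly R2 t / poly w2 t"
    if "poly w2 t \<noteq> 0" for t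
    using rep2 that by (simp_all add: represents_def B.center_def)
  interpret canal_pair w C R w2 C2 R2 P D
  proof unfold_locales
    show "R \<noteq> 0" "R2 \<noteq> 0" using R_nonzero rep rep2 by blast+
    show "\<exists>t. A.T t \<times> A.T' t \<noteq> 0" by (rule represents_curved[OF rep A.canal_family_axioms nc(1)])
    show "\<exists>t. B.T t \<times> B.T' t \<noteq> 0" by (rule represents_curved[OF rep2 B.canal_family_axioms nc(2)])
    show "real_polynomial_function P" "real_polynomial_function D" by (rule P, rule D)
    show "\<forall>\<^sub>F s in cofinite. D (B.center s) \<noteq> 0 \<and> P (B.center s) = s * D (B.center s)"
      using proper B.cofinite_w by eventually_elim (simp add: B_at)
    fix F :: "real^3 \<Rightarrow> real" assume F: "real_polynomial_function F"
    show "(\<forall>x\<in>A.sweep. F x = 0) \<longleftrightarrow> (\<forall>x\<in>B.sweep. F x = 0)"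
      using surf represents_canal_surface[OF rep A.canal_family_axioms]
        represents_canal_surface[OF rep2 B.canal_family_axioms] vanishing_on_zariski_closure[OF F] by metis
    show "(\<forall>t. poly w t \<noteq> 0 \<longrightarrow> F (A.center t) = 0) \<longleftrightarrow> (\<forall>s. poly w2 s \<noteq> 0 \<longrightarrow> F (B.center s) = 0)"
      using represents_spine_zero[OF rep rep2 spine F] represents_spine_zero[OF rep2 rep spine[symmetric] F]
      unfolding A.center_def B.center_def by blast
  qed
  have "finite {s. poly w2 s = 0}" using B.w_nonzero by (rule poly_roots_finite)
  moreover have "\<forall>\<^sub>F t in cofinite. P (curve_at c t) / D (curve_at c t) \<notin> {s. poly w2 s = 0} \<longrightarrow>
    ratfun_defined_at r (P (curve_at c t) / D (curve_at c t)) \<and>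
    (ratfun_at r t)\<^sup>2 = (ratfun_at r (P (curve_at c t) / D (curve_at c t)))\<^sup>2"
    using radius_condition A.cofinite_w
  proof eventually_elim
    case (elim t)
    show ?case
    proof
      assume "P (curve_at c t) / D (curve_at c t) \<notin> {s. poly w2 s = 0}"
      then have s: "poly w2 (P (A.center t) / D (A.center t)) \<noteq> 0" by (simp add: A_at elim(2))
      show "ratfun_defined_at r (P (curve_at c t) / D (curve_at c t)) \<and>
        (ratfun_at r t)\<^sup>2 = (ratfun_at r (P (curve_at c t) / D (curve_at c t)))\<^sup>2"
        unfolding A_at[OF elim(2)] B_at(3)[OF s]
        using elim(1) s B_at(2)[OF s] by (simp add: power_divide eq_divide_eq)
    qed
  qed
  ultimately show ?thesis by blast
qed

text \<open>
  The second family is the image under the inverse isometry. The function \<open>\<phi>\<close> takes every value finitely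
  often, since \<open>c t = f\<^sup>-\<^sup>1 (c (\<phi> t))\<close> determines \<open>t\<close>; therefore finitely many exceptional values of \<open>\<phi>\<close>
  exclude finitely many parameters only.
\<close>

lemma parameter_change_of_symmetry:
  fixes Q :: "real^3^3"
  assumes proper: "proper_curve c" and fam: "sphere_family c r"
    and nc: "\<not> collinear (curve_image c)" and nd: "\<not> dupin_cyclide (canal_surface c r)"
    and Q: "orthogonal_matrix Q"
    and sym: "(\<lambda>x. Q *v x + b) ` canal_surface c r = canal_surface c r"
  shows "\<exists>\<phi>. moebius_transformation \<phi> \<and> affine_image_curve Q b c = curve_compose c \<phi> \<and> r\<^sup>2 = (ratfun_compose r \<phi>)\<^sup>2"
proof -
  define f where "f = (\<lambda>x. Q *v x + b)"
  define b' where "b' = - (transpose Q *v b)"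
  define g where "g = (\<lambda>x. transpose Q *v x + b')"
  have fg: "f (g x) = x" "g (f x) = x" for x
    using orthogonal_affine_inverse[OF Q] by (simp_all add: f_def g_def b'_def)
  have Q': "orthogonal_matrix (transpose Q)" using Q by simp
  define c1 where "c1 = affine_image_curve Q b c"
  define c2 where "c2 = affine_image_curve (transpose Q) b' c"
  note im1 = isometric_image[OF Q fam, where b = b, folded c1_def f_def]
  note im2 = isometric_image[OF Q' fam, where b = b', folded c2_def g_def]
  have at1: "curve_at c1 t = f (curve_at c t)" if "curve_defined_at c t" for t
    using im1(2)[OF that] by (simp add: f_def)
  have at2: "curve_at c2 t = g (curve_at c t)" if "curve_defined_at c t" for t
    using im2(2)[OF that] by (simp add: g_def)
  have gf_image: "g ` f ` X = X" "f ` g ` X = X" for X using fg by (auto simp: image_image)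
  have surf2: "canal_surface c r = canal_surface c2 r"
    using im2(4) sym gf_image(1)[of "canal_surface c r"] by (simp add: f_def)
  have spine2: "spine_curve c = spine_curve c2"
    using nd fam im2(3) surf2 unfolding dupin_cyclide_def by blast
  have "spine_curve c = g ` spine_curve c" using spine2 im2(5) by (rule trans)
  then have "f ` spine_curve c = f ` g ` spine_curve c" by (rule arg_cong)
  then have spine1: "spine_curve c = spine_curve c1" by (simp only: im1(5) gf_image(2))
  obtain P D where P: "real_polynomial_function P" and D: "real_polynomial_function D"
    and PD: "\<forall>\<^sub>F t in cofinite. curve_defined_at c t \<and> D (curve_at c t) \<noteq> 0 \<and> P (curve_at c t) / D (curve_at c t) = t"
    using proper unfolding proper_curve_def by blast
  obtain \<phi> where \<phi>: "\<forall>\<^sub>F t in cofinite. ratfun_value \<phi> t (P (curve_at c1 t) / D (curve_at c1 t)) \<and>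
     curve_value c (P (curve_at c1 t) / D (curve_at c1 t)) (curve_at c1 t)"
    by (rule spine_parameter_change[OF spine1 P D PD])
  obtain \<psi> where \<psi>: "\<forall>\<^sub>F t in cofinite. ratfun_value \<psi> t (P (curve_at c2 t) / D (curve_at c2 t)) \<and>
     curve_value c (P (curve_at c2 t) / D (curve_at c2 t)) (curve_at c2 t)"
    by (rule spine_parameter_change[OF spine2 P D PD])
  have fibre: "finite {t. ratfun_value \<phi> t s}" for s
  proof -
    have "\<forall>\<^sub>F t in cofinite. ratfun_value \<phi> t s \<longrightarrow> t = P (g (curve_at c s)) / D (g (curve_at c s))"
      using \<phi> PD
    proof eventually_elim
      case (elim t)
      show ?case
      proof
        assume "ratfun_value \<phi> t s"
        then have "P (curve_at c1 t) / D (curve_at c1 t) = s" using elim ratfun_value_unique by blast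
        then have "curve_at c s = f (curve_at c t)" using elim at1 by (simp add: curve_value_iff)
        then have "g (curve_at c s) = curve_at c t" by (simp add: fg)
        then show "t = P (g (curve_at c s)) / D (g (curve_at c s))" using elim by simp
      qed
    qed
    then have "finite ({t. \<not> (ratfun_value \<phi> t s \<longrightarrow> t = P (g (curve_at c s)) / D (g (curve_at c s)))}
        \<union> {P (g (curve_at c s)) / D (g (curve_at c s))})" by (simp add: eventually_cofinite)
    then show ?thesis by (rule finite_subset[rotated]) auto
  qed
  have avoid: "\<forall>\<^sub>F t in cofinite. \<forall>s\<in>E. \<not> ratfun_value \<phi> t s" if "finite E" for E
  proof -
    have "finite (\<Union>s\<in>E. {t. ratfun_value \<phi> t s})" using that fibre by blast
    then show ?thesis unfolding eventually_cofinite by (rule finite_subset[rotated]) auto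
  qed
  have "moebius_transformation \<phi>"
  proof (rule moebius_if_left_invertible[OF fibre])
    define E where "E = {s. \<not> (ratfun_value \<psi> s (P (curve_at c2 s) / D (curve_at c2 s)))}"
    have "\<forall>\<^sub>F s in cofinite. ratfun_value \<psi> s (P (curve_at c2 s) / D (curve_at c2 s))"
      using \<psi> by eventually_elim blast
    then have "finite E" by (simp add: E_def eventually_cofinite)
    from avoid[OF this] \<phi> PD show "\<forall>\<^sub>F t in cofinite. \<exists>s. ratfun_value \<phi> t s \<and> ratfun_value \<psi> s t"
    proof eventually_elim
      case (elim t)
      define s where "s = P (curve_at c1 t) / D (curve_at c1 t)"
      have s: "ratfun_value \<phi> t s" "curve_defined_at c s" "curve_at c s = f (curve_at c t)"
        using elim at1 by (simp_all add: s_def curve_value_iff)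
      have "curve_at c2 s = curve_at c t" using at2[OF s(2)] s(3) by (simp add: fg)
      moreover have "s \<notin> E" using elim s(1) by blast
      ultimately have "ratfun_value \<psi> s t" using elim by (simp add: E_def)
      with s(1) show ?case by blast
    qed
  qed
  moreover have "c1 = curve_compose c \<phi>"
  proof (rule curve_eqI)
    show "\<forall>\<^sub>F t in cofinite. \<exists>y. curve_value c1 t y \<and> curve_value (curve_compose c \<phi>) t y"
      using \<phi> cofinite_curve_defined[of c1]
      by eventually_elim (auto intro!: exI curve_value_compose simp: curve_value_iff[of c1])
  qed
  moreover have "r\<^sup>2 = (ratfun_compose r \<phi>)\<^sup>2"
  proof (cases "r = 0")
    case True
    then show ?thesis by (simp add: ratfun_compose_def)
  next
    case False
    define P2 where "P2 = (\<lambda>x. P (f x))"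
    define D2 where "D2 = (\<lambda>x. D (f x))"
    have "curve_image c = f ` curve_image c2"
      using im2(1) at2 by (auto simp: curve_image_def fg image_iff)
    then have nc2: "\<not> collinear (curve_image c2)"
      using nc collinear_affine_image[of "curve_image c2" Q b] by (auto simp: f_def)
    have proper2: "\<forall>\<^sub>F s in cofinite. D2 (curve_at c2 s) \<noteq> 0 \<and> P2 (curve_at c2 s) = s * D2 (curve_at c2 s)"
      using PD by eventually_elim (auto simp: P2_def D2_def at2 fg divide_eq_eq)
    obtain E where E: "finite E"
      "\<forall>\<^sub>F t in cofinite. P2 (curve_at c t) / D2 (curve_at c t) \<notin> E \<longrightarrow>
        ratfun_defined_at r (P2 (curve_at c t) / D2 (curve_at c t)) \<and>
        (ratfun_at r t)\<^sup>2 = (ratfun_at r (P2 (curve_at c t) / D2 (curve_at c t)))\<^sup>2"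
      using same_radius[OF fam im2(3) surf2 spine2 nc nc2 False _ _ proper2]
        real_polynomial_affine[OF P, of Q b] real_polynomial_affine[OF D, of Q b]
      by (auto simp: P2_def D2_def f_def)
    show ?thesis
    proof (rule ratfun_eqI)
      show "\<forall>\<^sub>F t in cofinite. \<exists>y. ratfun_value (r\<^sup>2) t y \<and> ratfun_value ((ratfun_compose r \<phi>)\<^sup>2) t y"
        using \<phi> E(2) avoid[OF E(1)] cofinite_curve_defined[of c] cofinite_ratfun_defined[of r]
      proof eventually_elim
        case (elim t)
        define s where "s = P (curve_at c1 t) / D (curve_at c1 t)"
        have s: "s = P2 (curve_at c t) / D2 (curve_at c t)" using elim at1 by (simp add: s_def P2_def D2_def)
        have v: "ratfun_value \<phi> t s" using elim by (simp add: s_def)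
        have "s \<notin> E" using elim(3) v by blast
        then have "ratfun_value r s (ratfun_at r s)" "(ratfun_at r t)\<^sup>2 = (ratfun_at r s)\<^sup>2"
          using elim(2) by (simp_all add: s ratfun_value_def)
        then have "ratfun_value ((ratfun_compose r \<phi>)\<^sup>2) t ((ratfun_at r t)\<^sup>2)"
          using ratfun_value_power2[OF ratfun_value_compose[OF v]] by metis
        moreover have "ratfun_value (r\<^sup>2) t ((ratfun_at r t)\<^sup>2)"
          using elim(5) by (intro ratfun_value_power2) (simp add: ratfun_value_def)
        ultimately show ?case by blast
      qed
    qed
  qed
  ultimately show ?thesis unfolding c1_def by blast
qed

theorem theorem7:
  fixes c :: ratcurve and r :: ratfun
    and Q :: "real ^ 3 ^ 3" and b :: "real ^ 3" and f :: "real ^ 3 \<Rightarrow> real ^ 3"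
  assumes "proper_curve c"
    and "sphere_family c r"
    and "\<not> collinear (curve_image c)"
    and "\<not> dupin_cyclide (canal_surface c r)"
    and "orthogonal_matrix Q"
    and "f = (\<lambda>x. Q *v x + b)"
  shows "f ` canal_surface c r = canal_surface c r \<longleftrightarrow>
    (\<exists>\<phi>. moebius_transformation \<phi> \<and>
       affine_image_curve Q b c = curve_compose c \<phi> \<and>
       r\<^sup>2 = (ratfun_compose r \<phi>)\<^sup>2)"
  unfolding assms(6)
  using parameter_change_of_symmetry[OF assms(1-5)] symmetry_of_canal_surface[OF assms(2,5)] by blast

end
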